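(* $\mathrm{MC}(\cup,\cap,+,\times,/)\in\mathrm{NEXP}$.
   Context: Natural numbers include $0$. For $A,B\subseteq\mathbb N$: $A\cup B$, $A\cap B$ are the usual operations, $\overline{A}=\mathbb N\setminus A$, $A+B=\{a+b: a\in A, b\in B\}$, $A\times B=\{a\cdot b: a\in A, b\in B\}$, and $A/B=\{c\in\mathbb N:\exists a\in A\ \exists b\in B\setminus\{0\}: a=c\cdot b\}$ (exact integer division without remainder or rounding). For $\emptyset\ne\mathcal O\subseteq\{\cup,\cap,\overline{\phantom{c}},+,\times,/\}$, an $\mathcal O$-circuit $C=(V,E,g_C,\alpha)$ is a finite acyclic directed multigraph with gate set $V\subseteq\mathbb N$, every gate having indegree $0$, $1$ or $2$, a designated output gate $g_C\in V$, and a labeling $\alpha$: gates of indegree $0$ (input gates) are labeled by natural numbers, gates of indegree $1$ are labeled $\overline{\phantom{c}}$ (allowed only if $\overline{\phantom{c}}\in\mathcal O$), and gates of indegree $2$ are labeled by an operation in $\mathcal O\setminus\{\overline{\phantom{c}}\}$. The result set $I(g)\subseteq\mathbb N$ is defined inductively: $I(g)=\{\alpha(g)\}$ for an input gate; $I(g)=\mathbb N\setminus I(p)$ for a complement gate with predecessor $p$; $I(g)=I(g_1)\,\sigma\,I(g_2)$ for a gate labeled $\sigma$ with predecessors $g_1\le g_2$ (a double edge from one gate gives $g_1=g_2$). $I(C)=I(g_C)$. A circuit is encoded as a bit string listing its gates in reverse topological order, each gate as the triple (gate name, label, list of predecessors), with all numbers (including input labels) in binary; $|C|$ denotes the length of this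 encoding. The membership problem is $\mathrm{MC}(\mathcal O)=\{(C,b): C \text{ is an } \mathcal O\text{-circuit},\ b\in\mathbb N,\ b\in I(C)\}$, with $b$ given in binary; $\mathrm{MC}(\sigma_1,\dots,\sigma_n)$ abbreviates $\mathrm{MC}(\{\sigma_1,\dots,\sigma_n\})$. *)

theory Defs
  imports Main
begin

definition set_plus :: "nat set \<Rightarrow> nat set \<Rightarrow> nat set" where
  "set_plus A B = {a + b | a b. a \<in> A \<and> b \<in> B}"

definition set_times :: "nat set \<Rightarrow> nat set \<Rightarrow> nat set" where
  "set_times A B = {a * b | a b. a \<in> A \<and> b \<in> B}"

definition set_div :: "nat set \<Rightarrow> nat set \<Rightarrow> nat set" where
  "set_div A B = {c. \<exists>a\<in>A. \<exists>b\<in>B - {0}. a = c * b}"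

datatype op = OUn | OInt | OCompl | OPlus | OTimes | ODiv

datatype lab = LInp nat | LOp op

text \<open>A gate is a triple (gate name, label, list of predecessors).
  A circuit is given as a list of gates in reverse topological order
  (every predecessor of a gate occurs later in the list) together with
  a designated output gate.\<close>
type_synonym gate = "nat \<times> lab \<times> nat list"

fun lab_ok :: "op set \<Rightarrow> lab \<Rightarrow> nat \<Rightarrow> bool" where
  "lab_ok Ops (LInp n) k = (k = 0)"
| "lab_ok Ops (LOp OCompl) k = (OCompl \<in> Ops \<and> k = 1)"
| "lab_ok Ops (LOp x) k = (x \<in> Ops \<and> k = 2)"

definition wf_circuit :: "op set \<Rightarrow> nat \<Rightarrow> gate list \<Rightarrow> bool" where
  "wf_circuit Ops out gs \<longleftrightarrow>
     distinct (map fst gs) \<and> out \<in> set (map fst gs) \<and>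
     (\<forall>i < length gs. case gs ! i of (g, l, ps) \<Rightarrow>
        (\<forall>p \<in> set ps. p \<in> set (map fst (drop (Suc i) gs))) \<and> lab_ok Ops l (length ps))"

fun eval_lab :: "lab \<Rightarrow> nat set list \<Rightarrow> nat set" where
  "eval_lab (LInp n) _ = {n}"
| "eval_lab (LOp OCompl) [A] = - A"
| "eval_lab (LOp OUn) [A, B] = A \<union> B"
| "eval_lab (LOp OInt) [A, B] = A \<inter> B"
| "eval_lab (LOp OPlus) [A, B] = set_plus A B"
| "eval_lab (LOp OTimes) [A, B] = set_times A B"
| "eval_lab (LOp ODiv) [A, B] = set_div A B"
| "eval_lab _ _ = {}"

text \<open>Result sets of all gates. Predecessors are sorted, so that a binary gate
  with predecessors g1 \<le> g2 computes I(g1) op I(g2) (relevant for division).\<close>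
fun sem :: "gate list \<Rightarrow> nat \<Rightarrow> nat set" where
  "sem [] = (\<lambda>_. {})"
| "sem ((g, l, ps) # gs) = (let s = sem gs in s(g := eval_lab l (map s (sort ps))))"

fun bin :: "nat \<Rightarrow> bool list" where
  "bin n = (if n < 2 then [n = 1] else bin (n div 2) @ [odd n])"

text \<open>Self-delimiting encoding of a number: each binary digit doubled, then the
  separator 01.\<close>
definition enc_num :: "nat \<Rightarrow> bool list" where
  "enc_num n = concat (map (\<lambda>b. [b, b]) (bin n)) @ [False, True]"

fun op_code :: "op \<Rightarrow> nat" where
  "op_code OUn = 1" | "op_code OInt = 2" | "op_code OCompl = 3"
| "op_code OPlus = 4" | "op_code OTimes = 5" | "op_code ODiv = 6"

fun enc_lab :: "lab \<Rightarrow> bool list" where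
  "enc_lab (LInp n) = enc_num 0 @ enc_num n"
| "enc_lab (LOp x) = enc_num (op_code x)"

fun enc_gate :: "gate \<Rightarrow> bool list" where
  "enc_gate (g, l, ps) = enc_num g @ enc_lab l @ enc_num (length ps) @ concat (map enc_num ps)"

definition enc_instance :: "nat \<Rightarrow> gate list \<Rightarrow> nat \<Rightarrow> bool list" where
  "enc_instance out gs b =
     enc_num out @ enc_num (length gs) @ concat (map enc_gate gs) @ enc_num b"

definition MC :: "op set \<Rightarrow> bool list set" where
  "MC Ops = {enc_instance out gs b | out gs b. wf_circuit Ops out gs \<and> b \<in> sem gs out}"

text \<open>Single-tape NTM: states and tape symbols are natural numbers; start state 0,
  accepting state 1; blank symbol 0, input bits False/True are symbols 1/2.
  A machine is a finite transition relation of tuples (q, a, q', a', d) with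
  head move d \<in> {-1,0,1}.\<close>
type_synonym ntm = "(nat \<times> nat \<times> nat \<times> nat \<times> int) set"
type_synonym config = "nat \<times> (int \<Rightarrow> nat) \<times> int"

definition ntm_step :: "ntm \<Rightarrow> config \<Rightarrow> config \<Rightarrow> bool" where
  "ntm_step M c c' \<longleftrightarrow> (case c of (q, t, h) \<Rightarrow> case c' of (q', t', h') \<Rightarrow>
      \<exists>a' d. (q, t h, q', a', d) \<in> M \<and> d \<in> {-1, 0, 1} \<and> t' = t(h := a') \<and> h' = h + d)"

definition sym_of :: "bool \<Rightarrow> nat" where
  "sym_of b = (if b then 2 else 1)"

definition init_config :: "bool list \<Rightarrow> config" where
  "init_config w = (0, \<lambda>i. if 0 \<le> i \<and> i < int (length w) then sym_of (w ! nat i) else 0, 0)"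

definition accepts_within :: "ntm \<Rightarrow> bool list \<Rightarrow> nat \<Rightarrow> bool" where
  "accepts_within M w T \<longleftrightarrow>
     (\<exists>k \<le> T. \<exists>q t h. (ntm_step M ^^ k) (init_config w) (q, t, h) \<and> q = 1)"

text \<open>NEXP = union over k of NTIME(2^(n^k)); we use the (equivalent) bound 2^((n+1)^k).\<close>
definition NEXP :: "bool list set set" where
  "NEXP = {L. \<exists>M k. finite M \<and>
            (\<forall>w. w \<in> L \<longleftrightarrow> accepts_within M w (2 ^ ((length w + 1) ^ k)))}"

end

theory Submission
  imports Defs "HOL-Library.Countable"
begin

text \<open>
  All result sets are finite: a quotient never exceeds its dividend (and \<open>0 / b = 0\<close>), so the elements
  of the result sets of a circuit \<open>C\<close> are below \<open>2 ^ (|C| * 2 ^ |C|)\<close> and have exponentially many digits. Hence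
  \<open>b \<in> I(C)\<close> is certified by a proof tree of exponential size: a value of a gate is justified by guessed
  values of its predecessors, down to the input gates. As the gates are listed in reverse topological
  order, a single pass over the list suffices: the machine keeps a list of pending obligations, and at
  each gate replaces those that concern it by at most two obligations each on later gates. Existence
  of predecessors and distinctness of names are checked by obligations of two further kinds.

  The machine is written in a small language of nondeterministic programs over finitely many stacks,
  which compiles to one-tape machines with polynomial overhead: the machine state is the list of programs
  that remain to be run, and only finitely many such continuations are reachable.
\<close>

section \<open>Stack programs and their compilation to one-tape machines\<close>

text \<open>No clock is built into the program. A run under any loop bound \<open>N\<close>
  certifies membership, and an instance has a run under one explicit exponential \<open>N\<close>;
  this asymmetry lets a generous time bound serve both directions of the equivalence in
  \<open>NEXP\<close>.

  The programs have no negation, and a failed test merely kills the run. Every test therefore needs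
  a positive form: an order relation is a guessed difference, a product a chain of guessed
  subtractions, a decrement a guessed predecessor. Addition of digit strings is the only arithmetic
  carried out.

  The encoding puts the target \<open>b\<close> after the gates, although the first obligation
  mentions it. It is guessed at the start and compared with the input at the end.

  Most \<open>exec_...\<close> lemmas are equivalences, so that one statement serves soundness and
  completeness. From multiplication upwards the exact size conditions become unwieldy, and the two
  directions are proved separately, with size conditions only in the second.\<close>

datatype ('r, 's) prog =
    Push 'r 's
  | Pop 'r 's
  | Emp 'r
  | Seq "('r, 's) prog" "('r, 's) prog" (infixr ";;" 60)
  | Alt "('r, 's) prog" "('r, 's) prog" (infixr "[+]" 55)
  | Star "('r, 's) prog"

instance prog :: (countable, countable) countable
  by countable_datatype

fun iterate :: "('a \<Rightarrow> 'a \<Rightarrow> bool) \<Rightarrow> nat \<Rightarrow> 'a \<Rightarrow> 'a \<Rightarrow> bool" where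
  "iterate R 0 s s' = (s' = s)"
| "iterate R (Suc k) s s' = (\<exists>u. R s u \<and> iterate R k u s')"

text \<open>The parameter \<open>N\<close> bounds the number of iterations of every loop. Running time is then a
  polynomial in \<open>N\<close> for a fixed program (\<open>cost\<close>), so no time analysis of individual programs is needed.\<close>

primrec exec :: "nat \<Rightarrow> ('r, 's) prog \<Rightarrow> ('r \<Rightarrow> 's list) \<Rightarrow> ('r \<Rightarrow> 's list) \<Rightarrow> bool" where
  "exec N (Push r a) = (\<lambda>s s'. s' = s(r := a # s r))"
| "exec N (Pop r a) = (\<lambda>s s'. \<exists>l. s r = a # l \<and> s' = s(r := l))"
| "exec N (Emp r) = (\<lambda>s s'. s r = [] \<and> s' = s)"
| "exec N (p ;; q) = (\<lambda>s s'. \<exists>u. exec N p s u \<and> exec N q u s')"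
| "exec N (p [+] q) = (\<lambda>s s'. exec N p s s' \<or> exec N q s s')"
| "exec N (Star p) = (\<lambda>s s'. \<exists>k\<le>N. iterate (exec N p) k s s')"

lemma exec_simps [simp]:
  "exec N (Push r a) s s' \<longleftrightarrow> s' = s(r := a # s r)"
  "exec N (Pop r a) s s' \<longleftrightarrow> (\<exists>l. s r = a # l \<and> s' = s(r := l))"
  "exec N (Emp r) s s' \<longleftrightarrow> s r = [] \<and> s' = s"
  "exec N (p ;; q) s s' \<longleftrightarrow> (\<exists>u. exec N p s u \<and> exec N q u s')"
  "exec N (p [+] q) s s' \<longleftrightarrow> exec N p s s' \<or> exec N q s s'"
  "exec N (Star p) s s' \<longleftrightarrow> (\<exists>k\<le>N. iterate (exec N p) k s s')"
  by simp_all

declare exec.simps [simp del]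

lemma iterate_mono: "(\<And>s s'. R s s' \<Longrightarrow> S s s') \<Longrightarrow> iterate R k s s' \<Longrightarrow> iterate S k s s'"
  by (induction k arbitrary: s) auto

lemma exec_mono: "exec N p s s' \<Longrightarrow> N \<le> N' \<Longrightarrow> exec N' p s s'"
proof (induction p arbitrary: s s')
  case (Star p)
  then obtain k where "k \<le> N" "iterate (exec N p) k s s'" by auto
  moreover have "iterate (exec N' p) k s s'" if "iterate (exec N p) k s s'" for k
    using iterate_mono[OF _ that] Star by blast
  ultimately show ?case using Star.prems by (auto intro: le_trans)
next
  case (Seq p q)
  then show ?case by simp blast
next
  case (Alt p q)
  then show ?case by auto
qed auto

fun exec_list :: "nat \<Rightarrow> ('r, 's) prog list \<Rightarrow> ('r \<Rightarrow> 's list) \<Rightarrow> ('r \<Rightarrow> 's list) \<Rightarrow> bool" where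
  "exec_list N [] s s' = (s' = s)"
| "exec_list N (p # K) s s' = (\<exists>u. exec N p s u \<and> exec_list N K u s')"

lemma exec_list_mono: "exec_list N K s s' \<Longrightarrow> N \<le> N' \<Longrightarrow> exec_list N' K s s'"
  by (induction K arbitrary: s) (auto intro: exec_mono)

section \<open>Small-step semantics over continuation lists\<close>

inductive sstep :: "('r, 's) prog list \<times> ('r \<Rightarrow> 's list) \<Rightarrow> ('r, 's) prog list \<times> ('r \<Rightarrow> 's list) \<Rightarrow> bool" where
  push: "sstep (Push r a # K, s) (K, s(r := a # s r))"
| pop: "s r = a # l \<Longrightarrow> sstep (Pop r a # K, s) (K, s(r := l))"
| emp: "s r = [] \<Longrightarrow> sstep (Emp r # K, s) (K, s)"
| seq: "sstep ((p ;; q) # K, s) (p # q # K, s)"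
| altl: "sstep ((p [+] q) # K, s) (p # K, s)"
| altr: "sstep ((p [+] q) # K, s) (q # K, s)"
| star0: "sstep (Star p # K, s) (K, s)"
| star1: "sstep (Star p # K, s) (p # Star p # K, s)"

text \<open>A single step unfolds at most one loop iteration, and raising the bound by one pays for
  it. Hence a run of \<open>n\<close> steps is an execution with bound \<open>n\<close>, and
  soundness needs no bound known in advance.\<close>

lemma sstep_exec_list:
  assumes "sstep (K, s) (K', u)" and e: "exec_list n K' u s'"
  shows "exec_list (Suc n) K s s'"
proof -
  have e': "exec_list (Suc n) K' u s'" using e by (rule exec_list_mono) simp
  from assms(1) show ?thesis
  proof cases
    case (star0 p)
    then show ?thesis using e' by (auto intro!: exI[of _ s] exI[of _ 0])
  next
    case (star1 p K2)
    then obtain v k w where v: "exec n p s v" "k \<le> n" "iterate (exec n p) k v w" "exec_list n K2 w s'"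
      using e by auto
    have "iterate (exec (Suc n) p) (Suc k) s w"
      using exec_mono[OF v(1), of "Suc n"] iterate_mono[OF exec_mono[of n p _ _ "Suc n"] v(3)] by auto
    then show ?thesis using star1 v(2) exec_list_mono[OF v(4), of "Suc n"] by (auto simp del: iterate.simps)
  qed (use e' in simp; blast)+
qed

lemma steps_exec_list: "(sstep ^^ n) (K, s) ([], s') \<Longrightarrow> exec_list n K s s'"
proof (induction n arbitrary: K s)
  case (Suc n)
  then obtain K' u where "sstep (K, s) (K', u)" "(sstep ^^ n) (K', u) ([], s')"
    by (metis relpowp_Suc_D2 surj_pair)
  then show ?case using Suc.IH sstep_exec_list by blast
qed auto

text \<open>An alternative is charged the sum of its branches instead of the maximum. Then
  \<open>cost\<close> is built from constants, \<open>N\<close>, sums and products only, which is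
  all that \<open>exp_bounded_cost\<close> has to handle.\<close>

primrec cost :: "nat \<Rightarrow> ('r, 's) prog \<Rightarrow> nat" where
  "cost N (Push r a) = 1"
| "cost N (Pop r a) = 1"
| "cost N (Emp r) = 1"
| "cost N (p ;; q) = 1 + (cost N p + cost N q)"
| "cost N (p [+] q) = 1 + (cost N p + cost N q)"
| "cost N (Star p) = 1 + N * (1 + cost N p)"

definition within :: "('a \<Rightarrow> 'a \<Rightarrow> bool) \<Rightarrow> nat \<Rightarrow> 'a \<Rightarrow> 'a \<Rightarrow> bool" where
  "within R n x y \<longleftrightarrow> (\<exists>k\<le>n. (R ^^ k) x y)"

lemma within_refl [simp]: "within R n x x"
  unfolding within_def by (rule exI[of _ 0]) simp

lemma within_step: "R x y \<Longrightarrow> within R n y z \<Longrightarrow> n < m \<Longrightarrow> within R m x z"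
  unfolding within_def by (metis Suc_leI le_less_trans relpowp_Suc_I2)

lemma within_trans: "within R n x y \<Longrightarrow> within R m y z \<Longrightarrow> n + m \<le> k \<Longrightarrow> within R k x z"
  unfolding within_def by (metis (no_types, opaque_lifting) relpowp_trans add_mono le_trans)

lemma exec_steps: "exec N p s u \<Longrightarrow> within sstep (cost N p) (p # K, s) (K, u)"
proof (induction p arbitrary: s u K)
  case (Seq p q)
  then obtain v where v: "exec N p s v" "exec N q v u" by auto
  have "within sstep (cost N p + cost N q) (p # q # K, s) (K, u)"
    using within_trans[OF Seq.IH(1)[OF v(1)] Seq.IH(2)[OF v(2)]] by simp
  then show ?case by (rule within_step[where R = sstep, OF sstep.seq]) simp
next
  case (Alt p q)
  then consider "exec N p s u" | "exec N q s u" by auto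
  then show ?case
  proof cases
    case 1
    then show ?thesis by (rule within_step[where R = sstep, OF sstep.altl Alt.IH(1)]) simp
  next
    case 2
    then show ?thesis by (rule within_step[where R = sstep, OF sstep.altr Alt.IH(2)]) simp
  qed
next
  case (Star p)
  have "within sstep (1 + k * (1 + cost N p)) (Star p # K, s) (K, u)" if "iterate (exec N p) k s u" for k s
    using that
  proof (induction k arbitrary: s)
    case 0
    then show ?case by (auto intro: within_step[where R = sstep, OF sstep.star0 within_refl])
  next
    case (Suc k)
    then obtain v where v: "exec N p s v" "iterate (exec N p) k v u" by auto
    have "within sstep (cost N p + (1 + k * (1 + cost N p))) (p # Star p # K, s) (K, u)"
      using within_trans[OF Star.IH[OF v(1)] Suc.IH[OF v(2)]] by simp
    then show ?case by (rule within_step[where R = sstep, OF sstep.star1]) simp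
  qed
  then obtain k where k: "k \<le> N" "within sstep (1 + k * (1 + cost N p)) (Star p # K, s) (K, u)"
    using Star.prems by auto
  have "1 + k * (1 + cost N p) \<le> cost N (Star p)" using k(1) by (simp add: add_mono mult_le_mono1)
  then show ?case using within_trans[OF k(2) within_refl[of _ 0]] by simp
qed (auto intro: within_step[where R = sstep, OF sstep.push within_refl] within_step[where R = sstep, OF sstep.pop within_refl]
    within_step[where R = sstep, OF sstep.emp within_refl])

text \<open>Comparable to the partial derivatives of a regular expression: the body of
  \<open>Star p\<close> is followed by the loop itself, never by an unfolding, so finitely many
  control points suffice for loops of any length. The exit \<open>K\<close> is not collected, hence
  the \<open>insert K\<close> in \<open>continuations_sstep\<close>.\<close>

primrec continuations :: "('r, 's) prog \<Rightarrow> ('r, 's) prog list \<Rightarrow> ('r, 's) prog list set" where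
  "continuations (Push r a) K = {Push r a # K}"
| "continuations (Pop r a) K = {Pop r a # K}"
| "continuations (Emp r) K = {Emp r # K}"
| "continuations (p ;; q) K = {(p ;; q) # K} \<union> continuations p (q # K) \<union> continuations q K"
| "continuations (p [+] q) K = {(p [+] q) # K} \<union> continuations p K \<union> continuations q K"
| "continuations (Star p) K = {Star p # K} \<union> continuations p (Star p # K)"

lemma finite_continuations: "finite (continuations p K)"
  by (induction p arbitrary: K) auto

lemma continuations_self: "p # K \<in> continuations p K"
  by (cases p) auto

lemma continuations_sstep: "X \<in> continuations p K \<Longrightarrow> sstep (X, s) (Y, u) \<Longrightarrow> Y \<in> insert K (continuations p K)"
proof (induction p arbitrary: K)
  case (Seq p q)
  from Seq.prems consider "X = (p ;; q) # K" | "X \<in> continuations p (q # K)" | "X \<in> continuations q K" by auto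
  then show ?case
  proof cases
    case 1
    then show ?thesis using Seq.prems(2) by (auto elim: sstep.cases simp: continuations_self)
  next
    case 2
    then show ?thesis using Seq.IH(1)[OF 2 Seq.prems(2)] by (auto simp: continuations_self)
  next
    case 3
    then show ?thesis using Seq.IH(2)[OF 3 Seq.prems(2)] by auto
  qed
next
  case (Alt p q)
  from Alt.prems consider "X = (p [+] q) # K" | "X \<in> continuations p K" | "X \<in> continuations q K" by auto
  then show ?case
  proof cases
    case 1
    then show ?thesis using Alt.prems(2) by (auto elim: sstep.cases simp: continuations_self)
  next
    case 2
    then show ?thesis using Alt.IH(1)[OF 2 Alt.prems(2)] by auto
  next
    case 3
    then show ?thesis using Alt.IH(2)[OF 3 Alt.prems(2)] by auto
  qed
next
  case (Star p)
  from Star.prems consider "X = Star p # K" | "X \<in> continuations p (Star p # K)" by auto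
  then show ?case
  proof cases
    case 1
    then show ?thesis using Star.prems(2) by (auto elim: sstep.cases simp: continuations_self)
  next
    case 2
    then show ?thesis using Star.IH[OF 2 Star.prems(2)] by auto
  qed
qed (auto elim: sstep.cases)

text \<open>The tape has one track per stack, with the top of every stack at cell 0. A push carries symbols to
  the right (\<open>Ins\<close>) and returns (\<open>Ret\<close>); a pop runs to the end of the track (\<open>Fwd\<close>) and shifts it
  on the way back (\<open>Bwd\<close>). The blank cell at -1 stops the way back.\<close>

datatype ('r, 's) mode =
    Run "('r, 's) prog list"
  | Ins 'r 's "('r, 's) prog list"
  | Ret 'r "('r, 's) prog list"
  | Fwd 'r 's "('r, 's) prog list"
  | Bwd 'r 's "'s option" "('r, 's) prog list"

instance mode :: (countable, countable) countable
  by countable_datatype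

inductive delta :: "('r, 's) mode \<Rightarrow> ('r \<Rightarrow> 's option) \<Rightarrow> ('r, 's) mode \<Rightarrow> ('r \<Rightarrow> 's option) \<Rightarrow> int \<Rightarrow> bool" where
  seq: "delta (Run ((p ;; q) # K)) f (Run (p # q # K)) f 0"
| altl: "delta (Run ((p [+] q) # K)) f (Run (p # K)) f 0"
| altr: "delta (Run ((p [+] q) # K)) f (Run (q # K)) f 0"
| star0: "delta (Run (Star p # K)) f (Run K) f 0"
| star1: "delta (Run (Star p # K)) f (Run (p # Star p # K)) f 0"
| emp: "f r = None \<Longrightarrow> delta (Run (Emp r # K)) f (Run K) f 0"
| push: "delta (Run (Push r a # K)) f (Ins r a K) f 0"
| ins: "f r = Some b \<Longrightarrow> delta (Ins r a K) f (Ins r b K) (f(r := Some a)) 1"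
| ins_end: "f r = None \<Longrightarrow> delta (Ins r a K) f (Ret r K) (f(r := Some a)) (- 1)"
| ret: "f r = Some b \<Longrightarrow> delta (Ret r K) f (Ret r K) f (- 1)"
| ret_end: "f r = None \<Longrightarrow> delta (Ret r K) f (Run K) f 1"
| pop: "delta (Run (Pop r a # K)) f (Fwd r a K) f 0"
| fwd: "f r = Some b \<Longrightarrow> delta (Fwd r a K) f (Fwd r a K) f 1"
| fwd_end: "f r = None \<Longrightarrow> delta (Fwd r a K) f (Bwd r a None K) f (- 1)"
| bwd: "f r = Some b \<Longrightarrow> delta (Bwd r a c K) f (Bwd r a (Some b) K) (f(r := c)) (- 1)"
| bwd_end: "f r = None \<Longrightarrow> delta (Bwd r a (Some a) K) f (Run K) f 1"

definition tape_of :: "('r \<Rightarrow> 's list) \<Rightarrow> int \<Rightarrow> 'r \<Rightarrow> 's option" where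
  "tape_of s i r = (if 0 \<le> i \<and> i < int (length (s r)) then Some (s r ! nat i) else None)"

text \<open>In the abstract run a push happens when it starts, a pop only when it ends. During
  \<open>Ins\<close> the carried symbol is the entry missing from the tape. During
  \<open>Bwd\<close> the option holds the entry lifted last; it is \<open>None\<close> only at the
  far end, where nothing has been lifted yet.\<close>

fun simulates :: "('r, 's) mode \<Rightarrow> (int \<Rightarrow> 'r \<Rightarrow> 's option) \<Rightarrow> int \<Rightarrow> ('r, 's) prog list \<times> ('r \<Rightarrow> 's list) \<Rightarrow> bool" where
  "simulates (Run K) t h (K', s) = (K' = K \<and> t = tape_of s \<and> h = 0)"
| "simulates (Ins r a K) t h (K', s) = (K' = K \<and>
     (\<exists>l1 l2. s r = l1 @ a # l2 \<and> t = tape_of (s(r := l1 @ l2)) \<and> h = int (length l1)))"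
| "simulates (Ret r K) t h (K', s) = (K' = K \<and> t = tape_of s \<and> - 1 \<le> h \<and> h < int (length (s r)))"
| "simulates (Fwd r a K) t h (K', s) = (K' = Pop r a # K \<and> t = tape_of s \<and> 0 \<le> h \<and> h \<le> int (length (s r)))"
| "simulates (Bwd r a c K) t h (K', s) = (K' = Pop r a # K \<and>
     (\<exists>l1 l2. s r = l1 @ (case c of None \<Rightarrow> [] | Some b \<Rightarrow> [b]) @ l2 \<and> (c = None \<longrightarrow> l2 = []) \<and>
       t = tape_of (s(r := l1 @ l2)) \<and> h = int (length l1) - 1))"

lemma tape_of_replace:
  "(tape_of (s(r := l1 @ b # l2)))(int (length l1) := (tape_of (s(r := l1 @ b # l2)) (int (length l1)))(r := Some a))
    = tape_of (s(r := l1 @ a # l2))"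
proof (intro ext)
  fix i q
  have "(l1 @ b # l2) ! nat i = (l1 @ a # l2) ! nat i" if "0 \<le> i" "i \<noteq> int (length l1)"
    using that by (auto simp: nth_append nth_Cons')
  then show "((tape_of (s(r := l1 @ b # l2)))(int (length l1) := (tape_of (s(r := l1 @ b # l2)) (int (length l1)))(r := Some a))) i q
    = tape_of (s(r := l1 @ a # l2)) i q"
    by (cases "i = int (length l1)"; cases "q = r") (auto simp: tape_of_def)
qed

lemma tape_of_extend:
  "(tape_of (s(r := l)))(int (length l) := (tape_of (s(r := l)) (int (length l)))(r := Some a)) = tape_of (s(r := l @ [a]))"
  by (intro ext) (auto simp: tape_of_def nth_append)

lemma tape_of_shrink:
  "(tape_of (s(r := l @ [b])))(int (length l) := (tape_of (s(r := l @ [b])) (int (length l)))(r := None)) = tape_of (s(r := l))"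
  by (intro ext) (auto simp: tape_of_def nth_append)

lemma tape_of_at: "tape_of (s(r := l1 @ b # l2)) (int (length l1)) r = Some b"
  by (auto simp: tape_of_def nth_append)

lemma tape_of_end: "tape_of (s(r := l)) (int (length l)) r = None"
  by (auto simp: tape_of_def)

lemma tape_of_left: "i < 0 \<Longrightarrow> tape_of s i r = None"
  by (auto simp: tape_of_def)

lemma tape_of_None: "tape_of s 0 r = None \<longleftrightarrow> s r = []"
  by (auto simp: tape_of_def)

lemma tape_of_int: "tape_of (s(r := l)) (int k) r = (if k < length l then Some (l ! k) else None)"
  by (auto simp: tape_of_def)

text \<open>Sweeping moves leave the abstract state unchanged, hence the case \<open>A' = A\<close>.
  A pop of the wrong symbol sweeps as well, but \<open>bwd_end\<close> fires only if the last entry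
  lifted is the expected one, so the machine gets stuck exactly where the program does.\<close>

lemma simulates_step:
  assumes "delta q (t h) q' f' d" "simulates q t h A"
  shows "\<exists>A'. simulates q' (t(h := f')) (h + d) A' \<and> (A' = A \<or> sstep A A')"
proof -
  obtain X s where A: "A = (X, s)" by (cases A)
  from assms(1) show ?thesis
  proof (cases q "t h" q' f' d rule: delta.cases)
    case (push r a K)
    then show ?thesis using assms(2) A
      by (intro exI[of _ "(K, s(r := a # s r))"]) (auto intro: sstep.push intro!: exI[of _ "[]"])
  next
    case (ins r b a K)
    from assms(2) A ins obtain l1 l2 where *: "X = K" "s r = l1 @ a # l2" "t = tape_of (s(r := l1 @ l2))" "h = int (length l1)"
      by auto
    have "l2 \<noteq> []" using ins * by (auto simp: tape_of_int)
    then obtain c l3 where l2: "l2 = c # l3" by (cases l2) auto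
    have b: "c = b" using ins * l2 by (auto simp: tape_of_at)
    have "t(h := f') = tape_of (s(r := (l1 @ [a]) @ l3))"
      using tape_of_replace[of s r l1 b l3 a] * l2 b ins by simp
    then have "simulates (Ins r b K) (t(h := f')) (h + 1) A"
      unfolding A using * l2 b by simp (rule exI[of _ "l1 @ [a]"], rule exI[of _ l3], simp)
    then show ?thesis using ins by (intro exI[of _ A]) simp
  next
    case (ins_end r a K)
    from assms(2) A ins_end obtain l1 l2 where *: "X = K" "s r = l1 @ a # l2" "t = tape_of (s(r := l1 @ l2))" "h = int (length l1)"
      by auto
    have "l2 = []" using ins_end * by (cases l2) (auto simp: tape_of_at)
    then show ?thesis using ins_end * tape_of_extend[of s r l1 a] A
      by (intro exI[of _ A]) (auto simp: fun_upd_idem)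
  next
    case (ret r b K)
    then show ?thesis using assms(2) A
      by (intro exI[of _ A]) (auto simp: tape_of_def split: if_splits)
  next
    case (ret_end r K)
    then show ?thesis using assms(2) A
      by (intro exI[of _ A]) (auto simp: tape_of_def split: if_splits)
  next
    case (fwd r b a K)
    then show ?thesis using assms(2) A
      by (intro exI[of _ A]) (auto simp: tape_of_def split: if_splits)
  next
    case (fwd_end r a K)
    then show ?thesis using assms(2) A
      by (intro exI[of _ A]) (auto simp: tape_of_def split: if_splits intro!: exI[of _ "s r"])
  next
    case (bwd r b a c K)
    from assms(2) A bwd obtain l1 l2 where *: "X = Pop r a # K"
      "s r = l1 @ (case c of None \<Rightarrow> [] | Some b \<Rightarrow> [b]) @ l2" "c = None \<longrightarrow> l2 = []"
      "t = tape_of (s(r := l1 @ l2))" "h = int (length l1) - 1" by auto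
    have "l1 \<noteq> []" using bwd * by (auto simp: tape_of_left)
    then obtain l0 e where l1: "l1 = l0 @ [e]" by (cases l1 rule: rev_cases) auto
    have h: "h = int (length l0)" using * l1 by simp
    have e: "e = b" using bwd * l1 h tape_of_at[of s r l0 e l2] by auto
    show ?thesis
    proof (cases c)
      case None
      then have "simulates (Bwd r a (Some b) K) (t(h := f')) (h - 1) A"
        unfolding A using bwd * l1 e h tape_of_shrink[of s r l0 b]
        by simp (rule exI[of _ l0], rule exI[of _ "[]"], simp)
      then show ?thesis using bwd by (intro exI[of _ A]) simp
    next
      case (Some x)
      then have "simulates (Bwd r a (Some b) K) (t(h := f')) (h - 1) A"
        unfolding A using bwd * l1 e h tape_of_replace[of s r l0 b l2 x]
        by simp (rule exI[of _ l0], rule exI[of _ "x # l2"], simp)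
      then show ?thesis using bwd by (intro exI[of _ A]) simp
    qed
  next
    case (bwd_end r a K)
    from assms(2) A bwd_end obtain l1 l2 where *: "X = Pop r a # K" "s r = l1 @ a # l2"
      "t = tape_of (s(r := l1 @ l2))" "h = int (length l1) - 1" by auto
    have "l1 = []" using bwd_end * tape_of_at[of s r "butlast l1" "last l1" l2]
      by (cases l1 rule: rev_cases) auto
    then show ?thesis using bwd_end * A
      by (intro exI[of _ "(K, s(r := l2))"]) (auto intro: sstep.pop)
  qed (use assms(2) A in \<open>auto simp: tape_of_None intro: sstep.intros\<close>)
qed

section \<open>Finite transition relation and running time\<close>

primrec mode_cont :: "('r, 's) mode \<Rightarrow> ('r, 's) prog list" where
  "mode_cont (Run K) = K"
| "mode_cont (Ins r a K) = K"
| "mode_cont (Ret r K) = K"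
| "mode_cont (Fwd r a K) = K"
| "mode_cont (Bwd r a c K) = K"

text \<open>\<open>delta\<close> ranges over all programs; confining both ends of a move to
  continuations in \<open>S\<close> is what makes the relation finite.\<close>

definition mtrans where
  "mtrans S = {(q, f, q', f', d). delta q f q' f' d \<and> mode_cont q \<in> S \<and> mode_cont q' \<in> S}"

definition mstep :: "('r, 's) prog list set \<Rightarrow> ('r, 's) mode \<times> (int \<Rightarrow> 'r \<Rightarrow> 's option) \<times> int \<Rightarrow>
    ('r, 's) mode \<times> (int \<Rightarrow> 'r \<Rightarrow> 's option) \<times> int \<Rightarrow> bool" where
  "mstep S c c' \<longleftrightarrow> (case c of (q, t, h) \<Rightarrow> case c' of (q', t', h') \<Rightarrow>
     \<exists>f' d. (q, t h, q', f', d) \<in> mtrans S \<and> t' = t(h := f') \<and> h' = h + d)"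

lemma mstepI:
  "delta q (t h) q' f' d \<Longrightarrow> mode_cont q \<in> S \<Longrightarrow> mode_cont q' \<in> S \<Longrightarrow> t' = t(h := f') \<Longrightarrow> h' = h + d \<Longrightarrow>
    mstep S (q, t, h) (q', t', h')"
  by (auto simp: mstep_def mtrans_def)

lemma mstepI0:
  "delta q (t h) q' (t h) d \<Longrightarrow> mode_cont q \<in> S \<Longrightarrow> mode_cont q' \<in> S \<Longrightarrow> h' = h + d \<Longrightarrow>
    mstep S (q, t, h) (q', t, h')"
  by (rule mstepI) auto

lemma finite_mtrans:
  fixes S :: "('r::finite, 's::finite) prog list set"
  assumes "finite S"
  shows "finite (mtrans S)"
proof -
  let ?Q = "Run ` S \<union> (\<lambda>(r, a, K). Ins r a K) ` (UNIV \<times> UNIV \<times> S) \<union> (\<lambda>(r, K). Ret r K) ` (UNIV \<times> S)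
    \<union> (\<lambda>(r, a, K). Fwd r a K) ` (UNIV \<times> UNIV \<times> S) \<union> (\<lambda>(r, a, c, K). Bwd r a c K) ` (UNIV \<times> UNIV \<times> UNIV \<times> S)"
  have Q: "q \<in> ?Q" if "mode_cont q \<in> S" for q :: "('r, 's) mode"
    using that by (cases q) (force simp: image_iff)+
  have "d \<in> {-1, 0, 1}" if "delta q f q' f' d" for q q' :: "('r, 's) mode" and f f' d
    using that by cases auto
  then have "mtrans S \<subseteq> ?Q \<times> UNIV \<times> ?Q \<times> UNIV \<times> {-1, 0, 1}"
    unfolding mtrans_def using Q by blast
  moreover have "finite ?Q" using assms by simp
  ultimately show ?thesis by (meson finite.emptyI finite.insertI finite_SigmaI finite_UNIV finite_subset)
qed

lemma ret_run:
  assumes "K \<in> S" "k \<le> length (s r)"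
  shows "within (mstep S) (k + 1) (Ret r K, tape_of s, int k - 1) (Run K, tape_of s, 0)"
  using assms(2)
proof (induction k)
  case 0
  have "mstep S (Ret r K, tape_of s, int 0 - 1) (Run K, tape_of s, 0)"
    by (rule mstepI0[OF delta.ret_end]) (auto simp: tape_of_def assms)
  then show ?case by (rule within_step[OF _ within_refl]) simp
next
  case (Suc k)
  have "mstep S (Ret r K, tape_of s, int (Suc k) - 1) (Ret r K, tape_of s, int k - 1)"
    using Suc.prems by (intro mstepI0[OF delta.ret[of _ _ "s r ! k"]]) (auto simp: tape_of_def assms)
  then show ?case by (rule within_step[OF _ Suc.IH]) (use Suc.prems in auto)
qed

lemma ins_run:
  assumes "K \<in> S"
  shows "within (mstep S) (2 * length l2 + length l1 + 2)
    (Ins r a K, tape_of (s(r := l1 @ l2)), int (length l1)) (Run K, tape_of (s(r := l1 @ a # l2)), 0)"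
proof (induction l2 arbitrary: l1 a)
  case Nil
  have "mstep S (Ins r a K, tape_of (s(r := l1 @ [])), int (length l1)) (Ret r K, tape_of (s(r := l1 @ [a])), int (length l1) - 1)"
    by (rule mstepI[OF delta.ins_end]) (simp_all add: tape_of_end tape_of_extend assms del: fun_upd_apply)
  then show ?case
    by (rule within_step[OF _ ret_run]) (use assms in auto)
next
  case (Cons b l2)
  have "mstep S (Ins r a K, tape_of (s(r := l1 @ b # l2)), int (length l1))
      (Ins r b K, tape_of (s(r := (l1 @ [a]) @ l2)), int (length (l1 @ [a])))"
    by (rule mstepI[OF delta.ins[of _ _ b]]) (simp_all add: tape_of_at tape_of_replace assms del: fun_upd_apply)
  from within_step[where R = "mstep S" and m = "2 * length (b # l2) + length l1 + 2", OF this Cons.IH]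
  show ?case by (simp del: fun_upd_apply)
qed

lemma fwd_run:
  assumes "K \<in> S" "s r = l1 @ l2"
  shows "within (mstep S) (length l2 + 1)
    (Fwd r a K, tape_of s, int (length l1)) (Bwd r a None K, tape_of s, int (length (s r)) - 1)"
  using assms(2)
proof (induction l2 arbitrary: l1)
  case Nil
  have "mstep S (Fwd r a K, tape_of s, int (length l1)) (Bwd r a None K, tape_of s, int (length (s r)) - 1)"
    by (rule mstepI0[OF delta.fwd_end]) (use Nil assms in \<open>auto simp: tape_of_def\<close>)
  then show ?case by (rule within_step[OF _ within_refl]) simp
next
  case (Cons b l2)
  have "mstep S (Fwd r a K, tape_of s, int (length l1)) (Fwd r a K, tape_of s, int (length (l1 @ [b])))"
    by (rule mstepI0[OF delta.fwd[of _ _ b]]) (use Cons.prems assms in \<open>auto simp: tape_of_def nth_append\<close>)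
  then show ?case by (rule within_step[OF _ Cons.IH]) (use Cons.prems in auto)
qed

lemma bwd_run:
  assumes "K \<in> S" "Pop r a # K \<in> S"
  shows "l1 @ (case c of None \<Rightarrow> [] | Some b \<Rightarrow> [b]) @ l2 = a # l \<Longrightarrow> (c = None \<longrightarrow> l2 = []) \<Longrightarrow>
    within (mstep S) (length l1 + 1)
      (Bwd r a c K, tape_of (s(r := l1 @ l2)), int (length l1) - 1) (Run K, tape_of (s(r := l)), 0)"
proof (induction l1 arbitrary: c l2 rule: rev_induct)
  case Nil
  then have c: "c = Some a" "l2 = l" by (cases c; auto)+
  have "mstep S (Bwd r a c K, tape_of (s(r := [] @ l2)), int (length []) - 1) (Run K, tape_of (s(r := l)), 0)"
    unfolding c by (simp, rule mstepI0[OF delta.bwd_end]) (use assms in \<open>auto simp: tape_of_left\<close>)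
  then show ?case by (rule within_step[OF _ within_refl]) simp
next
  case (snoc b l1)
  let ?l2 = "(case c of None \<Rightarrow> [] | Some b \<Rightarrow> [b]) @ l2"
  have "mstep S (Bwd r a c K, tape_of (s(r := (l1 @ [b]) @ l2)), int (length (l1 @ [b])) - 1)
     (Bwd r a (Some b) K, tape_of (s(r := l1 @ ?l2)), int (length l1) - 1)"
    by (rule mstepI[OF delta.bwd[of _ _ b]])
      (use snoc.prems tape_of_replace[of s r l1 b l2] tape_of_shrink[of s r l1 b] in
        \<open>auto simp: tape_of_at assms simp del: fun_upd_apply split: option.splits\<close>)
  then show ?case by (rule within_step[OF _ snoc.IH]) (use snoc.prems in \<open>auto split: option.splits\<close>)
qed

text \<open>A push or a pop costs one dispatching move and a sweep out and back, at most
  \<open>2 * L + 3\<close> moves together; all other steps are single moves.\<close>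

lemma sstep_run:
  assumes "sstep (K, s) (K', s')" "K \<in> S" "K' \<in> S" and L: "\<And>r. length (s r) \<le> L"
  shows "within (mstep S) (2 * L + 4) (Run K, tape_of s, 0) (Run K', tape_of s', 0)"
proof -
  have stay: ?thesis if "delta (Run K) (tape_of s 0) (Run K') (tape_of s 0) 0" "s' = s"
    unfolding that(2)
    by (rule within_step[where R = "mstep S" and n = 0, OF mstepI0[where t = "tape_of s" and h = 0, OF that(1)]]) (use assms in auto)
  from assms(1) show ?thesis
  proof (cases rule: sstep.cases)
    case (push r a)
    have "mstep S (Run K, tape_of s, 0) (Ins r a K', tape_of (s(r := [] @ s r)), int (length []))"
      using push assms by (simp, intro mstepI0[OF delta.push]) auto
    then show ?thesis
      by (rule within_step) (use push ins_run[of K' S "s r" "[]" r a s] L[of r] assms(3) in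
        \<open>auto elim!: within_trans intro: within_refl[of _ 0]\<close>)
  next
    case (pop r a l)
    have 1: "mstep S (Run K, tape_of s, 0) (Fwd r a K', tape_of s, int (length []))"
      using pop assms by (simp, intro mstepI0[OF delta.pop]) auto
    have "within (mstep S) (length (s r) + 1 + (length (s r) + 1)) (Fwd r a K', tape_of s, int (length [])) (Run K', tape_of s', 0)"
    proof (rule within_trans)
      show "within (mstep S) (length (s r) + 1) (Fwd r a K', tape_of s, int (length [])) (Bwd r a None K', tape_of s, int (length (s r)) - 1)"
        using fwd_run[of K' S s r "[]" "s r" a] assms by simp
      show "within (mstep S) (length (s r) + 1) (Bwd r a None K', tape_of s, int (length (s r)) - 1) (Run K', tape_of s', 0)"
        using bwd_run[of K' S r a "s r" None "[]" l s] pop assms(2,3) by (simp add: fun_upd_idem)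
    qed simp
    then show ?thesis
      by (rule within_step[where R = "mstep S", OF 1]) (use L[of r] in auto)
  qed (rule stay; use assms in \<open>simp add: delta.intros tape_of_None\<close>)+
qed

lemma sstep_length: "sstep (K, s) (K', s') \<Longrightarrow> length (s r) \<le> L \<Longrightarrow> length (s' r) \<le> Suc L"
  by (auto elim!: sstep.cases)

text \<open>A step lengthens a stack by at most one symbol, so no stack outgrows
  \<open>L + n\<close> within \<open>n\<close> steps and each step is charged the sweep for that
  length.\<close>

lemma steps_run:
  assumes S: "\<And>K s K' s'. K \<in> S \<Longrightarrow> sstep (K, s) (K', s') \<Longrightarrow> K' \<in> S"
  shows "(sstep ^^ n) (K, s) (K', s') \<Longrightarrow> K \<in> S \<Longrightarrow> (\<And>r. length (s r) \<le> L) \<Longrightarrow>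
    within (mstep S) (n * (2 * (L + n) + 4)) (Run K, tape_of s, 0) (Run K', tape_of s', 0)"
proof (induction n arbitrary: K s L)
  case (Suc n)
  then obtain X u where X: "sstep (K, s) (X, u)" "(sstep ^^ n) (X, u) (K', s')"
    by (metis relpowp_Suc_D2 surj_pair)
  have "X \<in> S" using S X(1) Suc.prems(2) by blast
  from sstep_run[OF X(1) Suc.prems(2) this Suc.prems(3)]
    Suc.IH[OF X(2) this sstep_length[OF X(1) Suc.prems(3)]]
  show ?case by (rule within_trans) simp
qed simp

lemma msteps_sound:
  "(mstep S ^^ n) (q, t, h) (Run [], t', h') \<Longrightarrow> simulates q t h A \<Longrightarrow> \<exists>m s'. (sstep ^^ m) A ([], s')"
proof (induction n arbitrary: q t h A)
  case 0
  then show ?case by (cases A) (auto intro: exI[of _ 0])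
next
  case (Suc n)
  then obtain q2 t2 h2 where c: "mstep S (q, t, h) (q2, t2, h2)" "(mstep S ^^ n) (q2, t2, h2) (Run [], t', h')"
    by (metis relpowp_Suc_D2 surj_pair)
  then obtain f' d where "delta q (t h) q2 f' d" "t2 = t(h := f')" "h2 = h + d"
    by (auto simp: mstep_def mtrans_def)
  with simulates_step[of q t h q2 f' d A] Suc.prems(2) obtain A' where
    A': "simulates q2 t2 h2 A'" "A' = A \<or> sstep A A'" by blast
  from Suc.IH[OF c(2) A'(1)] A'(2) show ?case by (metis relpowp_Suc_I2)
qed

section \<open>Coding the machine by natural numbers\<close>

lemma Ex_inj_fixing:
  fixes a b c :: "'a :: countable"
  assumes "a \<noteq> b" "a \<noteq> c" "b \<noteq> c"
  shows "\<exists>f :: 'a \<Rightarrow> nat. inj f \<and> f a = 0 \<and> f b = 1 \<and> f c = 2"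
  by (rule exI[of _ "\<lambda>x. if x = a then 0 else if x = b then 1 else if x = c then 2 else to_nat x + 3"])
    (use assms in \<open>auto simp: inj_def\<close>)

lemma ntm_step_code:
  fixes S :: "('r, 's) prog list set"
  assumes "inj f" "inj g"
  defines "M \<equiv> (\<lambda>(q, a, q', a', d). (f q, g a, f q', g a', d)) ` mtrans S"
  shows "ntm_step M (f q, g \<circ> t, h) c \<longleftrightarrow> (\<exists>q' t' h'. c = (f q', g \<circ> t', h') \<and> mstep S (q, t, h) (q', t', h'))"
    (is "?l \<longleftrightarrow> ?r")
proof
  assume ?l
  then obtain x q2 t2 h2 a' d where c: "c = (q2, t2, h2)" "(f q, g (t h), q2, a', d) \<in> M"
    "t2 = (g \<circ> t)(h := a')" "h2 = h + d"
    by (cases c) (auto simp: ntm_step_def)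
  then obtain q' f' where "(q, t h, q', f', d) \<in> mtrans S" "q2 = f q'" "a' = g f'"
    using assms(1,2) by (auto simp: M_def dest!: injD)
  then show ?r using c by (auto simp: mstep_def fun_eq_iff intro!: exI[of _ q'] exI[of _ "t(h := f')"])
next
  assume ?r
  then obtain q' f' d where "c = (f q', g \<circ> t(h := f'), h + d)" "(q, t h, q', f', d) \<in> mtrans S"
    by (auto simp: mstep_def)
  moreover from this have "d \<in> {-1, 0, 1}" by (auto simp: mtrans_def elim: delta.cases)
  ultimately show ?l
    by (auto simp: ntm_step_def M_def fun_upd_comp intro!: exI[of _ "g f'"] exI[of _ d] image_eqI)
qed

lemma ntm_steps_code:
  fixes S :: "('r, 's) prog list set"
  assumes "inj f" "inj g"
  defines "M \<equiv> (\<lambda>(q, a, q', a', d). (f q, g a, f q', g a', d)) ` mtrans S"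
  shows "(ntm_step M ^^ n) (f q, g \<circ> t, h) c \<longleftrightarrow>
    (\<exists>q' t' h'. c = (f q', g \<circ> t', h') \<and> (mstep S ^^ n) (q, t, h) (q', t', h'))"
proof (induction n arbitrary: q t h)
  case (Suc n)
  have "(ntm_step M ^^ Suc n) (f q, g \<circ> t, h) c \<longleftrightarrow>
      (\<exists>u. ntm_step M (f q, g \<circ> t, h) u \<and> (ntm_step M ^^ n) u c)"
    unfolding relpowp_Suc_left OO_def ..
  also have "\<dots> \<longleftrightarrow> (\<exists>q' t' h'. mstep S (q, t, h) (q', t', h') \<and> (ntm_step M ^^ n) (f q', g \<circ> t', h') c)"
    unfolding M_def ntm_step_code[OF assms(1,2)] by blast
  also have "\<dots> \<longleftrightarrow> (\<exists>q' t' h'. c = (f q', g \<circ> t', h') \<and> (mstep S ^^ Suc n) (q, t, h) (q', t', h'))"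
    unfolding Suc.IH relpowp_Suc_left OO_def split_paired_Ex by blast
  finally show ?case .
qed auto

definition load :: "'r \<Rightarrow> 's \<Rightarrow> 's \<Rightarrow> bool list \<Rightarrow> 'r \<Rightarrow> 's list" where
  "load r z e w = (\<lambda>_. [])(r := map (\<lambda>b. if b then e else z) w)"

text \<open>Acceptance in any time whatsoever yields an execution for some \<open>N\<close>;
  conversely an execution for a given \<open>N\<close> yields a time bound polynomial in
  \<open>cost N p\<close> and the input length.\<close>

theorem ntm_of_prog:
  fixes p :: "('r::finite, 's::finite) prog"
  assumes "z \<noteq> e"
  obtains M where "finite M"
    and "\<And>w T. accepts_within M w T \<Longrightarrow> \<exists>N s'. exec N p (load r z e w) s'"
    and "\<And>w N s'. exec N p (load r z e w) s' \<Longrightarrow>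
      accepts_within M w (cost N p * (2 * (length w + cost N p) + 4))"
proof -
  define S where "S = insert [] (continuations p [])"
  \<comment> \<open>The start is the whole program, acceptance the empty continuation.
    \<open>Run [p, p]\<close> only fills the third place of \<open>Ex_inj_fixing\<close>.\<close>
  obtain f :: "('r, 's) mode \<Rightarrow> nat" where f: "inj f" "f (Run [p]) = 0" "f (Run []) = 1"
    using Ex_inj_fixing[of "Run [p]" "Run []" "Run [p, p]"] by auto
  have ne: "(\<lambda>_. None) \<noteq> (\<lambda>_. None)(r := Some x)" for x :: 's
    by (metis fun_upd_same option.distinct(1))
  have "(\<lambda>_. None)(r := Some z) \<noteq> (\<lambda>_. None)(r := Some e)"
    using assms by (metis fun_upd_same option.inject)
  \<comment> \<open>The blank is the column that is empty on all tracks; an input bit is a column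
    with one digit on track \<open>r\<close> and nothing elsewhere.\<close>
  from Ex_inj_fixing[OF ne ne this]
  obtain g :: "('r \<Rightarrow> 's option) \<Rightarrow> nat" where g: "inj g" "g (\<lambda>_. None) = 0"
    "g ((\<lambda>_. None)(r := Some z)) = 1" "g ((\<lambda>_. None)(r := Some e)) = 2"
    by blast
  define M where "M = (\<lambda>(q, a, q', a', d). (f q, g a, f q', g a', d)) ` mtrans S"
  have init: "init_config w = (f (Run [p]), g \<circ> tape_of (load r z e w), 0)" for w
  proof -
    have "g (tape_of (load r z e w) i) = (if 0 \<le> i \<and> i < int (length w) then sym_of (w ! nat i) else 0)" for i
    proof -
      have "tape_of (load r z e w) i = (if 0 \<le> i \<and> i < int (length w)
          then (\<lambda>_. None)(r := Some (if w ! nat i then e else z)) else (\<lambda>_. None))"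
        by (auto simp: tape_of_def load_def fun_eq_iff)
      then show ?thesis using g by (simp add: sym_of_def)
    qed
    then show ?thesis by (simp add: init_config_def f fun_eq_iff)
  qed
  have acc: "accepts_within M w T \<longleftrightarrow>
      (\<exists>k\<le>T. \<exists>t h. (mstep S ^^ k) (Run [p], tape_of (load r z e w), 0) (Run [], t, h))" for w T
  proof -
    have "(\<exists>q t h. (ntm_step M ^^ k) (init_config w) (q, t, h) \<and> q = 1) \<longleftrightarrow>
        (\<exists>t h. (mstep S ^^ k) (Run [p], tape_of (load r z e w), 0) (Run [], t, h))" (is "?l \<longleftrightarrow> ?r") for k
    proof
      assume ?l
      then obtain q t h where "f q = 1" "(mstep S ^^ k) (Run [p], tape_of (load r z e w), 0) (q, t, h)"
        unfolding init M_def ntm_steps_code[OF f(1) g(1)] by auto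
      moreover from this have "q = Run []" using injD[OF f(1), of q "Run []"] f(3) by simp
      ultimately show ?r by blast
    next
      assume ?r
      then show ?l unfolding init M_def ntm_steps_code[OF f(1) g(1)] using f(3) by metis
    qed
    then show ?thesis unfolding accepts_within_def by simp
  qed
  have S: "K' \<in> S" if "K \<in> S" "sstep (K, s) (K', s')" for K s K' s'
    using that continuations_sstep[of K p "[]" s K' s'] unfolding S_def by (auto elim: sstep.cases)
  show ?thesis
  proof (rule that[of M])
    show "finite M" unfolding M_def by (intro finite_imageI finite_mtrans) (simp add: S_def finite_continuations)
    show "\<exists>N s'. exec N p (load r z e w) s'" if "accepts_within M w T" for w T
    proof -
      have "simulates (Run [p]) (tape_of (load r z e w)) 0 ([p], load r z e w)" by simp
      with that obtain m s' where "(sstep ^^ m) ([p], load r z e w) ([], s')"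
        unfolding acc using msteps_sound by blast
      from steps_exec_list[OF this] show ?thesis by auto
    qed
    show "accepts_within M w (cost N p * (2 * (length w + cost N p) + 4))"
      if p: "exec N p (load r z e w) s'" for w N s'
    proof -
      obtain n where n: "n \<le> cost N p" "(sstep ^^ n) ([p], load r z e w) ([], s')"
        using exec_steps[OF p, of "[]"] by (auto simp: within_def)
      have "within (mstep S) (n * (2 * (length w + n) + 4)) (Run [p], tape_of (load r z e w), 0) (Run [], tape_of s', 0)"
        by (rule steps_run[OF S n(2)]) (auto simp: S_def continuations_self load_def)
      moreover have "n * (2 * (length w + n) + 4) \<le> cost N p * (2 * (length w + cost N p) + 4)"
        using n(1) by (intro mult_mono) auto
      ultimately show ?thesis unfolding acc within_def by (meson le_trans)
    qed
  qed
qed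

section \<open>Closure properties of exponential bounds\<close>

definition exp_bounded :: "(nat \<Rightarrow> nat) \<Rightarrow> bool" where
  "exp_bounded f \<longleftrightarrow> (\<exists>k. \<forall>n\<ge>1. f n \<le> 2 ^ ((n + 1) ^ k))"

lemma exp_bounded_pow2:
  assumes "\<And>n. 1 \<le> n \<Longrightarrow> f n \<le> (n + 1) ^ k"
  shows "exp_bounded (\<lambda>n. 2 ^ f n)"
  unfolding exp_bounded_def using assms by (auto intro!: exI[of _ k] power_increasing)

lemma pow_add_le:
  fixes m :: nat
  assumes "2 \<le> m"
  shows "m ^ a + m ^ b \<le> m ^ (a + b + 1)"
proof -
  have "m ^ a \<le> m ^ (a + b)" "m ^ b \<le> m ^ (a + b)" using assms by (auto intro!: power_increasing)
  then have "m ^ a + m ^ b \<le> 2 * m ^ (a + b)" by simp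
  also have "\<dots> \<le> m * m ^ (a + b)" using assms by (rule mult_le_mono1)
  finally show ?thesis by simp
qed

lemma exp_bounded_mult:
  assumes "exp_bounded f" "exp_bounded g"
  shows "exp_bounded (\<lambda>n. f n * g n)"
proof -
  obtain a b where ab: "\<And>n. 1 \<le> n \<Longrightarrow> f n \<le> 2 ^ ((n + 1) ^ a)" "\<And>n. 1 \<le> n \<Longrightarrow> g n \<le> 2 ^ ((n + 1) ^ b)"
    using assms unfolding exp_bounded_def by blast
  have "f n * g n \<le> 2 ^ ((n + 1) ^ (a + b + 1))" if "1 \<le> n" for n
  proof -
    have "f n * g n \<le> 2 ^ ((n + 1) ^ a + (n + 1) ^ b)"
      unfolding power_add by (intro mult_mono ab that) auto
    also have "\<dots> \<le> 2 ^ ((n + 1) ^ (a + b + 1))"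
      using that by (intro power_increasing pow_add_le) auto
    finally show ?thesis .
  qed
  then show ?thesis unfolding exp_bounded_def by blast
qed

text \<open>The base \<open>n + 1\<close> must be at least 2: for \<open>n = 0\<close> the bound is
  2 whatever \<open>k\<close> is. This is why lengths start at 1 and why \<open>NEXP_I\<close> asks
  for \<open>[] \<notin> L\<close>.\<close>

lemma exp_bounded_const: "exp_bounded (\<lambda>_. c)"
proof -
  have "c \<le> 2 ^ ((n + 1) ^ c)" if "1 \<le> n" for n
  proof -
    have "c \<le> 2 ^ c" by simp
    also have "\<dots> \<le> (n + 1) ^ c" using that by (intro power_mono) auto
    also have "\<dots> \<le> 2 ^ ((n + 1) ^ c)" by simp
    finally show ?thesis .
  qed
  then show ?thesis unfolding exp_bounded_def by blast
qed

text \<open>Reduced to products, since \<open>x + y \<le> 2 * (x * y)\<close> for positive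
  \<open>x\<close> and \<open>y\<close>.\<close>

lemma exp_bounded_add:
  assumes "exp_bounded f" "exp_bounded g"
  shows "exp_bounded (\<lambda>n. f n + g n)"
proof -
  obtain a b where ab: "\<And>n. 1 \<le> n \<Longrightarrow> f n \<le> 2 ^ ((n + 1) ^ a)" "\<And>n. 1 \<le> n \<Longrightarrow> g n \<le> 2 ^ ((n + 1) ^ b)"
    using assms unfolding exp_bounded_def by blast
  have le: "x + y \<le> 2 * (x * y)" if "1 \<le> x" "1 \<le> y" for x y :: nat
  proof -
    have "x * 1 \<le> x * y" "1 * y \<le> x * y" by (rule mult_le_mono, use that in simp_all)+
    then show ?thesis by linarith
  qed
  have 1: "exp_bounded (\<lambda>n. 2 * (2 ^ ((n + 1) ^ a) * 2 ^ ((n + 1) ^ b)))"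
    by (intro exp_bounded_mult exp_bounded_const exp_bounded_pow2[of _ a] exp_bounded_pow2[of _ b]) auto
  have "f n + g n \<le> 2 * (2 ^ ((n + 1) ^ a) * 2 ^ ((n + 1) ^ b))" if "1 \<le> n" for n
    using ab[OF that] le[of "2 ^ ((n + 1) ^ a)" "2 ^ ((n + 1) ^ b)"] by simp
  then show ?thesis using 1 unfolding exp_bounded_def by (meson le_trans)
qed

lemma exp_bounded_id: "exp_bounded (\<lambda>n. n)"
  unfolding exp_bounded_def by (rule exI[of _ 1]) (metis add_leD1 less_exp less_imp_le power_one_right)

lemma exp_bounded_cost:
  assumes "exp_bounded N"
  shows "exp_bounded (\<lambda>n. cost (N n) p)"
  by (induction p) (simp_all only: cost.simps exp_bounded_const assms exp_bounded_add exp_bounded_mult)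

text \<open>Soundness for every \<open>N\<close> makes late acceptance harmless, so the true running
  time may be replaced by any larger bound of the form required.\<close>

theorem NEXP_I:
  fixes p :: "('r::finite, 's::finite) prog"
  assumes "z \<noteq> e" "exp_bounded N" "[] \<notin> L"
    and sound: "\<And>w N s'. exec N p (load r z e w) s' \<Longrightarrow> w \<in> L"
    and complete: "\<And>w. w \<in> L \<Longrightarrow> \<exists>s'. exec (N (length w)) p (load r z e w) s'"
  shows "L \<in> NEXP"
proof -
  obtain M where M: "finite M" "\<And>w T. accepts_within M w T \<Longrightarrow> \<exists>N s'. exec N p (load r z e w) s'"
    "\<And>w N s'. exec N p (load r z e w) s' \<Longrightarrow> accepts_within M w (cost N p * (2 * (length w + cost N p) + 4))"
    by (rule ntm_of_prog[OF assms(1)]) blast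
  have "exp_bounded (\<lambda>n. cost (N n) p * (2 * (n + cost (N n) p) + 4))"
    by (intro exp_bounded_mult exp_bounded_add exp_bounded_const exp_bounded_id exp_bounded_cost assms)
  then obtain k where k: "\<And>n. 1 \<le> n \<Longrightarrow> cost (N n) p * (2 * (n + cost (N n) p) + 4) \<le> 2 ^ ((n + 1) ^ k)"
    unfolding exp_bounded_def by blast
  have "accepts_within M w (2 ^ ((length w + 1) ^ k))" if "w \<in> L" for w
  proof -
    have "1 \<le> length w" using that assms(3) by (cases w) auto
    moreover obtain s' where "exec (N (length w)) p (load r z e w) s'" using complete[OF \<open>w \<in> L\<close>] by blast
    ultimately show ?thesis using M(3) k unfolding accepts_within_def by (meson le_trans)
  qed
  then show ?thesis
    unfolding NEXP_def using M(1,2) sound by blast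
qed

section \<open>Binary numbers on stacks\<close>

datatype sym = S0 | S1 | Sep | KV | KM | KF

text \<open>\<open>RIn\<close> is the input. \<open>RG\<close> and \<open>RH\<close> hold the items
  before and after treatment at the current gate; \<open>RN\<close>, \<open>RP\<close>,
  \<open>RQ\<close>, \<open>RA\<close> its name, sorted predecessors and literal; \<open>RM\<close>
  and \<open>RV\<close> the item in hand; \<open>RD\<close> and \<open>RW\<close> guessed operands.
  \<open>RE\<close>, \<open>RF\<close>, \<open>RJ\<close> belong to multiplication,
  \<open>RX\<close>, \<open>RY\<close>, \<open>RZ\<close>, \<open>RC\<close> to addition,
  \<open>RT\<close> and \<open>RU\<close> are temporary. \<open>RK\<close> counts the gates left,
  \<open>RB\<close> keeps the guessed target.\<close>

datatype reg = RIn | RG | RH | RN | RP | RQ | RA | RM | RV | RD | RW | RE | RF | RJ | RU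
  | RX | RY | RZ | RC | RT | RK | RB

instance sym :: finite
proof
  have "UNIV = {S0, S1, Sep, KV, KM, KF}" by (rule UNIV_eq_I) (case_tac x, auto)
  then show "finite (UNIV :: sym set)" by (metis finite.emptyI finite.insertI)
qed

instance reg :: finite
proof
  have "UNIV = {RIn, RG, RH, RN, RP, RQ, RA, RM, RV, RD, RW, RE, RF, RJ, RU, RX, RY, RZ, RC, RT, RK, RB}"
    by (rule UNIV_eq_I) (case_tac x, auto)
  then show "finite (UNIV :: reg set)" by (metis finite.emptyI finite.insertI)
qed

type_synonym rprog = "(reg, sym) prog"
type_synonym store = "reg \<Rightarrow> sym list"

declare bin.simps [simp del] fun_upd_apply [simp del] fun_upd_same [simp] fun_upd_other [simp]

text \<open>Stores appear as chains of updates, kept unevaluated since \<open>fun_upd_apply\<close>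
  is no simplification rule. Chains that differ in order or in overwritten entries are identified
  here register by register.\<close>

lemma store_eqI:
  fixes s t :: store
  assumes "s RIn = t RIn" "s RG = t RG" "s RH = t RH" "s RN = t RN" "s RP = t RP" "s RQ = t RQ" "s RA = t RA"
    "s RM = t RM" "s RV = t RV" "s RD = t RD" "s RW = t RW" "s RE = t RE" "s RF = t RF" "s RJ = t RJ" "s RU = t RU"
    "s RX = t RX" "s RY = t RY" "s RZ = t RZ" "s RC = t RC" "s RT = t RT" "s RK = t RK" "s RB = t RB"
  shows "s = t"
  by (rule ext, case_tac x) (use assms in simp_all)

text \<open>With these two rules the simplifier can execute a straight-line program symbolically.\<close>

lemma Ex_pull [simp]: "(\<exists>u. (\<exists>l. A u l) \<and> P u) \<longleftrightarrow> (\<exists>l u. A u l \<and> P u)"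
  by blast

lemma Ex_split [simp]: "(\<exists>u. (A u \<or> B u) \<and> P u) \<longleftrightarrow> (\<exists>u. A u \<and> P u) \<or> (\<exists>u. B u \<and> P u)"
  by blast

definition dig :: "bool \<Rightarrow> sym" where
  "dig b = (if b then S1 else S0)"

lemma dig_simps [simp]: "dig True = S1" "dig False = S0" "dig b = S0 \<longleftrightarrow> \<not> b" "dig b = S1 \<longleftrightarrow> b"
  "S0 = dig b \<longleftrightarrow> \<not> b" "S1 = dig b \<longleftrightarrow> b" "dig b = dig c \<longleftrightarrow> b = c" "dig b \<noteq> Sep" "Sep \<noteq> dig b"
  by (auto simp: dig_def)

text \<open>Least significant digit first, so that pushing the digits of an input number as they are read
  from the most significant one yields this list.\<close>

definition bits_of :: "nat \<Rightarrow> sym list" where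
  "bits_of n = map dig (rev (bin n))"

lemma bits_of_0 [simp]: "bits_of 0 = [S0]" and bits_of_1 [simp]: "bits_of (Suc 0) = [S1]"
  by (simp_all add: bits_of_def bin.simps)

lemma bits_of_rec: "2 \<le> n \<Longrightarrow> bits_of n = dig (odd n) # bits_of (n div 2)"
  by (subst bits_of_def, subst bin.simps) (simp add: bits_of_def)

fun val :: "sym list \<Rightarrow> nat" where
  "val [] = 0"
| "val (d # l) = (if d = S1 then 1 else 0) + 2 * val l"

abbreviation bits :: "sym list \<Rightarrow> bool" where
  "bits l \<equiv> set l \<subseteq> {S0, S1}"

lemma bits_bits_of [simp]: "bits (bits_of n)"
  by (auto simp: bits_of_def dig_def)

lemma nat_half_induct [case_names 0 1 half]:
  "P 0 \<Longrightarrow> P (Suc 0) \<Longrightarrow> (\<And>n. 2 \<le> n \<Longrightarrow> P (n div 2) \<Longrightarrow> P n) \<Longrightarrow> P (n :: nat)"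
proof (induction n rule: less_induct)
  case (less n)
  show ?case
  proof (cases "2 \<le> n")
    case True
    then show ?thesis using less by simp
  next
    case False
    then have "n = 0 \<or> n = Suc 0" by auto
    then show ?thesis using less.prems by auto
  qed
qed

lemma val_bits_of [simp]: "val (bits_of n) = n"
  by (induction n rule: nat_half_induct) (auto simp: bits_of_rec dig_def)

lemma bits_of_inject [simp]: "bits_of m = bits_of n \<longleftrightarrow> m = n"
  by (metis val_bits_of)

text \<open>The last list element is the leading digit, so a final \<open>S1\<close> means that
  there is no leading zero. With the converse \<open>bits_of_last\<close> this lets digit strings be
  exchanged for positive numbers.\<close>

lemma val_append_one: "bits l \<Longrightarrow> bits_of (val (l @ [S1])) = l @ [S1] \<and> 1 \<le> val (l @ [S1])"
proof (induction l)
  case (Cons d l)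
  then have "2 \<le> val ((d # l) @ [S1])" by auto
  then show ?case using Cons by (subst bits_of_rec) auto
qed simp

lemma bits_of_last: "1 \<le> n \<Longrightarrow> \<exists>l. bits l \<and> bits_of n = l @ [S1]"
proof (induction n rule: nat_half_induct)
  case (half n)
  then have "1 \<le> n div 2" by auto
  with half obtain l where "bits l" "bits_of (n div 2) = l @ [S1]" by auto
  then show ?case using half(1) by (intro exI[of _ "dig (odd n) # l"]) (auto simp: bits_of_rec dig_def)
qed auto

lemma bits_of_pos_iff: "(\<exists>l. bits l \<and> P (l @ [S1])) \<longleftrightarrow> (\<exists>n\<ge>1. P (bits_of n))"
  using val_append_one bits_of_last by metis

lemma length_bits_of_mono: "m \<le> n \<Longrightarrow> length (bits_of m) \<le> length (bits_of n)"
proof (induction n arbitrary: m rule: nat_half_induct)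
  case 1
  then have "m = 0 \<or> m = Suc 0" by auto
  then show ?case by auto
next
  case (half n)
  show ?case
  proof (cases "2 \<le> m")
    case True
    then show ?thesis using half by (simp add: bits_of_rec div_le_mono)
  next
    case False
    then have "m = 0 \<or> m = Suc 0" by auto
    then show ?thesis using half(1) by (auto simp: bits_of_rec)
  qed
qed auto

lemma length_bits_of_le: "n < 2 ^ k \<Longrightarrow> 1 \<le> k \<Longrightarrow> length (bits_of n) \<le> k"
proof (induction n arbitrary: k rule: nat_half_induct)
  case (half n)
  then obtain j where j: "k = Suc j" by (cases k) auto
  have "1 \<le> j" using half(1,3) j by (cases j) auto
  moreover have "n div 2 < 2 ^ j" using half(3) j by auto
  ultimately show ?case using half(1) half(2)[of j] j by (simp add: bits_of_rec)
qed auto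

lemma val_less: "val l < 2 ^ length l"
  by (induction l) auto

lemma length_bits_of_val: "n \<le> val l \<Longrightarrow> length l \<le> k \<Longrightarrow> 1 \<le> k \<Longrightarrow> length (bits_of n) \<le> k"
  using val_less[of l] by (intro length_bits_of_le) (auto intro: less_le_trans le_less_trans power_increasing)

primrec choices :: "rprog \<Rightarrow> rprog list \<Rightarrow> rprog" where
  "choices p [] = p"
| "choices p (q # ps) = p [+] choices q ps"

lemma exec_choices: "exec N (choices p ps) s s' \<longleftrightarrow> (\<exists>q\<in>set (p # ps). exec N q s s')"
  by (induction ps arbitrary: p) auto

section \<open>Moving, copying and guessing digit strings\<close>

definition move_digit :: "reg \<Rightarrow> reg list \<Rightarrow> sym \<Rightarrow> rprog" where
  "move_digit A Bs d = foldl (\<lambda>p B. p ;; Push B d) (Pop A d) Bs"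

definition moved :: "reg \<Rightarrow> reg list \<Rightarrow> sym list \<Rightarrow> sym list \<Rightarrow> store \<Rightarrow> store" where
  "moved A Bs l1 l2 s = (\<lambda>r. if r = A then l2 else if r \<in> set Bs then rev l1 @ s r else s r)"

lemma exec_move_digit:
  assumes "distinct Bs" "A \<notin> set Bs"
  shows "exec N (move_digit A Bs d) s s' \<longleftrightarrow> (\<exists>l. s A = d # l \<and> s' = moved A Bs [d] l s)"
  using assms
proof (induction Bs arbitrary: s' rule: rev_induct)
  case Nil
  have "moved A [] [d] l s = s(A := l)" for l by (auto simp: moved_def fun_upd_apply)
  then show ?case by (simp add: move_digit_def)
next
  case (snoc B Bs)
  have "exec N (move_digit A (Bs @ [B]) d) s s' \<longleftrightarrow> (\<exists>u. exec N (move_digit A Bs d) s u \<and> s' = u(B := d # u B))"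
    by (simp add: move_digit_def)
  moreover have "(moved A Bs [d] l s)(B := d # moved A Bs [d] l s B) = moved A (Bs @ [B]) [d] l s" for l
    using snoc.prems by (auto simp: moved_def fun_upd_apply)
  ultimately show ?case using snoc by auto
qed

definition xfer :: "reg \<Rightarrow> reg list \<Rightarrow> rprog" where
  "xfer A Bs = Star (move_digit A Bs S0 [+] move_digit A Bs S1)"

text \<open>The loop may stop after any prefix of digits; only the command that follows,
  \<open>Emp\<close> or a \<open>Pop\<close> of a separator, settles where it did. Digits arrive
  reversed because each is pushed on top.\<close>

lemma exec_xfer:
  assumes "distinct Bs" "A \<notin> set Bs"
  shows "exec N (xfer A Bs) s s' \<longleftrightarrow>
    (\<exists>l1 l2. s A = l1 @ l2 \<and> bits l1 \<and> length l1 \<le> N \<and> s' = moved A Bs l1 l2 s)"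
proof -
  note move_digit = exec_move_digit[OF assms]
  have upd: "moved A Bs l1 l2 (moved A Bs [d] l s) = moved A Bs (d # l1) l2 s" for l1 l2 l d s
    by (auto simp: moved_def)
  have at: "moved A Bs l1 l2 s A = l2" for l1 l2 s by (simp add: moved_def)
  have "iterate (exec N (move_digit A Bs S0 [+] move_digit A Bs S1)) k s s' \<longleftrightarrow>
    (\<exists>l1 l2. s A = l1 @ l2 \<and> bits l1 \<and> length l1 = k \<and> s' = moved A Bs l1 l2 s)" for k
  proof (induction k arbitrary: s)
    case 0
    then show ?case by (auto simp: moved_def)
  next
    case (Suc k)
    have "iterate (exec N (move_digit A Bs S0 [+] move_digit A Bs S1)) (Suc k) s s' \<longleftrightarrow>
      (\<exists>d l1 l2. s A = d # l1 @ l2 \<and> (d = S0 \<or> d = S1) \<and> bits l1 \<and> length l1 = k \<and> s' = moved A Bs (d # l1) l2 s)"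
      by (simp add: Suc move_digit at upd) blast
    also have "\<dots> \<longleftrightarrow> (\<exists>l1 l2. s A = l1 @ l2 \<and> bits l1 \<and> length l1 = Suc k \<and> s' = moved A Bs l1 l2 s)"
      (is "?l \<longleftrightarrow> ?r")
    proof
      assume ?l
      then obtain d l1 l2 where "s A = d # l1 @ l2" "d = S0 \<or> d = S1" "bits l1" "length l1 = k"
        "s' = moved A Bs (d # l1) l2 s" by blast
      then show ?r by (intro exI[of _ "d # l1"] exI[of _ l2]) auto
    next
      assume ?r
      then obtain l1 l2 where l: "s A = l1 @ l2" "bits l1" "length l1 = Suc k" "s' = moved A Bs l1 l2 s" by blast
      then show ?l by (intro exI[of _ "hd l1"] exI[of _ "tl l1"] exI[of _ l2]) (auto simp: length_Suc_conv)
    qed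
    finally show ?case .
  qed
  then show ?thesis by (auto simp: xfer_def)
qed

lemma moved_simps:
  "moved A [] l1 l2 s = s(A := l2)"
  "A \<noteq> B \<Longrightarrow> moved A [B] l1 l2 s = s(A := l2, B := rev l1 @ s B)"
  "A \<noteq> B \<Longrightarrow> A \<noteq> C \<Longrightarrow> B \<noteq> C \<Longrightarrow> moved A [B, C] l1 l2 s = s(A := l2, B := rev l1 @ s B, C := rev l1 @ s C)"
  by (auto simp: moved_def fun_upd_apply)

lemma exec_xfer_all:
  assumes "distinct Bs" "A \<notin> set Bs"
  shows "(\<exists>u. exec N (xfer A Bs) s u \<and> u A = [] \<and> s' = u) \<longleftrightarrow>
    bits (s A) \<and> length (s A) \<le> N \<and> s' = moved A Bs (s A) [] s"
  by (auto simp: exec_xfer[OF assms] moved_def)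

definition clear :: "reg \<Rightarrow> rprog" where
  "clear A = xfer A [] ;; Emp A"

definition pour :: "reg \<Rightarrow> reg \<Rightarrow> rprog" where
  "pour A B = xfer A [B] ;; Emp A"

text \<open>The detour over \<open>RT\<close> undoes the reversal caused by the first move; the same
  holds for \<open>shift\<close>.\<close>

definition copy :: "reg \<Rightarrow> reg \<Rightarrow> rprog" where
  "copy A B = pour A RT ;; xfer RT [A, B] ;; Emp RT"

definition shift :: "reg \<Rightarrow> reg \<Rightarrow> rprog" where
  "shift A B = pour A RT ;; pour RT B"

lemma exec_clear: "exec N (clear A) s s' \<longleftrightarrow> bits (s A) \<and> length (s A) \<le> N \<and> s' = s(A := [])"
  by (auto simp: clear_def exec_xfer_all moved_simps fun_upd_apply intro!: ext)

lemma exec_pour: "A \<noteq> B \<Longrightarrow>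
  exec N (pour A B) s s' \<longleftrightarrow> bits (s A) \<and> length (s A) \<le> N \<and> s' = s(A := [], B := rev (s A) @ s B)"
  by (auto simp: pour_def exec_xfer_all moved_simps fun_upd_apply intro!: ext)

lemma exec_copy: "A \<noteq> B \<Longrightarrow> A \<noteq> RT \<Longrightarrow> B \<noteq> RT \<Longrightarrow> s RT = [] \<Longrightarrow>
  exec N (copy A B) s s' \<longleftrightarrow> bits (s A) \<and> length (s A) \<le> N \<and> s' = s(B := s A @ s B)"
  by (auto simp: copy_def exec_xfer_all moved_simps exec_pour fun_upd_apply intro!: ext)

lemma exec_shift: "A \<noteq> RT \<Longrightarrow> B \<noteq> RT \<Longrightarrow> A \<noteq> B \<Longrightarrow> s RT = [] \<Longrightarrow>
  exec N (shift A B) s s' \<longleftrightarrow> bits (s A) \<and> length (s A) \<le> N \<and> s' = s(A := [], B := s A @ s B)"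
  by (auto simp: shift_def exec_pour fun_upd_apply intro!: ext)

text \<open>Only canonical representations are guessed; the first digit pushed is the leading one.\<close>

definition guess1 :: "reg \<Rightarrow> rprog" where
  "guess1 R = Push R S1 ;; Star (Push R S0 [+] Push R S1)"

definition guess :: "reg \<Rightarrow> rprog" where
  "guess R = Push R S0 [+] guess1 R"

lemma iterate_guess: "iterate (exec N (Push R S0 [+] Push R S1)) k s s' \<longleftrightarrow>
  (\<exists>l. length l = k \<and> bits l \<and> s' = s(R := l @ s R))"
proof (induction k arbitrary: s)
  case (Suc k)
  have "iterate (exec N (Push R S0 [+] Push R S1)) (Suc k) s s' \<longleftrightarrow>
      (\<exists>d l. (d = S0 \<or> d = S1) \<and> length l = k \<and> bits l \<and> s' = s(R := l @ d # s R))"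
    by (simp add: Suc)
  also have "\<dots> \<longleftrightarrow> (\<exists>l. length l = Suc k \<and> bits l \<and> s' = s(R := l @ s R))" (is "?l \<longleftrightarrow> ?r")
  proof
    assume ?l
    then obtain d l where "d = S0 \<or> d = S1" "length l = k" "bits l" "s' = s(R := l @ d # s R)" by blast
    then show ?r by (intro exI[of _ "l @ [d]"]) auto
  next
    assume ?r
    then obtain l where l: "length l = Suc k" "bits l" "s' = s(R := l @ s R)" by blast
    then obtain l0 d where "l = l0 @ [d]" by (cases l rule: rev_cases) auto
    then show ?l using l by (intro exI[of _ d] exI[of _ l0]) auto
  qed
  finally show ?case .
qed auto

text \<open>The bound is \<open>Suc N\<close> because the leading digit is pushed outside the
  loop.\<close>

lemma exec_guess1: "exec N (guess1 R) s s' \<longleftrightarrow> (\<exists>n\<ge>1. length (bits_of n) \<le> Suc N \<and> s' = s(R := bits_of n @ s R))"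
proof -
  have "exec N (guess1 R) s s' \<longleftrightarrow> (\<exists>l. bits l \<and> (length (l @ [S1]) \<le> Suc N \<and> s' = s(R := (l @ [S1]) @ s R)))"
    by (auto simp: guess1_def iterate_guess)
  also have "\<dots> \<longleftrightarrow> (\<exists>n\<ge>1. length (bits_of n) \<le> Suc N \<and> s' = s(R := bits_of n @ s R))"
    by (rule bits_of_pos_iff)
  finally show ?thesis .
qed

lemma ex_nat_split: "(\<exists>n :: nat. P n) \<longleftrightarrow> P 0 \<or> (\<exists>n\<ge>1. P n)"
  by (metis One_nat_def Suc_leI neq0_conv)

lemma exec_guess: "exec N (guess R) s s' \<longleftrightarrow> (\<exists>n. length (bits_of n) \<le> Suc N \<and> s' = s(R := bits_of n @ s R))"
  by (subst ex_nat_split) (simp add: guess_def exec_guess1)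

section \<open>Reading encoded numbers\<close>

definition enc_nat :: "nat \<Rightarrow> sym list" where
  "enc_nat n = map dig (enc_num n)"

lemma enc_nat_bits_of: "enc_nat n = concat (map (\<lambda>d. [d, d]) (rev (bits_of n))) @ [S0, S1]"
  by (simp add: enc_nat_def enc_num_def bits_of_def rev_map map_concat comp_def)

text \<open>Every digit is doubled, so the unequal pair \<open>S0\<close>, \<open>S1\<close> cannot
  be mistaken for a digit: the code is prefix free, and the nondeterministic reader has only one way
  to parse.\<close>

lemma doubled_inject: "concat (map (\<lambda>d. [d, d]) l) @ S0 # S1 # r = concat (map (\<lambda>d. [d, d]) l') @ S0 # S1 # r' \<Longrightarrow>
  l = l' \<and> r = r'"
proof (induction l arbitrary: l')
  case Nil
  then show ?case by (cases l') auto
next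
  case (Cons a l)
  then show ?case by (cases l') auto
qed

lemma enc_nat_inject [simp]: "enc_nat n @ r = enc_nat m @ r' \<longleftrightarrow> n = m \<and> r = r'"
  unfolding enc_nat_bits_of by (auto dest: doubled_inject)

text \<open>A digit \<open>S0\<close> in front is accepted only as the entire number. Without this
  restriction, codes with leading zeros would pass, and words outside the image of
  \<open>enc_instance\<close> could be accepted.\<close>

definition read_num :: "reg \<Rightarrow> rprog" where
  "read_num R = (Pop RIn S0 ;; Pop RIn S0 ;; Push R S0 [+]
      Pop RIn S1 ;; Pop RIn S1 ;; Push R S1 ;;
        Star (Pop RIn S0 ;; Pop RIn S0 ;; Push R S0 [+] Pop RIn S1 ;; Pop RIn S1 ;; Push R S1)) ;;
    Pop RIn S0 ;; Pop RIn S1"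

lemma iterate_read_num:
  assumes "R \<noteq> RIn"
  shows "iterate (exec N (Pop RIn S0 ;; Pop RIn S0 ;; Push R S0 [+] Pop RIn S1 ;; Pop RIn S1 ;; Push R S1)) k s s' \<longleftrightarrow>
    (\<exists>l r. length l = k \<and> bits l \<and> s RIn = concat (map (\<lambda>d. [d, d]) l) @ r \<and> s' = s(RIn := r, R := rev l @ s R))"
    (is "iterate (exec N ?b) k s s' \<longleftrightarrow> ?rhs k s")
proof (induction k arbitrary: s)
  case (Suc k)
  have body: "exec N ?b s u \<longleftrightarrow> (\<exists>d r. (d = S0 \<or> d = S1) \<and> s RIn = d # d # r \<and> u = s(RIn := r, R := d # s R))" for u
    using assms by (auto simp: fun_upd_twist[of RIn R])
  show ?case
  proof
    assume "iterate (exec N ?b) (Suc k) s s'"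
    then obtain d r where d: "d = S0 \<or> d = S1" "s RIn = d # d # r" "?rhs k (s(RIn := r, R := d # s R))"
      unfolding iterate.simps body Suc by blast
    then obtain l r' where "length l = k" "bits l" "r = concat (map (\<lambda>d. [d, d]) l) @ r'"
      "s' = s(RIn := r', R := rev l @ d # s R)"
      using assms by (auto simp: fun_upd_twist[of RIn R])
    then show "?rhs (Suc k) s" using d by (intro exI[of _ "d # l"] exI[of _ r']) auto
  next
    assume "?rhs (Suc k) s"
    then obtain l r where l: "length l = Suc k" "bits l" "s RIn = concat (map (\<lambda>d. [d, d]) l) @ r"
      "s' = s(RIn := r, R := rev l @ s R)" by blast
    then obtain d l' where l': "l = d # l'" by (cases l) auto
    let ?r = "concat (map (\<lambda>d. [d, d]) l') @ r"
    have "exec N ?b s (s(RIn := ?r, R := d # s R))"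
      unfolding body using l l' by (intro exI[of _ d] exI[of _ ?r]) auto
    moreover have "?rhs k (s(RIn := ?r, R := d # s R))"
      using l l' assms by (intro exI[of _ l'] exI[of _ r]) (auto simp: fun_upd_twist[of RIn R])
    ultimately show "iterate (exec N ?b) (Suc k) s s'" unfolding iterate.simps Suc by blast
  qed
qed auto

lemma Ex_rev: "(\<exists>l. P (rev l)) \<longleftrightarrow> (\<exists>l. P l)"
  by (metis rev_rev_ident)

lemma exec_read_num:
  assumes "R \<noteq> RIn"
  shows "exec N (read_num R) s s' \<longleftrightarrow>
    (\<exists>n r. s RIn = enc_nat n @ r \<and> length (bits_of n) \<le> Suc N \<and> s' = s(RIn := r, R := bits_of n @ s R))"
proof -
  let ?P = "\<lambda>w. \<exists>r. s RIn = concat (map (\<lambda>d. [d, d]) (rev w)) @ S0 # S1 # r \<and> length w \<le> Suc N \<and>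
    s' = s(RIn := r, R := w @ s R)"
  have "exec N (read_num R) s s' \<longleftrightarrow> ?P [S0] \<or> (\<exists>l. bits (rev l) \<and> ?P (rev l @ [S1]))"
    (is "?l \<longleftrightarrow> ?r")
  proof
    assume ?l
    then show ?r using assms by (auto simp: read_num_def iterate_read_num fun_upd_twist[of RIn R])
  next
    assume ?r
    then consider r where "s RIn = S0 # S0 # S0 # S1 # r" "s' = s(RIn := r, R := S0 # s R)"
      | l r where "bits l" "s RIn = S1 # S1 # concat (map (\<lambda>d. [d, d]) l) @ S0 # S1 # r" "length l \<le> N"
          "s' = s(RIn := r, R := rev l @ S1 # s R)"
      by auto
    then show ?l
    proof cases
      case 1
      then show ?thesis using assms by (auto simp: read_num_def fun_upd_twist[of RIn R])
    next
      case 2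
      let ?v = "s(RIn := concat (map (\<lambda>d. [d, d]) l) @ S0 # S1 # r, R := S1 # s R)"
      let ?u = "s(RIn := S0 # S1 # r, R := rev l @ S1 # s R)"
      have "exec N (Star (Pop RIn S0 ;; Pop RIn S0 ;; Push R S0 [+] Pop RIn S1 ;; Pop RIn S1 ;; Push R S1)) ?v ?u"
        unfolding exec_simps iterate_read_num[OF assms] using 2 assms
        by (intro exI[of _ "length l"] conjI exI[of _ l] exI[of _ "S0 # S1 # r"]) auto
      moreover have "exec N (Pop RIn S1 ;; Pop RIn S1 ;; Push R S1) s ?v"
        using 2 assms by (auto simp: fun_upd_twist[of RIn R])
      moreover have "exec N (Pop RIn S0 ;; Pop RIn S1) ?u s'"
        using 2 assms by (auto simp: fun_upd_twist[of RIn R])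
      ultimately show ?thesis unfolding read_num_def exec_simps(4,5) by blast
    qed
  qed
  also have "(\<exists>l. bits (rev l) \<and> ?P (rev l @ [S1])) \<longleftrightarrow> (\<exists>l. bits l \<and> ?P (l @ [S1]))"
    by (rule Ex_rev[of "\<lambda>l. bits l \<and> ?P (l @ [S1])"])
  also have "\<dots> \<longleftrightarrow> (\<exists>n\<ge>1. ?P (bits_of n))" by (rule bits_of_pos_iff)
  also have "?P [S0] \<or> (\<exists>n\<ge>1. ?P (bits_of n)) \<longleftrightarrow> (\<exists>n. ?P (bits_of n))"
    by (subst ex_nat_split) simp
  finally show ?thesis by (simp add: enc_nat_bits_of)
qed

primrec expect :: "sym \<Rightarrow> sym list \<Rightarrow> rprog" where
  "expect d [] = Pop RIn d"
| "expect d (e # l) = Pop RIn d ;; expect e l"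

lemma exec_expect: "exec N (expect d l) s s' \<longleftrightarrow> (\<exists>r. s RIn = d # l @ r \<and> s' = s(RIn := r))"
  by (induction l arbitrary: d s) auto

section \<open>Arithmetic tests and items\<close>

definition pop_digit :: "reg \<Rightarrow> bool \<Rightarrow> rprog" where
  "pop_digit R b = (if b then Pop R S1 else Pop R S0 [+] Emp R)"

lemma exec_pop_digit: "bits (s R) \<Longrightarrow> exec N (pop_digit R b) s s' \<longleftrightarrow> odd (val (s R)) = b \<and> s' = s(R := tl (s R))"
  by (cases "s R") (auto simp: pop_digit_def fun_upd_idem)

lemma val_tl: "bits l \<Longrightarrow> val l = 2 * val (tl l) + (if odd (val l) then 1 else 0)"
  by (cases l) auto

lemma bits_tl: "bits l \<Longrightarrow> bits (tl l)"
  by (cases l) auto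

text \<open>\<open>add c\<close> consumes \<open>RX\<close>, \<open>RY\<close>, \<open>RZ\<close> and succeeds iff \<open>X + Y + c = Z\<close>. Exhausted registers supply zeros,
  so leading zeros are harmless.\<close>

definition addstep :: "bool \<times> bool \<times> bool \<Rightarrow> rprog" where
  "addstep = (\<lambda>(c, x, y). Pop RC (dig c) ;; pop_digit RX x ;; pop_digit RY y ;; pop_digit RZ ((x \<noteq> y) \<noteq> c) ;;
     Push RC (dig (x \<and> y \<or> c \<and> (x \<or> y))))"

definition addbody :: rprog where
  "addbody = choices (addstep (False, False, False)) (map addstep [(False, False, True), (False, True, False),
     (False, True, True), (True, False, False), (True, False, True), (True, True, False), (True, True, True)])"

definition add :: "bool \<Rightarrow> rprog" where
  "add c = Push RC (dig c) ;; Star addbody ;; Emp RX ;; Emp RY ;; Emp RZ ;; Pop RC S0"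

lemma exec_addbody: "exec N addbody s s' \<longleftrightarrow> (\<exists>c x y. exec N (addstep (c, x, y)) s s')"
proof -
  have "set (addstep (False, False, False) # map addstep [(False, False, True), (False, True, False),
     (False, True, True), (True, False, False), (True, False, True), (True, True, False), (True, True, True)])
     = range addstep"
    by (auto simp: image_iff) (metis (full_types))
  then show ?thesis unfolding addbody_def exec_choices by (simp add: split_paired_Ex)
qed

definition addstate :: "store \<Rightarrow> sym list \<Rightarrow> sym list \<Rightarrow> sym list \<Rightarrow> bool \<Rightarrow> store" where
  "addstate s X Y Z c = s(RX := X, RY := Y, RZ := Z, RC := [dig c])"

lemma exec_addstep:
  assumes "bits X" "bits Y" "bits Z"
  shows "exec N (addstep (c', x, y)) (addstate s X Y Z c) s' \<longleftrightarrow>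
    c' = c \<and> x = odd (val X) \<and> y = odd (val Y) \<and> odd (val Z) = ((x \<noteq> y) \<noteq> c) \<and>
    s' = addstate s (tl X) (tl Y) (tl Z) (x \<and> y \<or> c \<and> (x \<or> y))"
  using assms
  by (auto simp: addstep_def addstate_def exec_pop_digit fun_upd_apply intro!: ext)

text \<open>One column of the addition. The terms \<open>a\<close> and \<open>b\<close> stand for
  the contributions of the digits beyond the positions treated, so that the induction step of
  \<open>iterate_add\<close> is an instance.\<close>

lemma full_adder:
  fixes x y z a b :: nat
  shows "z3 = ((x3 \<noteq> y3) \<noteq> c) \<and> x + y + (if x3 \<and> y3 \<or> c \<and> (x3 \<or> y3) then 1 else 0) + a = z + b \<longleftrightarrow>
    (2 * x + (if x3 then 1 else 0)) + (2 * y + (if y3 then 1 else 0)) + (if c then 1 else 0) + 2 * a =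
    (2 * z + (if z3 then 1 else 0)) + 2 * b"
  by (cases x3; cases y3; cases z3; cases c; simp; presburger)

text \<open>The invariant is that the low \<open>k\<close> digits add up with carry
  \<open>c'\<close>. Adding the unread parts of all three numbers to both sides states this through
  \<open>val\<close> of whole lists, without remainders or truncated subtraction.\<close>

lemma iterate_add:
  assumes "bits X" "bits Y" "bits Z"
  shows "iterate (exec N addbody) k (addstate s X Y Z c) s' \<longleftrightarrow>
    (\<exists>c'. s' = addstate s (drop k X) (drop k Y) (drop k Z) c' \<and>
      val X + val Y + (if c then 1 else 0) + 2 ^ k * val (drop k Z) =
      val Z + 2 ^ k * (val (drop k X) + val (drop k Y) + (if c' then 1 else 0)))"
  using assms
proof (induction k arbitrary: X Y Z c)
  case 0
  then show ?case by (cases c) auto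
next
  case (Suc k)
  let ?x = "odd (val X)" and ?y = "odd (val Y)"
  let ?c = "?x \<and> ?y \<or> c \<and> (?x \<or> ?y)"
  have "iterate (exec N addbody) (Suc k) (addstate s X Y Z c) s' \<longleftrightarrow> odd (val Z) = ((?x \<noteq> ?y) \<noteq> c) \<and>
      iterate (exec N addbody) k (addstate s (tl X) (tl Y) (tl Z) ?c) s'"
    by (auto simp: exec_addbody exec_addstep[OF Suc.prems])
  also have "\<dots> \<longleftrightarrow> odd (val Z) = ((?x \<noteq> ?y) \<noteq> c) \<and> (\<exists>c'. s' = addstate s (drop (Suc k) X) (drop (Suc k) Y) (drop (Suc k) Z) c' \<and>
      val (tl X) + val (tl Y) + (if ?c then 1 else 0) + 2 ^ k * val (drop (Suc k) Z) =
      val (tl Z) + 2 ^ k * (val (drop (Suc k) X) + val (drop (Suc k) Y) + (if c' then 1 else 0)))"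
    using Suc.prems by (subst Suc.IH) (auto simp: bits_tl drop_Suc)
  also have "\<dots> \<longleftrightarrow> (\<exists>c'. s' = addstate s (drop (Suc k) X) (drop (Suc k) Y) (drop (Suc k) Z) c' \<and>
      val X + val Y + (if c then 1 else 0) + 2 ^ Suc k * val (drop (Suc k) Z) =
      val Z + 2 ^ Suc k * (val (drop (Suc k) X) + val (drop (Suc k) Y) + (if c' then 1 else 0)))"
    using full_adder[of "odd (val Z)" ?x ?y c "val (tl X)" "val (tl Y)" _ "val (tl Z)"]
    unfolding val_tl[OF Suc.prems(1), symmetric] val_tl[OF Suc.prems(2), symmetric] val_tl[OF Suc.prems(3), symmetric]
    by (simp only: power_Suc mult.assoc) blast
  finally show ?case .
qed

lemma exec_add:
  assumes "bits (s RX)" "bits (s RY)" "bits (s RZ)" "s RC = []"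
  shows "exec N (add c) s s' \<longleftrightarrow> length (s RX) \<le> N \<and> length (s RY) \<le> N \<and> length (s RZ) \<le> N \<and>
    val (s RX) + val (s RY) + (if c then 1 else 0) = val (s RZ) \<and> s' = s(RX := [], RY := [], RZ := [])"
proof -
  have s: "s(RC := [dig c]) = addstate s (s RX) (s RY) (s RZ) c"
    by (auto simp: addstate_def fun_upd_apply)
  have fin: "(addstate s [] [] [] c')(RC := []) = s(RX := [], RY := [], RZ := [])" for c'
    using assms(4) by (auto simp: addstate_def fun_upd_apply)
  have at: "addstate s X Y Z c' RX = X" "addstate s X Y Z c' RY = Y" "addstate s X Y Z c' RZ = Z"
    "addstate s X Y Z c' RC = [dig c']" for X Y Z c'
    by (auto simp: addstate_def)
  have "exec N (add c) s s' \<longleftrightarrow> (\<exists>k\<le>N. length (s RX) \<le> k \<and> length (s RY) \<le> k \<and> length (s RZ) \<le> k \<and>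
      val (s RX) + val (s RY) + (if c then 1 else 0) = val (s RZ) \<and> s' = s(RX := [], RY := [], RZ := []))"
    (is "_ \<longleftrightarrow> ?r")
  proof
    assume "exec N (add c) s s'"
    then obtain k u where k: "k \<le> N" "iterate (exec N addbody) k (addstate s (s RX) (s RY) (s RZ) c) u"
      "u RX = []" "u RY = []" "u RZ = []" "\<exists>l. u RC = S0 # l \<and> s' = u(RC := l)"
      unfolding add_def by (auto simp: assms(4) s)
    then obtain c' where c': "u = addstate s (drop k (s RX)) (drop k (s RY)) (drop k (s RZ)) c'"
      "val (s RX) + val (s RY) + (if c then 1 else 0) + 2 ^ k * val (drop k (s RZ)) =
      val (s RZ) + 2 ^ k * (val (drop k (s RX)) + val (drop k (s RY)) + (if c' then 1 else 0))"
      using iterate_add[OF assms(1-3)] by blast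
    have d: "drop k (s RX) = []" "drop k (s RY) = []" "drop k (s RZ) = []" "\<not> c'" "s' = u(RC := [])"
      using k(3-6) c'(1) by (auto simp: at)
    then show ?r using k(1) c' fin[of c'] by (intro exI[of _ k]) auto
  next
    assume ?r
    then obtain k where k: "k \<le> N" "length (s RX) \<le> k" "length (s RY) \<le> k" "length (s RZ) \<le> k"
      "val (s RX) + val (s RY) + (if c then 1 else 0) = val (s RZ)" "s' = s(RX := [], RY := [], RZ := [])" by blast
    have "iterate (exec N addbody) k (addstate s (s RX) (s RY) (s RZ) c) (addstate s [] [] [] False)"
      unfolding iterate_add[OF assms(1-3)] using k by (intro exI[of _ False]) auto
    then show "exec N (add c) s s'"
      unfolding add_def using k(1,6) fin[of False]
      by (auto simp: assms(4) s at intro!: exI[of _ "addstate s [] [] [] False"])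
  qed
  then show ?thesis by (auto intro: le_trans)
qed

section \<open>Comparison tests\<close>

definition clean :: "store \<Rightarrow> bool" where
  "clean s \<longleftrightarrow> s RX = [] \<and> s RY = [] \<and> s RZ = [] \<and> s RC = [] \<and> s RT = [] \<and> s RU = []"

lemma cleanD [simp]: "clean s \<Longrightarrow> s RX = []" "clean s \<Longrightarrow> s RY = []" "clean s \<Longrightarrow> s RZ = []"
  "clean s \<Longrightarrow> s RC = []" "clean s \<Longrightarrow> s RT = []" "clean s \<Longrightarrow> s RU = []"
  by (auto simp: clean_def)

abbreviation temps :: "reg set" where
  "temps \<equiv> {RX, RY, RZ, RC, RT, RU}"

lemma clean_upd [simp]: "A \<notin> temps \<Longrightarrow> clean (s(A := l)) \<longleftrightarrow> clean s"
  unfolding clean_def by auto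

definition test_eq :: "reg \<Rightarrow> reg \<Rightarrow> rprog" where
  "test_eq A B = copy A RX ;; copy B RZ ;; add False"

text \<open>The difference is guessed in \<open>RY\<close> and verified by addition; the carry
  \<open>True\<close> in \<open>test_less\<close> makes the order strict. For lack of negation,
  \<open>test_neq\<close> is the disjunction of the two strict orders.\<close>

definition test_le :: "reg \<Rightarrow> reg \<Rightarrow> rprog" where
  "test_le A B = guess RY ;; copy A RX ;; copy B RZ ;; add False"

definition test_less :: "reg \<Rightarrow> reg \<Rightarrow> rprog" where
  "test_less A B = guess RY ;; copy A RX ;; copy B RZ ;; add True"

definition test_neq :: "reg \<Rightarrow> reg \<Rightarrow> rprog" where
  "test_neq A B = test_less A B [+] test_less B A"

lemma exec_test_eq:
  assumes "clean s" "A \<notin> temps" "B \<notin> temps" "s A = bits_of a" "s B = bits_of b"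
  shows "exec N (test_eq A B) s s' \<longleftrightarrow> a = b \<and> length (bits_of a) \<le> N \<and> s' = s"
proof -
  have "s(RX := bits_of a, RZ := bits_of b, RX := [], RY := [], RZ := []) = s"
    by (rule store_eqI) (use assms(1) in simp_all)
  then show ?thesis using assms by (auto simp: test_eq_def exec_copy exec_add)
qed

lemma exec_test_le:
  assumes "clean s" "A \<notin> temps" "B \<notin> temps" "s A = bits_of a" "s B = bits_of b"
  shows "exec N (test_le A B) s s' \<longleftrightarrow> a \<le> b \<and> length (bits_of b) \<le> N \<and> s' = s"
proof -
  have "s(RY := bits_of y, RX := bits_of a, RZ := bits_of b, RX := [], RY := [], RZ := []) = s" for y
    by (rule store_eqI) (use assms(1) in simp_all)
  then have "exec N (test_le A B) s s' \<longleftrightarrow> (\<exists>y. length (bits_of y) \<le> Suc N \<and> length (bits_of a) \<le> N \<and> length (bits_of b) \<le> N \<and>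
      length (bits_of y) \<le> N \<and> a + y = b \<and> s' = s)"
    using assms by (auto simp: test_le_def exec_copy exec_add exec_guess)
  also have "\<dots> \<longleftrightarrow> a \<le> b \<and> length (bits_of b) \<le> N \<and> s' = s"
    using length_bits_of_mono[of a b] length_bits_of_mono[of "b - a" b] by (auto intro!: exI[of _ "b - a"])
  finally show ?thesis .
qed

lemma exec_test_less:
  assumes "clean s" "A \<notin> temps" "B \<notin> temps" "s A = bits_of a" "s B = bits_of b"
  shows "exec N (test_less A B) s s' \<longleftrightarrow> a < b \<and> length (bits_of b) \<le> N \<and> s' = s"
proof -
  have "s(RY := bits_of y, RX := bits_of a, RZ := bits_of b, RX := [], RY := [], RZ := []) = s" for y
    by (rule store_eqI) (use assms(1) in simp_all)
  then have "exec N (test_less A B) s s' \<longleftrightarrow> (\<exists>y. length (bits_of y) \<le> Suc N \<and> length (bits_of a) \<le> N \<and> length (bits_of b) \<le> N \<and>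
      length (bits_of y) \<le> N \<and> Suc (a + y) = b \<and> s' = s)"
    using assms by (auto simp: test_less_def exec_copy exec_add exec_guess)
  also have "\<dots> \<longleftrightarrow> a < b \<and> length (bits_of b) \<le> N \<and> s' = s"
    using length_bits_of_mono[of a b] length_bits_of_mono[of "b - Suc a" b] by (auto intro!: exI[of _ "b - Suc a"])
  finally show ?thesis .
qed

lemma exec_test_neq:
  assumes "clean s" "A \<notin> temps" "B \<notin> temps" "s A = bits_of a" "s B = bits_of b"
  shows "exec N (test_neq A B) s s' \<longleftrightarrow> a \<noteq> b \<and> length (bits_of a) \<le> N \<and> length (bits_of b) \<le> N \<and> s' = s"
  using length_bits_of_mono[of a b] length_bits_of_mono[of b a]
  by (auto simp: test_neq_def exec_test_less[OF assms] exec_test_less[OF assms(1,3,2,5,4)] linorder_neq_iff)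

text \<open>\<open>mul\<close> consumes \<open>RE\<close>, \<open>RF\<close>, \<open>RJ\<close> and succeeds iff \<open>E * F = J\<close>: for every digit of \<open>E\<close> it subtracts \<open>F\<close>
  from \<open>J\<close> if the digit is 1 (guessing the difference) and halves \<open>J\<close>.\<close>

definition mulbody :: rprog where
  "mulbody = (Pop RE S0 ;; pop_digit RJ False) [+]
     (Pop RE S1 ;; guess RU ;; copy RF RX ;; copy RU RY ;; shift RJ RZ ;; add False ;; shift RU RJ ;; pop_digit RJ False)"

text \<open>With \<open>RX\<close> and \<open>RY\<close> empty, the closing \<open>add False\<close>
  tests whether what is left of \<open>J\<close> is zero.\<close>

definition mul :: rprog where
  "mul = Star mulbody ;; Emp RE ;; clear RF ;; shift RJ RZ ;; add False"

lemma exec_mulbody: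
  assumes "clean s" "bits (s RE)" "bits (s RF)" "bits (s RJ)"
  shows "exec N mulbody s s' \<longleftrightarrow>
    (\<exists>e. s RE = S0 # e \<and> even (val (s RJ)) \<and> s' = s(RE := e, RJ := tl (s RJ))) \<or>
    (\<exists>e u. s RE = S1 # e \<and> length (bits_of u) \<le> N \<and> length (s RF) \<le> N \<and> length (s RJ) \<le> N \<and>
       val (s RF) + u = val (s RJ) \<and> even u \<and> s' = s(RE := e, RJ := tl (bits_of u)))"
proof -
  have s: "s(RE := e, RU := bits_of u, RX := s RF, RY := bits_of u, RJ := [], RZ := s RJ, RX := [], RY := [], RZ := [],
      RU := [], RJ := bits_of u, RJ := tl (bits_of u)) = s(RE := e, RJ := tl (bits_of u))" for e u
    by (rule store_eqI) (use assms(1) in simp_all)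
  have "exec N (Pop RE S0 ;; pop_digit RJ False) s s' \<longleftrightarrow>
      (\<exists>e. s RE = S0 # e \<and> even (val (s RJ)) \<and> s' = s(RE := e, RJ := tl (s RJ)))"
    using assms by (simp add: exec_pop_digit)
  moreover have "exec N (Pop RE S1 ;; guess RU ;; copy RF RX ;; copy RU RY ;; shift RJ RZ ;; add False ;; shift RU RJ ;; pop_digit RJ False) s s' \<longleftrightarrow>
    (\<exists>e u. s RE = S1 # e \<and> length (bits_of u) \<le> N \<and> length (s RF) \<le> N \<and> length (s RJ) \<le> N \<and>
       val (s RF) + u = val (s RJ) \<and> even u \<and> s' = s(RE := e, RU := bits_of u, RX := s RF, RY := bits_of u, RJ := [], RZ := s RJ, RX := [], RY := [], RZ := [],
      RU := [], RJ := bits_of u, RJ := tl (bits_of u)))"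
    using assms by (simp add: exec_pop_digit exec_guess exec_copy exec_shift exec_add) (blast intro: le_SucI)
  ultimately show ?thesis
    by (simp only: mulbody_def exec_simps(5) s)
qed


lemma val_mult_bit: "val (d # e) * f = (if d = S1 then f else 0) + 2 * (val e * f)"
  by (simp add: algebra_simps)

lemma upd2_inject: "A \<noteq> B \<Longrightarrow> s(A := a, B := b) = s(A := a', B := b') \<longleftrightarrow> a = a' \<and> b = b'"
  by (metis fun_upd_same fun_upd_other)

text \<open>The invariant is an equivalence: a successful pass never changes the truth of
  \<open>E * F = J\<close>. Once \<open>E\<close> is exhausted the left side is zero, so soundness
  and completeness both follow from the final test on \<open>J\<close>.\<close>

lemma mulbody_inv:
  assumes "clean s" "bits (s RE)" "bits (s RF)" "bits (s RJ)" "exec N mulbody s s'"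
  shows "\<exists>e j. s' = s(RE := e, RJ := j) \<and> bits e \<and> bits j \<and> length (s RE) = Suc (length e) \<and>
    (val (s RE) * val (s RF) = val (s RJ) \<longleftrightarrow> val e * val (s RF) = val j)"
proof -
  from assms(5) consider e where "s RE = S0 # e" "even (val (s RJ))" "s' = s(RE := e, RJ := tl (s RJ))"
    | e u where "s RE = S1 # e" "val (s RF) + u = val (s RJ)" "even u" "s' = s(RE := e, RJ := tl (bits_of u))"
    unfolding exec_mulbody[OF assms(1-4)] by blast
  then show ?thesis
  proof cases
    case (1 e)
    then show ?thesis using assms(2,4) bits_tl val_tl[OF assms(4)]
      by - (rule exI[of _ e], rule exI[of _ "tl (s RJ)"], (simp add: val_mult_bit del: val.simps))
  next
    case (2 e u)
    obtain t where "u = 2 * t" "val (tl (bits_of u)) = t"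
      using val_tl[of "bits_of u"] 2(3) by simp
    then show ?thesis using 2(1,4) 2(2)[symmetric] assms(2) bits_tl[of "bits_of u"]
      by - (rule exI[of _ e], rule exI[of _ "tl (bits_of u)"], (simp add: val_mult_bit del: val.simps))
  qed
qed

lemma mulbody_run:
  assumes "clean s" "bits (s RE)" "bits (s RF)" "bits (s RJ)" "s RE \<noteq> []"
    and "length (s RF) \<le> N" "length (s RJ) \<le> N" "1 \<le> N" "val (s RE) * val (s RF) = val (s RJ)"
  shows "\<exists>e j. exec N mulbody s (s(RE := e, RJ := j)) \<and> length j \<le> N"
proof (cases "s RE")
  case (Cons d e)
  then consider "d = S0" | "d = S1" using assms(2) by auto
  then show ?thesis
  proof cases
    case 1
    then have "val (s RJ) = 2 * (val e * val (s RF))" using assms(9) Cons by (simp add: val_mult_bit del: val.simps)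
    then have "even (val (s RJ))" by simp
    with 1 show ?thesis
      unfolding exec_mulbody[OF assms(1-4)] using 1 Cons assms(7) by - (rule exI[of _ e], rule exI[of _ "tl (s RJ)"], auto)
  next
    case 2
    \<comment> \<open>The right guess is the difference \<open>J - F\<close>; since \<open>E\<close>
      is odd and \<open>E * F = J\<close>, it equals this even number.\<close>
    let ?u = "2 * (val e * val (s RF))"
    have u: "val (s RF) + ?u = val (s RJ)" using assms(9) Cons 2 by (simp add: val_mult_bit del: val.simps)
    have "length (bits_of ?u) \<le> N" by (rule length_bits_of_val[OF _ assms(7,8)]) (use u in simp)
    then show ?thesis
      unfolding exec_mulbody[OF assms(1-4)] using 2 Cons assms(6,7) u
      by - (rule exI[of _ e], rule exI[of _ "tl (bits_of ?u)"], auto)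
  qed
qed (use assms in simp)

lemma iterate_mul_inv:
  assumes "iterate (exec N mulbody) k s s'" "clean s" "bits (s RE)" "bits (s RF)" "bits (s RJ)"
  shows "\<exists>e j. s' = s(RE := e, RJ := j) \<and> bits e \<and> bits j \<and>
    (val (s RE) * val (s RF) = val (s RJ) \<longleftrightarrow> val e * val (s RF) = val j)"
  using assms
proof (induction k arbitrary: s)
  case 0
  then show ?case by - (rule exI[of _ "s RE"], rule exI[of _ "s RJ"], simp)
next
  case (Suc k)
  then obtain u where u: "exec N mulbody s u" "iterate (exec N mulbody) k u s'" by auto
  from mulbody_inv[OF Suc.prems(2-5) u(1)] obtain e j where ej: "u = s(RE := e, RJ := j)" "bits e" "bits j"
    "val (s RE) * val (s RF) = val (s RJ) \<longleftrightarrow> val e * val (s RF) = val j" by blast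
  have "clean u" "bits (u RE)" "bits (u RF)" "bits (u RJ)" using ej Suc.prems by auto
  from Suc.IH[OF u(2) this] obtain e' j' where "s' = u(RE := e', RJ := j')" "bits e'" "bits j'"
    "val (u RE) * val (u RF) = val (u RJ) \<longleftrightarrow> val e' * val (u RF) = val j'" by blast
  then show ?case using ej by - (rule exI[of _ e'], rule exI[of _ j'], (simp add: fun_upd_twist))
qed

lemma iterate_mul_run:
  assumes "clean s" "bits (s RE)" "bits (s RF)" "bits (s RJ)"
    and "length (s RF) \<le> N" "length (s RJ) \<le> N" "1 \<le> N" "val (s RE) * val (s RF) = val (s RJ)"
  shows "\<exists>j. iterate (exec N mulbody) (length (s RE)) s (s(RE := [], RJ := j)) \<and> length j \<le> N"
  using assms
proof (induction "length (s RE)" arbitrary: s)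
  case 0
  then show ?case by (intro exI[of _ "s RJ"]) (simp add: fun_upd_idem)
next
  case (Suc k)
  then have "s RE \<noteq> []" by auto
  from mulbody_run[OF Suc.prems(1-4) this Suc.prems(5-8)] obtain e j where
    ej: "exec N mulbody s (s(RE := e, RJ := j))" "length j \<le> N" by blast
  let ?u = "s(RE := e, RJ := j)"
  from mulbody_inv[OF Suc.prems(1-4) ej(1)] have
    inv: "bits e" "bits j" "length (s RE) = Suc (length e)" "val e * val (s RF) = val j"
    using Suc.prems(8) by (auto simp: upd2_inject)
  have "\<exists>j'. iterate (exec N mulbody) (length (?u RE)) ?u (?u(RE := [], RJ := j')) \<and> length j' \<le> N"
    by (rule Suc.hyps(1)) (use inv ej(2) Suc.hyps(2) Suc.prems in simp_all)
  then obtain j' where "iterate (exec N mulbody) (length e) ?u (s(RE := [], RJ := j'))" "length j' \<le> N"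
    by (auto simp: fun_upd_twist)
  then show ?case unfolding inv(3) iterate.simps using ej(1) by blast
qed

lemma mul_sound:
  assumes "exec N mul s s'" "clean s" "bits (s RE)" "bits (s RF)" "bits (s RJ)"
  shows "val (s RE) * val (s RF) = val (s RJ) \<and> s' = s(RE := [], RF := [], RJ := [])"
proof -
  from assms(1) obtain k u where u: "iterate (exec N mulbody) k s u" "exec N (Emp RE ;; clear RF ;; shift RJ RZ ;; add False) u s'"
    unfolding mul_def by auto
  from iterate_mul_inv[OF u(1) assms(2-5)] obtain e j where ej: "u = s(RE := e, RJ := j)" "bits e" "bits j"
    "val (s RE) * val (s RF) = val (s RJ) \<longleftrightarrow> val e * val (s RF) = val j" by blast
  have "e = []" "val j = 0" "s' = s(RE := [], RJ := [], RF := [], RX := [], RY := [], RZ := [])"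
    using u(2) assms(2) ej by (auto simp: exec_clear exec_shift exec_add fun_upd_twist)
  moreover have "s(RE := [], RJ := [], RF := [], RX := [], RY := [], RZ := []) = s(RE := [], RF := [], RJ := [])"
    by (rule store_eqI) (use assms(2) in simp_all)
  ultimately show ?thesis using ej(4) by simp
qed

lemma mul_run:
  assumes "clean s" "bits (s RE)" "bits (s RF)" "bits (s RJ)"
    and "length (s RE) \<le> N" "length (s RF) \<le> N" "length (s RJ) \<le> N" "1 \<le> N" "val (s RE) * val (s RF) = val (s RJ)"
  shows "exec N mul s (s(RE := [], RF := [], RJ := []))"
proof -
  from iterate_mul_run[OF assms(1-4,6-9)] obtain j where
    j: "iterate (exec N mulbody) (length (s RE)) s (s(RE := [], RJ := j))" "length j \<le> N" by blast
  from iterate_mul_inv[OF j(1) assms(1-4)] have "bits j \<and> val j = 0"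
    using assms(9) by (auto simp: upd2_inject)
  moreover have "s(RE := [], RJ := [], RF := [], RX := [], RY := [], RZ := []) = s(RE := [], RF := [], RJ := [])"
    by (rule store_eqI) (use assms(1) in simp_all)
  ultimately have "exec N (Emp RE ;; clear RF ;; shift RJ RZ ;; add False) (s(RE := [], RJ := j)) (s(RE := [], RF := [], RJ := []))"
    using assms j(2) by (simp add: exec_clear exec_shift exec_add fun_upd_twist)
  moreover have "exec N (Star mulbody) s (s(RE := [], RJ := j))" using j(1) assms(5) by auto
  ultimately show ?thesis unfolding mul_def exec_simps(4)[of N "Star mulbody"] by blast
qed

text \<open>An item is an obligation on the gates still to be read: \<open>(KV, m, v)\<close> asks for a gate \<open>m\<close> with \<open>v\<close> in
  its result set, \<open>(KM, m, _)\<close> for the existence of a gate \<open>m\<close>, and \<open>(KF, m, _)\<close> forbids a gate \<open>m\<close>.\<close>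

type_synonym item = "sym \<times> nat \<times> nat"

text \<open>Fields are stored with the leading digit on top because one \<open>pour\<close>
  reverses. Popping a field reverses again, so neither direction needs a detour over
  \<open>RT\<close>.\<close>

definition enc_item :: "item \<Rightarrow> sym list" where
  "enc_item = (\<lambda>(k, m, v). k # rev (bits_of m) @ Sep # rev (bits_of v) @ [Sep])"

definition enc_items :: "item list \<Rightarrow> sym list" where
  "enc_items its = concat (map enc_item its)"

lemma enc_items_simps [simp]: "enc_items [] = []" "enc_items (i # its) = enc_item i @ enc_items its"
  by (simp_all add: enc_items_def)

definition push_item :: "reg \<Rightarrow> sym \<Rightarrow> reg \<Rightarrow> reg \<Rightarrow> rprog" where
  "push_item H k A B = Push H Sep ;; pour B H ;; Push H Sep ;; pour A H ;; Push H k"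

lemma exec_push_item:
  assumes "H \<noteq> A" "H \<noteq> B" "A \<noteq> B" "s A = bits_of m" "s B = bits_of v"
  shows "exec N (push_item H k A B) s s' \<longleftrightarrow> length (bits_of m) \<le> N \<and> length (bits_of v) \<le> N \<and>
    s' = s(A := [], B := [], H := enc_item (k, m, v) @ s H)"
  using assms by (auto simp: push_item_def exec_pour enc_item_def fun_upd_apply intro!: ext)

definition pop_field :: "reg \<Rightarrow> reg \<Rightarrow> rprog" where
  "pop_field G R = xfer G [R] ;; Pop G Sep"

lemma append_Sep_inject:
  "bits l \<Longrightarrow> bits l' \<Longrightarrow> l @ Sep # r = l' @ Sep # r' \<longleftrightarrow> l = l' \<and> r = r'"
proof (induction l arbitrary: l')
  case Nil
  then show ?case by (cases l') auto
next
  case (Cons a l)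
  then show ?case by (cases l') auto
qed

lemma exec_pop_field:
  assumes "G \<noteq> R" "s G = rev (bits_of m) @ Sep # g"
  shows "exec N (pop_field G R) s s' \<longleftrightarrow> length (bits_of m) \<le> N \<and> s' = s(G := g, R := bits_of m @ s R)"
proof -
  have "s G = l1 @ Sep # r \<and> bits l1 \<longleftrightarrow> l1 = rev (bits_of m) \<and> r = g" for l1 r
    using bits_bits_of[of m] by (auto simp: assms(2) append_Sep_inject simp del: bits_bits_of)
  moreover have "exec N (pop_field G R) s s' \<longleftrightarrow>
      (\<exists>l1 r. (s G = l1 @ Sep # r \<and> bits l1) \<and> length l1 \<le> N \<and> s' = s(G := r, R := rev l1 @ s R))"
    using assms(1) by (simp add: pop_field_def exec_xfer moved_simps fun_upd_twist[of R G]) blast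
  ultimately show ?thesis by simp
qed

definition pop_item :: "reg \<Rightarrow> sym \<Rightarrow> rprog" where
  "pop_item G k = Pop G k ;; pop_field G RM ;; pop_field G RV"

lemma exec_pop_item:
  assumes "G \<noteq> RM" "G \<noteq> RV" "s G = enc_items its" "s RM = []" "s RV = []"
  shows "exec N (pop_item G k) s s' \<longleftrightarrow> (\<exists>m v its'. its = (k, m, v) # its' \<and> length (bits_of m) \<le> N \<and> length (bits_of v) \<le> N \<and>
    s' = s(G := enc_items its', RM := bits_of m, RV := bits_of v))"
proof (cases its)
  case Nil
  then show ?thesis using assms by (simp add: pop_item_def)
next
  case (Cons i its')
  obtain k' m v where i: "i = (k', m, v)" by (cases i) auto
  have G: "s G = k' # rev (bits_of m) @ Sep # rev (bits_of v) @ Sep # enc_items its'"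
    using Cons i assms(3) by (simp add: enc_item_def)
  have "exec N (pop_item G k) s s' \<longleftrightarrow> k' = k \<and> length (bits_of m) \<le> N \<and> length (bits_of v) \<le> N \<and>
      s' = s(G := enc_items its', RM := bits_of m, RV := bits_of v)"
    using assms(1,2,4,5) by (auto simp: pop_item_def G exec_pop_field fun_upd_twist)
  then show ?thesis using Cons i by auto
qed

section \<open>Expanding items at a gate\<close>

definition fits :: "nat \<Rightarrow> nat \<Rightarrow> bool" where
  "fits N n \<longleftrightarrow> length (bits_of n) \<le> N"

definition fits_its :: "nat \<Rightarrow> item list \<Rightarrow> bool" where
  "fits_its N its \<longleftrightarrow> (\<forall>(k, m, v)\<in>set its. fits N m \<and> fits N v)"

lemma fits_its_simps [simp]: "fits_its N []"
  "fits_its N ((k, m, v) # its) \<longleftrightarrow> fits N m \<and> fits N v \<and> fits_its N its"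
  "fits_its N (its @ its') \<longleftrightarrow> fits_its N its \<and> fits_its N its'"
  by (auto simp: fits_its_def ball_Un)

lemma enc_items_append [simp]: "enc_items (its @ its') = enc_items its @ enc_items its'"
  by (simp add: enc_items_def)

fun comb :: "op \<Rightarrow> nat \<Rightarrow> nat \<Rightarrow> nat \<Rightarrow> bool" where
  "comb OInt v x y \<longleftrightarrow> x = v \<and> y = v"
| "comb OPlus v x y \<longleftrightarrow> v = x + y"
| "comb OTimes v x y \<longleftrightarrow> v = x * y"
| "comb ODiv v x y \<longleftrightarrow> y \<noteq> 0 \<and> x = v * y"
| "comb _ v x y \<longleftrightarrow> False"

text \<open>\<open>expands l qs v os\<close>: to certify that \<open>v\<close> is a result of a gate with label \<open>l\<close> and sorted
  predecessors \<open>qs\<close> it suffices to certify the items \<open>os\<close>.\<close>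

fun expands :: "lab \<Rightarrow> nat list \<Rightarrow> nat \<Rightarrow> item list \<Rightarrow> bool" where
  "expands (LInp a) qs v os \<longleftrightarrow> v = a \<and> os = []"
| "expands (LOp f) qs v os \<longleftrightarrow> (\<exists>p q. qs = [p, q] \<and>
     (if f = OUn then os = [(KV, p, v)] \<or> os = [(KV, q, v)]
      else \<exists>x y. comb f v x y \<and> os = [(KV, q, y), (KV, p, x)]))"

text \<open>\<open>push_item\<close> empties its argument registers, but the predecessor names are
  needed again for further items at the same gate; hence the copies into \<open>RM\<close>.\<close>

definition push2 :: rprog where
  "push2 = copy RP RM ;; push_item RH KV RM RD ;; copy RQ RM ;; push_item RH KV RM RW"

text \<open>Division is checked as the product of quotient and divisor, with \<open>guess1\<close>
  excluding divisor 0. The program for complement can never succeed, since it tests a register for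
  emptiness right after a push.\<close>

fun handler :: "lab \<Rightarrow> rprog" where
  "handler (LInp a) = test_eq RV RA ;; clear RV"
| "handler (LOp OUn) = (copy RP RM [+] copy RQ RM) ;; push_item RH KV RM RV"
| "handler (LOp OInt) = copy RV RD ;; shift RV RW ;; push2"
| "handler (LOp OPlus) = guess RD ;; guess RW ;; copy RD RX ;; copy RW RY ;; shift RV RZ ;; add False ;; push2"
| "handler (LOp OTimes) = guess RD ;; guess RW ;; copy RD RE ;; copy RW RF ;; shift RV RJ ;; mul ;; push2"
| "handler (LOp ODiv) = guess RD ;; guess1 RW ;; shift RV RE ;; copy RW RF ;; copy RD RJ ;; mul ;; push2"
| "handler (LOp OCompl) = Push RV S0 ;; Emp RV"

definition idle :: "store \<Rightarrow> bool" where
  "idle s \<longleftrightarrow> clean s \<and> s RM = [] \<and> s RD = [] \<and> s RW = [] \<and> s RE = [] \<and> s RF = [] \<and> s RJ = []"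

lemma idleD [simp]: "idle s \<Longrightarrow> clean s" "idle s \<Longrightarrow> s RM = []" "idle s \<Longrightarrow> s RD = []" "idle s \<Longrightarrow> s RW = []"
  "idle s \<Longrightarrow> s RE = []" "idle s \<Longrightarrow> s RF = []" "idle s \<Longrightarrow> s RJ = []"
  unfolding idle_def by simp_all

lemma idle_empty [simp]: "idle s \<Longrightarrow> s RX = []" "idle s \<Longrightarrow> s RY = []" "idle s \<Longrightarrow> s RZ = []"
  "idle s \<Longrightarrow> s RC = []" "idle s \<Longrightarrow> s RT = []" "idle s \<Longrightarrow> s RU = []"
  unfolding idle_def by simp_all

abbreviation scratch :: "reg set" where
  "scratch \<equiv> {RX, RY, RZ, RC, RT, RU, RM, RD, RW, RE, RF, RJ}"

lemma idle_upd [simp]: "A \<notin> scratch \<Longrightarrow> idle (s(A := l)) \<longleftrightarrow> idle s"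
  unfolding idle_def by auto

definition operands :: "lab \<Rightarrow> nat list \<Rightarrow> store \<Rightarrow> bool" where
  "operands l qs s \<longleftrightarrow> (case l of LInp a \<Rightarrow> qs = [] \<and> s RA = bits_of a
     | LOp f \<Rightarrow> \<exists>p q. qs = [p, q] \<and> s RP = bits_of p \<and> s RQ = bits_of q)"

lemma operands_upd [simp]: "A \<notin> {RA, RP, RQ} \<Longrightarrow> operands l qs (s(A := x)) \<longleftrightarrow> operands l qs s"
  by (auto simp: operands_def split: lab.splits)

lemma exec_push2:
  assumes "s RM = []" "s RT = []" "s RP = bits_of p" "s RQ = bits_of q" "s RD = bits_of x" "s RW = bits_of y"
  shows "exec N push2 s s' \<longleftrightarrow> fits N p \<and> fits N q \<and> fits N x \<and> fits N y \<and>
    s' = s(RD := [], RW := [], RH := enc_items [(KV, q, y), (KV, p, x)] @ s RH)"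
proof -
  have "s(RM := bits_of p, RM := [], RD := [], RH := enc_item (KV, p, x) @ s RH, RM := bits_of q, RM := [], RW := [],
      RH := enc_item (KV, q, y) @ enc_item (KV, p, x) @ s RH) =
    s(RD := [], RW := [], RH := enc_items [(KV, q, y), (KV, p, x)] @ s RH)"
    by (rule store_eqI) (use assms(1) in simp_all)
  then show ?thesis
    using assms by (auto simp: push2_def exec_copy exec_push_item fits_def)
qed

lemma handler_sound:
  assumes "exec N (handler l) s s'" "idle s" "s RV = bits_of v" "operands l qs s"
  shows "\<exists>os. expands l qs v os \<and> s' = s(RV := [], RH := enc_items os @ s RH)"
proof (cases l)
  case (LInp a)
  then show ?thesis using assms by (auto simp: operands_def exec_test_eq exec_clear intro!: store_eqI)
next
  case (LOp f)
  then obtain p q where pq: "qs = [p, q]" "s RP = bits_of p" "s RQ = bits_of q"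
    using assms(4) by (auto simp: operands_def)
  note [simp] = exec_copy exec_shift exec_guess exec_guess1 exec_add
  have fin: "s(RH := enc_items os @ s RH, RV := []) = s(RV := [], RH := enc_items os @ s RH)" for os
    by (simp add: fun_upd_twist)
  show ?thesis
  proof (cases f)
    case OUn
    then show ?thesis using assms LOp pq
      by (auto simp: exec_push_item fun_upd_idem fun_upd_twist)
  next
    case OInt
    have eq: "s(RD := bits_of v, RV := [], RW := bits_of v, RD := [], RW := [], RH := h) = s(RV := [], RH := h)" for h
      by (rule store_eqI) (use assms(2) in simp_all)
    from OInt show ?thesis using assms LOp pq eq
      by (auto simp: exec_push2)
  next
    case OPlus
    have eq: "s(RD := bits_of x, RW := bits_of y, RX := bits_of x, RY := bits_of y, RV := [], RZ := bits_of v, RX := [], RY := [], RZ := [],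
        RD := [], RW := [], RH := h) = s(RV := [], RH := h)" for x y h
      by (rule store_eqI) (use assms(2) in simp_all)
    from OPlus obtain x y where "x + y = v"
        "exec N push2 (s(RD := bits_of x, RW := bits_of y, RX := bits_of x, RY := bits_of y, RV := [], RZ := bits_of v, RX := [], RY := [], RZ := [])) s'"
      using assms LOp pq by auto
    then show ?thesis using OPlus assms(2,3) LOp pq eq[of x y] by (auto simp: exec_push2)
  next
    case OTimes
    have eq: "s(RD := bits_of x, RW := bits_of y, RE := bits_of x, RF := bits_of y, RV := [], RJ := bits_of v, RE := [], RF := [], RJ := [],
        RD := [], RW := [], RH := h) = s(RV := [], RH := h)" for x y h
      by (rule store_eqI) (use assms(2) in simp_all)
    from OTimes obtain x y u where
        "exec N mul (s(RD := bits_of x, RW := bits_of y, RE := bits_of x, RF := bits_of y, RV := [], RJ := bits_of v)) u" "exec N push2 u s'"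
      using assms LOp pq by auto
    moreover from mul_sound[OF this(1)] have "x * y = v"
      "u = s(RD := bits_of x, RW := bits_of y, RE := bits_of x, RF := bits_of y, RV := [], RJ := bits_of v, RE := [], RF := [], RJ := [])"
      using assms(2) by auto
    ultimately show ?thesis using OTimes assms(2,3) LOp pq eq[of x y] by (auto simp: exec_push2)
  next
    case ODiv
    have eq: "s(RD := bits_of x, RW := bits_of y, RV := [], RE := bits_of v, RF := bits_of y, RJ := bits_of x, RE := [], RF := [], RJ := [],
        RD := [], RW := [], RH := h) = s(RV := [], RH := h)" for x y h
      by (rule store_eqI) (use assms(2) in simp_all)
    from ODiv obtain x y u where "1 \<le> y"
        "exec N mul (s(RD := bits_of x, RW := bits_of y, RV := [], RE := bits_of v, RF := bits_of y, RJ := bits_of x)) u" "exec N push2 u s'"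
      using assms LOp pq by auto
    moreover from mul_sound[OF this(2)] have "v * y = x"
      "u = s(RD := bits_of x, RW := bits_of y, RV := [], RE := bits_of v, RF := bits_of y, RJ := bits_of x, RE := [], RF := [], RJ := [])"
      using assms(2) by auto
    ultimately show ?thesis using ODiv assms(2,3) LOp pq eq[of x y] by (auto simp: exec_push2 intro!: exI[of _ y])
  next
    case OCompl
    then show ?thesis using assms LOp by auto
  qed
qed

definition operands_fit :: "nat \<Rightarrow> lab \<Rightarrow> nat list \<Rightarrow> bool" where
  "operands_fit N l qs \<longleftrightarrow> (\<forall>q\<in>set qs. fits N q) \<and> (case l of LInp a \<Rightarrow> fits N a | LOp f \<Rightarrow> True)"

lemma handler_run:
  assumes "idle s" "s RV = bits_of v" "operands l qs s" "expands l qs v os"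
    and "fits N v" "fits_its N os" "operands_fit N l qs" "1 \<le> N"
  shows "exec N (handler l) s (s(RV := [], RH := enc_items os @ s RH))"
proof (cases l)
  case (LInp a)
  then show ?thesis using assms by (auto simp: operands_def exec_test_eq exec_clear operands_fit_def fits_def fun_upd_idem)
next
  case (LOp f)
  then obtain p q where pq: "qs = [p, q]" "s RP = bits_of p" "s RQ = bits_of q"
    using assms(3) by (auto simp: operands_def)
  note [simp] = exec_copy exec_shift exec_guess exec_guess1 exec_add
  show ?thesis
  proof (cases "f = OUn")
    case True
    then show ?thesis using assms LOp pq
      by (auto simp: exec_push_item fun_upd_idem fun_upd_twist operands_fit_def fits_def)
  next
    case False
    then obtain x y where xy: "comb f v x y" "os = [(KV, q, y), (KV, p, x)]"
      using assms(4) LOp pq by auto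
    have fit: "fits N p" "fits N q" "fits N x" "fits N y" "length (bits_of x) \<le> N" "length (bits_of y) \<le> N" "length (bits_of v) \<le> N"
      using assms(5-7) xy pq by (auto simp: operands_fit_def fits_def)
    show ?thesis
    proof (cases f)
      case OInt
      have eq: "s(RD := bits_of v, RV := [], RW := bits_of v, RD := [], RW := [], RH := h) = s(RV := [], RH := h)" for h
        by (rule store_eqI) (use assms(1) in simp_all)
      from OInt show ?thesis using assms(1,2) LOp pq eq xy fit
        by (auto simp: exec_push2)
    next
      case OPlus
      have eq: "s(RD := bits_of x, RW := bits_of y, RX := bits_of x, RY := bits_of y, RV := [], RZ := bits_of v, RX := [], RY := [], RZ := [],
          RD := [], RW := [], RH := h) = s(RV := [], RH := h)" for h
        by (rule store_eqI) (use assms(1) in simp_all)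
      let ?u = "s(RD := bits_of x, RW := bits_of y, RX := bits_of x, RY := bits_of y, RV := [], RZ := bits_of v, RX := [], RY := [], RZ := [])"
      have "exec N push2 ?u (s(RV := [], RH := enc_items os @ s RH))"
        using exec_push2[of ?u p q x y] assms(1,2) pq eq xy fit by simp
      then show ?thesis using OPlus assms(1,2) LOp pq xy fit
        by simp (rule exI[of _ x], simp)
    next
      case OTimes
      have eq: "s(RD := bits_of x, RW := bits_of y, RE := bits_of x, RF := bits_of y, RV := [], RJ := bits_of v, RE := [], RF := [], RJ := [],
          RD := [], RW := [], RH := h) = s(RV := [], RH := h)" for h
        by (rule store_eqI) (use assms(1) in simp_all)
      let ?u = "s(RD := bits_of x, RW := bits_of y, RE := bits_of x, RF := bits_of y, RV := [], RJ := bits_of v)"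
      have "exec N mul ?u (?u(RE := [], RF := [], RJ := []))"
        by (rule mul_run) (use OTimes assms(1,8) xy fit in auto)
      moreover have "exec N push2 (?u(RE := [], RF := [], RJ := [])) (s(RV := [], RH := enc_items os @ s RH))"
        using exec_push2[of "?u(RE := [], RF := [], RJ := [])" p q x y] assms(1,2) pq eq xy fit by simp
      ultimately have "exec N (mul ;; push2) ?u (s(RV := [], RH := enc_items os @ s RH))"
        unfolding exec_simps(4) by blast
      \<comment> \<open>Only the compositions before \<open>mul ;; push2\<close> are unfolded; this
        tail enters as one fact, because \<open>mul_run\<close> is an implication and cannot be used
        for rewriting.\<close>
      then show ?thesis using OTimes assms(1,2) LOp pq xy fit
        by (simp del: exec_simps(4) add: exec_simps(4)[of N "copy A B" for A B] exec_simps(4)[of N "guess A" for A]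
            exec_simps(4)[of N "shift A B" for A B])
          (rule exI[of _ x], simp del: exec_simps(4), rule exI[of _ y], simp del: exec_simps(4))
    next
      case ODiv
      have eq: "s(RD := bits_of x, RW := bits_of y, RV := [], RE := bits_of v, RF := bits_of y, RJ := bits_of x, RE := [], RF := [], RJ := [],
          RD := [], RW := [], RH := h) = s(RV := [], RH := h)" for h
        by (rule store_eqI) (use assms(1) in simp_all)
      let ?u = "s(RD := bits_of x, RW := bits_of y, RV := [], RE := bits_of v, RF := bits_of y, RJ := bits_of x)"
      have "exec N mul ?u (?u(RE := [], RF := [], RJ := []))"
        by (rule mul_run) (use ODiv assms(1,8) xy fit in auto)
      moreover have "exec N push2 (?u(RE := [], RF := [], RJ := [])) (s(RV := [], RH := enc_items os @ s RH))"
        using exec_push2[of "?u(RE := [], RF := [], RJ := [])" p q x y] assms(1,2) pq eq xy fit by simp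
      ultimately have "exec N (mul ;; push2) ?u (s(RV := [], RH := enc_items os @ s RH))"
        unfolding exec_simps(4) by blast
      then show ?thesis using ODiv assms(1,2) LOp pq xy fit
        by (simp del: exec_simps(4) add: exec_simps(4)[of N "copy A B" for A B] exec_simps(4)[of N "guess A" for A]
            exec_simps(4)[of N "guess1 A" for A] exec_simps(4)[of N "shift A B" for A B])
          (rule exI[of _ x], simp del: exec_simps(4), rule exI[of _ y], simp del: exec_simps(4))
    qed (use False xy in auto)
  qed
qed

definition keep :: "sym \<Rightarrow> rprog" where
  "keep k = pop_item RG k ;; test_neq RM RN ;; push_item RH k RM RV"

definition process :: "lab \<Rightarrow> rprog" where
  "process l = choices (keep KV) [keep KM, keep KF, pop_item RG KM ;; test_eq RM RN ;; clear RM ;; clear RV,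
     pop_item RG KV ;; test_eq RM RN ;; clear RM ;; handler l]"

text \<open>A \<open>KF\<close> item that names the current gate matches no case: the run dies,
  which is how a repeated name is rejected.\<close>

definition process_rel :: "nat \<Rightarrow> lab \<Rightarrow> nat list \<Rightarrow> item \<Rightarrow> item list \<Rightarrow> bool" where
  "process_rel g l qs = (\<lambda>(k, m, v) os.
     m \<noteq> g \<and> k \<in> {KV, KM, KF} \<and> os = [(k, m, v)] \<or>
     m = g \<and> k = KM \<and> os = [] \<or>
     m = g \<and> k = KV \<and> expands l qs v os)"

lemma idle_popped:
  assumes "idle s" "s RV = []"
  shows "s(RG := a, RM := [], RV := [], RH := h) = s(RG := a, RH := h)"
    "s(RG := a, RM := [], RV := []) = s(RG := a)"
  by (rule store_eqI; use assms in simp)+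

lemma exec_keep:
  assumes "idle s" "s RV = []" "s RN = bits_of g" "s RG = enc_items its"
  shows "exec N (keep k) s s' \<longleftrightarrow> (\<exists>m v its'. its = (k, m, v) # its' \<and> fits N m \<and> fits N v \<and> fits N g \<and> m \<noteq> g \<and>
    s' = s(RG := enc_items its', RH := enc_items [(k, m, v)] @ s RH))"
proof -
  have c: "clean (s(RG := enc_items its', RM := bits_of m, RV := bits_of v))" for its' m v
    using assms(1) by simp
  show ?thesis
    using assms idle_popped[OF assms(1,2)]
    by (auto simp: keep_def exec_pop_item exec_test_neq[OF c] exec_push_item fits_def intro!: store_eqI)
qed

lemma exec_discharge:
  assumes "idle s" "s RV = []" "s RN = bits_of g" "s RG = enc_items its"
  shows "exec N (pop_item RG KM ;; test_eq RM RN ;; clear RM ;; clear RV) s s' \<longleftrightarrow>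
    (\<exists>v its'. its = (KM, g, v) # its' \<and> fits N v \<and> fits N g \<and> s' = s(RG := enc_items its'))"
proof -
  have c: "clean (s(RG := enc_items its', RM := bits_of m, RV := bits_of v))" for its' m v
    using assms(1) by simp
  show ?thesis
    using assms idle_popped[OF assms(1,2)]
    by (auto simp: exec_pop_item exec_test_eq[OF c] exec_clear fits_def intro!: store_eqI)
qed

lemma exec_expand:
  assumes "idle s" "s RV = []" "s RN = bits_of g" "s RG = enc_items its"
  shows "exec N (pop_item RG KV ;; test_eq RM RN ;; clear RM ;; handler l) s s' \<longleftrightarrow>
    (\<exists>v its'. its = (KV, g, v) # its' \<and> fits N v \<and> fits N g \<and> exec N (handler l) (s(RG := enc_items its', RV := bits_of v)) s')"
proof -
  have c: "clean (s(RG := enc_items its', RM := bits_of m, RV := bits_of v))" for its' m v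
    using assms(1) by simp
  have e: "s(RG := a, RV := b, RM := []) = s(RG := a, RV := b)" for a b
    by (rule store_eqI) (use assms(1) in simp_all)
  show ?thesis
    using assms e
    by (auto simp: exec_pop_item exec_test_eq[OF c] exec_clear fits_def intro!: store_eqI)
qed

lemma process_sound:
  assumes "exec N (process l) s s'" "idle s" "s RV = []" "s RN = bits_of g" "operands l qs s" "s RG = enc_items its"
  shows "\<exists>it its' os. its = it # its' \<and> process_rel g l qs it os \<and> s' = s(RG := enc_items its', RH := enc_items os @ s RH)"
proof -
  from assms(1) consider k where "k \<in> {KV, KM, KF}" "exec N (keep k) s s'"
    | "exec N (pop_item RG KM ;; test_eq RM RN ;; clear RM ;; clear RV) s s'"
    | "exec N (pop_item RG KV ;; test_eq RM RN ;; clear RM ;; handler l) s s'"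
    unfolding process_def exec_choices by (auto simp del: exec_simps)
  then show ?thesis
  proof cases
    case 1
    then obtain m v its' where "its = (k, m, v) # its'" "m \<noteq> g" "s' = s(RG := enc_items its', RH := enc_items [(k, m, v)] @ s RH)"
      unfolding exec_keep[OF assms(2,3,4,6)] by blast
    then show ?thesis using 1(1)
      by (intro exI[of _ "(k, m, v)"] exI[of _ its'] exI[of _ "[(k, m, v)]"]) (auto simp: process_rel_def)
  next
    case 2
    then obtain v its' where "its = (KM, g, v) # its'" "s' = s(RG := enc_items its')"
      unfolding exec_discharge[OF assms(2,3,4,6)] by blast
    then show ?thesis
      by - (rule exI[of _ "(KM, g, v)"], rule exI[of _ its'], rule exI[of _ "[]"], simp add: process_rel_def fun_upd_idem)
  next
    case 3
    then obtain v its' where v: "its = (KV, g, v) # its'" "exec N (handler l) (s(RG := enc_items its', RV := bits_of v)) s'"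
      unfolding exec_expand[OF assms(2,3,4,6)] by blast
    have "\<exists>os. expands l qs v os \<and> s' = s(RG := enc_items its', RV := bits_of v, RV := [], RH := enc_items os @ (s(RG := enc_items its', RV := bits_of v)) RH)"
      by (rule handler_sound[OF v(2)]) (use assms in simp_all)
    then obtain os where "expands l qs v os" "s' = s(RG := enc_items its', RH := enc_items os @ s RH)"
      using assms(3) by (auto simp: fun_upd_idem)
    then show ?thesis using v(1)
      by - (rule exI[of _ "(KV, g, v)"], rule exI[of _ its'], rule exI[of _ os], simp add: process_rel_def)
  qed
qed

lemma process_run:
  assumes "idle s" "s RV = []" "s RN = bits_of g" "operands l qs s" "s RG = enc_items (it # its)" "process_rel g l qs it os"
    and "fits N g" "operands_fit N l qs" "fits_its N [it]" "fits_its N os" "1 \<le> N"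
  shows "exec N (process l) s (s(RG := enc_items its, RH := enc_items os @ s RH))" (is "exec N _ s ?s'")
proof -
  obtain k m v where it: "it = (k, m, v)" by (cases it) auto
  from assms(6) it consider "m \<noteq> g" "k \<in> {KV, KM, KF}" "os = [(k, m, v)]" | "m = g" "k = KM" "os = []"
    | "m = g" "k = KV" "expands l qs v os"
    by (auto simp: process_rel_def)
  then show ?thesis
  proof cases
    case 1
    then have "exec N (keep k) s ?s'"
      unfolding exec_keep[OF assms(1,2,3,5)] using it assms(7,9) by auto
    then show ?thesis using 1(2) by (auto simp: process_def simp del: exec_simps(4))
  next
    case 2
    then have "exec N (pop_item RG KM ;; test_eq RM RN ;; clear RM ;; clear RV) s ?s'"
      unfolding exec_discharge[OF assms(1,2,3,5)] using it assms(7,9) by (auto simp: fun_upd_idem)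
    then show ?thesis by (auto simp: process_def simp del: exec_simps(4))
  next
    case 3
    have "exec N (handler l) (s(RG := enc_items its, RV := bits_of v))
        (s(RG := enc_items its, RV := bits_of v, RV := [], RH := enc_items os @ (s(RG := enc_items its, RV := bits_of v)) RH))"
      by (rule handler_run[where qs = qs and v = v]) (use assms 3 it in simp_all)
    then have "exec N (pop_item RG KV ;; test_eq RM RN ;; clear RM ;; handler l) s ?s'"
      unfolding exec_expand[OF assms(1,2,3,5)] using it 3 assms(2,7,9) by (auto simp: fun_upd_idem)
    then show ?thesis by (auto simp: process_def simp del: exec_simps(4))
  qed
qed

section \<open>Processing one gate\<close>

lemma fits_mono: "m \<le> n \<Longrightarrow> fits N n \<Longrightarrow> fits N m"
  using length_bits_of_mono unfolding fits_def by (blast intro: le_trans)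

lemma fits_Suc: "fits N n \<Longrightarrow> fits (Suc N) n"
  by (simp add: fits_def)

lemma fits_its_rev [simp]: "fits_its N (rev its) \<longleftrightarrow> fits_its N its"
  by (simp add: fits_its_def)

lemma fits_its_concat_rev [simp]: "fits_its N (concat (rev oss)) \<longleftrightarrow> fits_its N (concat oss)"
  by (simp add: fits_its_def)

definition process_all :: "lab \<Rightarrow> rprog" where
  "process_all l = Star (process l) ;; Emp RG"

text \<open>Replacements pile up on the stack \<open>RH\<close>, so their blocks appear in reverse
  order; this is the origin of \<open>concat (rev oss)\<close>.\<close>

lemma iterate_process_sound:
  assumes "iterate (exec N (process l)) k s s'" "idle s" "s RV = []" "s RN = bits_of g" "operands l qs s" "s RG = enc_items its"
  shows "\<exists>its1 its2 oss. its = its1 @ its2 \<and> list_all2 (process_rel g l qs) its1 oss \<and>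
    s' = s(RG := enc_items its2, RH := enc_items (concat (rev oss)) @ s RH)"
  using assms
proof (induction k arbitrary: s its)
  case 0
  have "s(RG := enc_items its, RH := s RH) = s" using 0 by (simp add: fun_upd_idem)
  then show ?case using 0 by - (rule exI[of _ "[]"], rule exI[of _ its], rule exI[of _ "[]"], simp)
next
  case (Suc k)
  then obtain u where u: "exec N (process l) s u" "iterate (exec N (process l)) k u s'" by auto
  from process_sound[OF u(1) Suc.prems(2-6)] obtain it its' os where
    1: "its = it # its'" "process_rel g l qs it os" "u = s(RG := enc_items its', RH := enc_items os @ s RH)" by blast
  have "\<exists>its1 its2 oss. its' = its1 @ its2 \<and> list_all2 (process_rel g l qs) its1 oss \<and>
    s' = u(RG := enc_items its2, RH := enc_items (concat (rev oss)) @ u RH)"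
    by (rule Suc.IH[OF u(2)]) (use 1 Suc.prems in simp_all)
  then obtain its1 its2 oss where 2: "its' = its1 @ its2" "list_all2 (process_rel g l qs) its1 oss"
    "s' = u(RG := enc_items its2, RH := enc_items (concat (rev oss)) @ u RH)" by blast
  show ?case
    by (rule exI[of _ "it # its1"], rule exI[of _ its2], rule exI[of _ "os # oss"])
      (use 1 2 in \<open>simp add: fun_upd_twist\<close>)
qed

lemma process_all_sound:
  assumes "exec N (process_all l) s s'" "idle s" "s RV = []" "s RN = bits_of g" "operands l qs s" "s RG = enc_items its"
  shows "\<exists>oss. list_all2 (process_rel g l qs) its oss \<and> s' = s(RG := [], RH := enc_items (concat (rev oss)) @ s RH)"
proof -
  from assms(1) obtain k where k: "iterate (exec N (process l)) k s s'" "s' RG = []"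
    by (auto simp: process_all_def)
  from iterate_process_sound[OF k(1) assms(2-6)] obtain its1 its2 oss where
    1: "its = its1 @ its2" "list_all2 (process_rel g l qs) its1 oss"
    "s' = s(RG := enc_items its2, RH := enc_items (concat (rev oss)) @ s RH)" by blast
  have "its2 = []" using k(2) 1(3) by (cases its2) (auto simp: enc_item_def)
  then show ?thesis using 1 by auto
qed

lemma iterate_process_run:
  assumes "idle s" "s RV = []" "s RN = bits_of g" "operands l qs s" "s RG = enc_items its" "list_all2 (process_rel g l qs) its oss"
    and "fits N g" "operands_fit N l qs" "fits_its N its" "fits_its N (concat oss)" "1 \<le> N"
  shows "iterate (exec N (process l)) (length its) s (s(RG := [], RH := enc_items (concat (rev oss)) @ s RH))"
  using assms
proof (induction its arbitrary: s oss)
  case Nil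
  then show ?case by (simp add: fun_upd_idem)
next
  case (Cons it its)
  then obtain os oss' where o: "oss = os # oss'" "process_rel g l qs it os" "list_all2 (process_rel g l qs) its oss'"
    by (auto simp: list_all2_Cons1)
  let ?u = "s(RG := enc_items its, RH := enc_items os @ s RH)"
  have "fits_its N [it]" "fits_its N its" using Cons.prems(9) by (cases it, simp)+
  moreover have "fits_its N os" "fits_its N (concat oss')" using Cons.prems(10) o(1) by simp_all
  ultimately have fit: "fits_its N [it]" "fits_its N its" "fits_its N os" "fits_its N (concat oss')" by simp_all
  have "exec N (process l) s ?u"
    by (rule process_run[where it = it]) (use Cons.prems o fit in simp_all)
  moreover have "iterate (exec N (process l)) (length its) ?u (?u(RG := [], RH := enc_items (concat (rev oss')) @ ?u RH))"
    by (rule Cons.IH) (use Cons.prems o fit in simp_all)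
  ultimately show ?case using o(1) by (auto simp: fun_upd_twist)
qed

lemma process_all_run:
  assumes "idle s" "s RV = []" "s RN = bits_of g" "operands l qs s" "s RG = enc_items its" "list_all2 (process_rel g l qs) its oss"
    and "fits N g" "operands_fit N l qs" "fits_its N its" "fits_its N (concat oss)" "1 \<le> N" "length its \<le> N"
  shows "exec N (process_all l) s (s(RG := [], RH := enc_items (concat (rev oss)) @ s RH))"
  using iterate_process_run[OF assms(1-11)] assms(12) by (auto simp: process_all_def)

section \<open>Restoring the pending list and marking a gate\<close>

definition move_item :: "sym \<Rightarrow> rprog" where
  "move_item k = pop_item RH k ;; push_item RG k RM RV"

definition move_any :: rprog where
  "move_any = choices (move_item KV) [move_item KM, move_item KF]"

definition move_back :: rprog where
  "move_back = Star move_any ;; Emp RH"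

definition kinds :: "item list \<Rightarrow> bool" where
  "kinds its \<longleftrightarrow> (\<forall>(k, m, v)\<in>set its. k \<in> {KV, KM, KF})"

lemma kinds_simps [simp]: "kinds []" "kinds ((k, m, v) # its) \<longleftrightarrow> k \<in> {KV, KM, KF} \<and> kinds its"
  by (auto simp: kinds_def)

lemma exec_move_item:
  assumes "idle s" "s RV = []" "s RH = enc_items its"
  shows "exec N move_any s s' \<longleftrightarrow> (\<exists>k m v its'. its = (k, m, v) # its' \<and>
    k \<in> {KV, KM, KF} \<and> fits N m \<and> fits N v \<and> s' = s(RH := enc_items its', RG := enc_items [(k, m, v)] @ s RG))"
proof -
  have "exec N (move_item k) s s' \<longleftrightarrow> (\<exists>m v its'. its = (k, m, v) # its' \<and> fits N m \<and> fits N v \<and>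
      s' = s(RH := enc_items its', RG := enc_items [(k, m, v)] @ s RG))" for k
    using assms by (auto simp: move_item_def exec_pop_item exec_push_item fits_def intro!: store_eqI)
  then show ?thesis by (auto simp: move_any_def)
qed

lemma iterate_move_back:
  assumes "idle s" "s RV = []" "s RH = enc_items its"
  shows "iterate (exec N move_any) k s s' \<and> s' RH = [] \<longleftrightarrow>
    k = length its \<and> kinds its \<and> fits_its N its \<and> s' = s(RH := [], RG := enc_items (rev its) @ s RG)"
  using assms
proof (induction its arbitrary: s k)
  case Nil
  then have "s(RH := [], RG := enc_items (rev []) @ s RG) = s" by (simp add: fun_upd_idem)
  moreover have "\<not> exec N move_any s u" for u
    using exec_move_item[OF Nil(1-3)] by simp
  ultimately show ?case using Nil by (cases k) auto
next
  case (Cons it its)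
  obtain k0 m v where it: "it = (k0, m, v)" by (cases it) auto
  show ?case
  proof (cases k)
    case 0
    then show ?thesis using Cons.prems by (auto simp: enc_item_def it)
  next
    case (Suc k')
    let ?u = "s(RH := enc_items its, RG := enc_items [(k0, m, v)] @ s RG)"
    have "iterate (exec N move_any) k s s' \<and> s' RH = [] \<longleftrightarrow>
      k0 \<in> {KV, KM, KF} \<and> fits N m \<and> fits N v \<and>
      (iterate (exec N move_any) k' ?u s' \<and> s' RH = [])"
      unfolding Suc iterate.simps exec_move_item[OF Cons.prems] it by auto
    also have "\<dots> \<longleftrightarrow> k0 \<in> {KV, KM, KF} \<and> fits N m \<and> fits N v \<and>
      (k' = length its \<and> kinds its \<and> fits_its N its \<and> s' = ?u(RH := [], RG := enc_items (rev its) @ ?u RG))"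
      by (subst Cons.IH) (use Cons.prems in simp_all)
    also have "?u(RH := [], RG := enc_items (rev its) @ ?u RG) = s(RH := [], RG := enc_items (rev (it # its)) @ s RG)"
      by (rule store_eqI) (simp_all add: it)
    finally show ?thesis by (auto simp: it Suc)
  qed
qed

lemma exec_move_back:
  assumes "idle s" "s RV = []" "s RH = enc_items its"
  shows "exec N move_back s s' \<longleftrightarrow> length its \<le> N \<and> kinds its \<and> fits_its N its \<and>
    s' = s(RH := [], RG := enc_items (rev its) @ s RG)"
proof -
  have "exec N move_back s s' \<longleftrightarrow> (\<exists>k\<le>N. iterate (exec N move_any) k s s' \<and> s' RH = [])"
    by (auto simp: move_back_def)
  then show ?thesis unfolding iterate_move_back[OF assms] by auto
qed

text \<open>The value 0 is a filler that gives items of all three kinds the same format.\<close>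

definition mark :: "sym \<Rightarrow> reg \<Rightarrow> rprog" where
  "mark k A = copy A RM ;; Push RV S0 ;; push_item RG k RM RV"

lemma exec_mark:
  assumes "idle s" "s RV = []" "s A = bits_of a" "A \<notin> scratch" "A \<noteq> RV"
  shows "exec N (mark k A) s s' \<longleftrightarrow> fits N a \<and> 1 \<le> N \<and> s' = s(RG := enc_item (k, a, 0) @ s RG)"
proof -
  have e: "s(RM := [], RV := [], RG := h) = s(RG := h)" for h
    by (rule store_eqI) (use assms in simp_all)
  show ?thesis
    using assms e exec_push_item[of RG RM RV "s(RM := bits_of a, RV := [S0])" a 0 N k s']
    by (auto simp: mark_def exec_copy fits_def)
qed

section \<open>Parsing and treating a gate\<close>

definition expect_num :: "nat \<Rightarrow> rprog" where
  "expect_num n = expect (hd (enc_nat n)) (tl (enc_nat n))"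

lemma exec_expect_num: "exec N (expect_num n) s s' \<longleftrightarrow> (\<exists>r. s RIn = enc_nat n @ r \<and> s' = s(RIn := r))"
proof -
  have "enc_nat n \<noteq> []" by (simp add: enc_nat_bits_of)
  then show ?thesis by (auto simp: expect_num_def exec_expect) (metis append_Cons list.collapse)+
qed

definition inptail :: rprog where
  "inptail = move_back ;; mark KF RN ;; clear RN ;; clear RA"

definition inpgate :: rprog where
  "inpgate = expect_num 0 ;; read_num RA ;; expect_num 0 ;; process_all (LInp 0) ;; inptail"

definition optail :: rprog where
  "optail = move_back ;; mark KF RN ;; mark KM RP ;; mark KM RQ ;; clear RN ;; clear RP ;; clear RQ"

text \<open>Which of the two listed predecessors is the smaller is guessed and then verified. This
  realizes the \<open>sort\<close> in \<open>sem\<close>, on which the roles of dividend and divisor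
  depend.\<close>

definition read_pair :: rprog where
  "read_pair = (read_num RP ;; read_num RQ [+] read_num RQ ;; read_num RP) ;; test_le RP RQ"

definition opgate :: "op \<Rightarrow> rprog" where
  "opgate f = expect_num (op_code f) ;; expect_num 2 ;; read_pair ;; process_all (LOp f) ;; optail"

lemma exec_inptail:
  assumes "idle s" "s RV = []" "s RN = bits_of g" "s RA = bits_of a" "s RG = []" "s RH = enc_items h"
  shows "exec N inptail s s' \<longleftrightarrow> length h \<le> N \<and> kinds h \<and> fits_its N h \<and> fits N g \<and> fits N a \<and> 1 \<le> N \<and>
    s' = s(RN := [], RA := [], RH := [], RG := enc_items ((KF, g, 0) # rev h))"
  using assms by (auto simp: inptail_def exec_move_back exec_mark exec_clear fits_def fun_upd_twist)

lemma exec_optail: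
  assumes "idle s" "s RV = []" "s RN = bits_of g" "s RP = bits_of p" "s RQ = bits_of q" "s RG = []" "s RH = enc_items h"
  shows "exec N optail s s' \<longleftrightarrow> length h \<le> N \<and> kinds h \<and> fits_its N h \<and> fits N g \<and> fits N p \<and> fits N q \<and> 1 \<le> N \<and>
    s' = s(RN := [], RP := [], RQ := [], RH := [], RG := enc_items ((KM, q, 0) # (KM, p, 0) # (KF, g, 0) # rev h))"
  using assms by (auto simp: optail_def exec_move_back exec_mark exec_clear fits_def fun_upd_twist)

lemma exec_inpgate:
  assumes "s RA = []"
  shows "exec N inpgate s s' \<longleftrightarrow> (\<exists>a i. s RIn = enc_nat 0 @ enc_nat a @ enc_nat 0 @ i \<and> fits (Suc N) a \<and>
    (\<exists>u. exec N (process_all (LInp 0)) (s(RIn := i, RA := bits_of a)) u \<and> exec N inptail u s'))"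
  using assms by (auto simp: inpgate_def exec_expect_num exec_read_num fits_def fun_upd_twist)

lemma exec_read_pair:
  assumes "clean s" "s RP = []" "s RQ = []"
  shows "exec N read_pair s s' \<longleftrightarrow> (\<exists>p q p' q' i. s RIn = enc_nat p' @ enc_nat q' @ i \<and> sort [p', q'] = [p, q] \<and>
    fits N p \<and> fits N q \<and> s' = s(RIn := i, RP := bits_of p, RQ := bits_of q))"
proof -
  have "exec N read_pair s s' \<longleftrightarrow> (\<exists>p q i. (s RIn = enc_nat p @ enc_nat q @ i \<or> s RIn = enc_nat q @ enc_nat p @ i) \<and>
    fits (Suc N) p \<and> fits (Suc N) q \<and> p \<le> q \<and> fits N q \<and> s' = s(RIn := i, RP := bits_of p, RQ := bits_of q))"
    using assms by (simp add: read_pair_def exec_read_num exec_test_le fits_def fun_upd_twist) blast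
  also have "\<dots> \<longleftrightarrow> (\<exists>p q i. (s RIn = enc_nat p @ enc_nat q @ i \<or> s RIn = enc_nat q @ enc_nat p @ i) \<and>
    p \<le> q \<and> fits N p \<and> fits N q \<and> s' = s(RIn := i, RP := bits_of p, RQ := bits_of q))"
    by (blast intro: fits_mono fits_Suc)
  also have "\<dots> \<longleftrightarrow> (\<exists>p q p' q' i. s RIn = enc_nat p' @ enc_nat q' @ i \<and> sort [p', q'] = [p, q] \<and>
    fits N p \<and> fits N q \<and> s' = s(RIn := i, RP := bits_of p, RQ := bits_of q))" (is "?l \<longleftrightarrow> ?r")
  proof
    assume ?l
    then obtain p q i where *: "s RIn = enc_nat p @ enc_nat q @ i \<or> s RIn = enc_nat q @ enc_nat p @ i" "p \<le> q"
      "fits N p \<and> fits N q \<and> s' = s(RIn := i, RP := bits_of p, RQ := bits_of q)" by blast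
    moreover have "sort [p, q] = [p, q]" "sort [q, p] = [p, q]" using *(2) by auto
    ultimately show ?r by blast
  next
    assume ?r
    then obtain p q p' q' i where *: "s RIn = enc_nat p' @ enc_nat q' @ i" "sort [p', q'] = [p, q]"
      "fits N p \<and> fits N q \<and> s' = s(RIn := i, RP := bits_of p, RQ := bits_of q)" by blast
    moreover have "p \<le> q \<and> (p' = p \<and> q' = q \<or> p' = q \<and> q' = p)" using *(2) by (auto split: if_splits)
    ultimately show ?l by blast
  qed
  finally show ?thesis .
qed

lemma exec_opgate:
  assumes "clean s" "s RP = []" "s RQ = []"
  shows "exec N (opgate f) s s' \<longleftrightarrow> (\<exists>p q p' q' i. s RIn = enc_nat (op_code f) @ enc_nat 2 @ enc_nat p' @ enc_nat q' @ i \<and>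
    sort [p', q'] = [p, q] \<and> fits N p \<and> fits N q \<and>
    (\<exists>u. exec N (process_all (LOp f)) (s(RIn := i, RP := bits_of p, RQ := bits_of q)) u \<and> exec N optail u s'))"
  using assms by (simp add: opgate_def exec_expect_num exec_read_pair del: sort_key_simps) blast

definition gatestep :: rprog where
  "gatestep = read_num RN ;; choices inpgate (map opgate [OUn, OInt, OPlus, OTimes, ODiv])"

definition idle_gate :: "store \<Rightarrow> bool" where
  "idle_gate s \<longleftrightarrow> idle s \<and> s RV = [] \<and> s RN = [] \<and> s RP = [] \<and> s RQ = [] \<and> s RA = [] \<and> s RH = []"

lemma idle_gateD [simp]: "idle_gate s \<Longrightarrow> idle s" "idle_gate s \<Longrightarrow> s RV = []" "idle_gate s \<Longrightarrow> s RN = []"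
  "idle_gate s \<Longrightarrow> s RP = []" "idle_gate s \<Longrightarrow> s RQ = []" "idle_gate s \<Longrightarrow> s RA = []" "idle_gate s \<Longrightarrow> s RH = []"
  unfolding idle_gate_def by simp_all

lemma idle_gate_upd [simp]: "A \<notin> scratch \<union> {RV, RN, RP, RQ, RA, RH} \<Longrightarrow> idle_gate (s(A := l)) \<longleftrightarrow> idle_gate s"
  unfolding idle_gate_def by auto

text \<open>Marks are added only after all items have met the gate, so they bind later gates alone:
  \<open>KM\<close> says that the predecessors occur further down the list, \<open>KF\<close> that
  the name does not occur again. The outer reversal of the items comes from moving them back from
  \<open>RH\<close> to \<open>RG\<close>.\<close>

definition gate_rel :: "gate \<Rightarrow> item list \<Rightarrow> item list \<Rightarrow> bool" where
  "gate_rel = (\<lambda>(g, l, ps) its its'. lab_ok {OUn, OInt, OPlus, OTimes, ODiv} l (length ps) \<and>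
     (\<exists>oss. list_all2 (process_rel g l (sort ps)) its oss \<and>
       its' = rev (map (\<lambda>p. (KM, p, 0)) (sort ps)) @ (KF, g, 0) # rev (concat (rev oss))))"

definition gate_syms :: "gate \<Rightarrow> sym list" where
  "gate_syms x = map dig (enc_gate x)"

lemma gate_syms_inp: "gate_syms (g, LInp a, []) = enc_nat g @ enc_nat 0 @ enc_nat a @ enc_nat 0"
  by (simp add: gate_syms_def enc_nat_def)

lemma gate_syms_op: "gate_syms (g, LOp f, [p, q]) = enc_nat g @ enc_nat (op_code f) @ enc_nat 2 @ enc_nat p @ enc_nat q"
  by (simp add: gate_syms_def enc_nat_def numeral_2_eq_2)

lemma process_rel_kinds: "process_rel g l qs it os \<Longrightarrow> kinds os"
  by (cases it; cases l) (auto simp: process_rel_def split: if_splits)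

text \<open>The handler takes the literal from \<open>RA\<close> and ignores the numeral in the
  label. Therefore one fixed program treats input gates with arbitrary literals.\<close>

lemma process_all_LInp: "process_all (LInp a) = process_all (LInp b)"
  by (simp add: process_all_def process_def)

lemma inpgate_sound:
  assumes "exec N inpgate s s'" "idle_gate (s(RN := []))" "s RN = bits_of g" "s RG = enc_items its"
  shows "\<exists>a its' i. s RIn = enc_nat 0 @ enc_nat a @ enc_nat 0 @ i \<and> gate_rel (g, LInp a, []) its its' \<and>
    s' = s(RN := [], RIn := i, RG := enc_items its')"
proof -
  have id: "idle s" "s RV = []" "s RA = []" "s RH = []"
    using assms(2) unfolding idle_gate_def by simp_all
  from assms(1) obtain a i u where a: "s RIn = enc_nat 0 @ enc_nat a @ enc_nat 0 @ i"
    "exec N (process_all (LInp 0)) (s(RIn := i, RA := bits_of a)) u" "exec N inptail u s'"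
    unfolding exec_inpgate[where s = s, OF id(3)] by blast
  have "\<exists>oss. list_all2 (process_rel g (LInp a) []) its oss \<and>
    u = s(RIn := i, RA := bits_of a, RG := [], RH := enc_items (concat (rev oss)) @ (s(RIn := i, RA := bits_of a)) RH)"
    by (rule process_all_sound[OF a(2)[unfolded process_all_LInp[of 0 a]]]) (use id assms in \<open>simp_all add: operands_def\<close>)
  then obtain oss where o: "list_all2 (process_rel g (LInp a) []) its oss"
    "u = s(RIn := i, RA := bits_of a, RG := [], RH := enc_items (concat (rev oss)))" using id by auto
  have "s' = u(RN := [], RA := [], RH := [], RG := enc_items ((KF, g, 0) # rev (concat (rev oss))))"
    using a(3) by (subst (asm) exec_inptail[where g = g and a = a and h = "concat (rev oss)"]) (use id o(2) assms(3) in simp_all)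
  also have "\<dots> = s(RN := [], RIn := i, RG := enc_items ((KF, g, 0) # rev (concat (rev oss))))"
    unfolding o(2) by (rule store_eqI) (use id in simp_all)
  finally show ?thesis using a(1) o(1)
    by - (rule exI[of _ a], rule exI[of _ "(KF, g, 0) # rev (concat (rev oss))"], rule exI[of _ i],
      simp add: gate_rel_def, blast)
qed

lemma opgate_sound:
  assumes "exec N (opgate f) s s'" "idle_gate (s(RN := []))" "s RN = bits_of g" "s RG = enc_items its"
    and "f \<in> {OUn, OInt, OPlus, OTimes, ODiv}"
  shows "\<exists>p q its' i. s RIn = enc_nat (op_code f) @ enc_nat 2 @ enc_nat p @ enc_nat q @ i \<and> gate_rel (g, LOp f, [p, q]) its its' \<and>
    s' = s(RN := [], RIn := i, RG := enc_items its')"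
proof -
  have id: "idle s" "s RV = []" "s RP = []" "s RQ = []" "s RH = []"
    using assms(2) unfolding idle_gate_def by simp_all
  from assms(1) obtain p q p' q' i u where a: "s RIn = enc_nat (op_code f) @ enc_nat 2 @ enc_nat p' @ enc_nat q' @ i"
    "sort [p', q'] = [p, q]"
    "exec N (process_all (LOp f)) (s(RIn := i, RP := bits_of p, RQ := bits_of q)) u" "exec N optail u s'"
    unfolding exec_opgate[where s = s, OF idleD(1)[OF id(1)] id(3,4)] by blast
  have "\<exists>oss. list_all2 (process_rel g (LOp f) [p, q]) its oss \<and>
    u = s(RIn := i, RP := bits_of p, RQ := bits_of q, RG := [], RH := enc_items (concat (rev oss)) @ (s(RIn := i, RP := bits_of p, RQ := bits_of q)) RH)"
    by (rule process_all_sound[OF a(3)]) (use id assms in \<open>simp_all add: operands_def\<close>)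
  then obtain oss where o: "list_all2 (process_rel g (LOp f) [p, q]) its oss"
    "u = s(RIn := i, RP := bits_of p, RQ := bits_of q, RG := [], RH := enc_items (concat (rev oss)))" using id by auto
  let ?its = "(KM, q, 0) # (KM, p, 0) # (KF, g, 0) # rev (concat (rev oss))"
  have "s' = u(RN := [], RP := [], RQ := [], RH := [], RG := enc_items ?its)"
    using a(4) by (subst (asm) exec_optail[where g = g and p = p and q = q and h = "concat (rev oss)"])
      (use id o(2) assms(3) in simp_all)
  also have "\<dots> = s(RN := [], RIn := i, RG := enc_items ?its)"
    unfolding o(2) by (rule store_eqI) (use id in simp_all)
  finally have s': "s' = s(RN := [], RIn := i, RG := enc_items ?its)" .
  have "gate_rel (g, LOp f, [p', q']) its ?its"
    unfolding gate_rel_def using o(1) assms(5) by (cases f) (simp_all add: a(2) del: sort_key_simps, blast+)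
  then show ?thesis using a(1) s' by blast
qed

theorem gatestep_sound:
  assumes "exec N gatestep s s'" "idle_gate s" "s RG = enc_items its"
  shows "\<exists>x its' i. s RIn = gate_syms x @ i \<and> gate_rel x its its' \<and> s' = s(RIn := i, RG := enc_items its')"
proof -
  from assms(1) obtain g i where g: "s RIn = enc_nat g @ i"
    "exec N (choices inpgate (map opgate [OUn, OInt, OPlus, OTimes, ODiv])) (s(RIn := i, RN := bits_of g)) s'"
    using assms(2) by (auto simp: gatestep_def exec_read_num simp del: choices.simps list.map)
  let ?u = "s(RIn := i, RN := bits_of g)"
  have u: "idle_gate (?u(RN := []))" "?u RN = bits_of g" "?u RG = enc_items its"
    using assms by (simp_all add: fun_upd_twist fun_upd_idem)
  have restore: "?u(RN := [], RIn := i', RG := h) = s(RIn := i', RG := h)" for i' h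
    by (rule store_eqI) (use assms in simp_all)
  from g(2) consider "exec N inpgate ?u s'" | f where "f \<in> {OUn, OInt, OPlus, OTimes, ODiv}" "exec N (opgate f) ?u s'"
    unfolding exec_choices by auto
  then show ?thesis
  proof cases
    case 1
    from inpgate_sound[OF this u] obtain a its' i' where
      "i = enc_nat 0 @ enc_nat a @ enc_nat 0 @ i'" "gate_rel (g, LInp a, []) its its'" "s' = s(RIn := i', RG := enc_items its')"
      unfolding restore by auto
    then show ?thesis using g(1)
      by - (rule exI[of _ "(g, LInp a, [])"], rule exI[of _ its'], rule exI[of _ i'], simp add: gate_syms_inp)
  next
    case 2
    from opgate_sound[OF 2(2) u 2(1)] obtain p q its' i' where
      "i = enc_nat (op_code f) @ enc_nat 2 @ enc_nat p @ enc_nat q @ i'" "gate_rel (g, LOp f, [p, q]) its its'" "s' = s(RIn := i', RG := enc_items its')"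
      unfolding restore by auto
    then show ?thesis using g(1)
      by - (rule exI[of _ "(g, LOp f, [p, q])"], rule exI[of _ its'], rule exI[of _ i'], simp add: gate_syms_op)
  qed
qed

fun gate_fits :: "nat \<Rightarrow> gate \<Rightarrow> bool" where
  "gate_fits N (g, l, ps) \<longleftrightarrow> fits N g \<and> (\<forall>p\<in>set ps. fits N p) \<and> (case l of LInp a \<Rightarrow> fits N a | LOp f \<Rightarrow> True)"

theorem gatestep_run:
  assumes "idle_gate s" "s RG = enc_items its" "s RIn = gate_syms x @ i" "gate_rel x its its'"
    and "gate_fits N x" "fits_its N its" "fits_its N its'" "length its \<le> N" "length its' \<le> N" "1 \<le> N"
  shows "exec N gatestep s (s(RIn := i, RG := enc_items its'))"
proof -
  obtain g l ps where x: "x = (g, l, ps)" by (cases x) auto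
  from assms(4) obtain oss where o: "lab_ok {OUn, OInt, OPlus, OTimes, ODiv} l (length ps)"
    "list_all2 (process_rel g l (sort ps)) its oss"
    "its' = rev (map (\<lambda>p. (KM, p, 0)) (sort ps)) @ (KF, g, 0) # rev (concat (rev oss))"
    unfolding gate_rel_def x by auto
  let ?h = "concat (rev oss)"
  have "fits N g" "\<forall>p\<in>set ps. fits N p" using assms(5) x by simp_all
  moreover have "fits_its N (concat oss)" using assms(7) unfolding o(3) by simp
  moreover have "length ?h \<le> N" using assms(9) unfolding o(3) by simp
  ultimately have fit: "fits N g" "\<forall>p\<in>set ps. fits N p" "fits_its N (concat oss)" "fits_its N ?h" "length ?h \<le> N"
    by simp_all
  have "kinds os" if "os \<in> set oss" for os
  proof -
    from that obtain j where "j < length oss" "oss ! j = os" by (auto simp: in_set_conv_nth)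
    with o(2) have "process_rel g l (sort ps) (its ! j) os" by (auto simp: list_all2_conv_all_nth)
    then show ?thesis by (rule process_rel_kinds)
  qed
  then have kinds: "kinds ?h" unfolding kinds_def by auto
  have id: "idle s" "clean s" "s RV = []" "s RN = []" "s RP = []" "s RQ = []" "s RA = []" "s RH = []"
    using assms(1) by simp_all
  show ?thesis
  proof (cases l)
    case (LInp a)
    then have ps: "ps = []" using o(1) by simp
    let ?s = "s(RIn := i, RN := bits_of g, RA := bits_of a)"
    have a: "fits N a" using assms(5) x LInp by simp
    have 1: "exec N (process_all (LInp 0)) ?s (?s(RG := [], RH := enc_items ?h @ ?s RH))"
      unfolding process_all_LInp[of 0 a]
      by (rule process_all_run[where qs = "[]" and g = g and its = its])
        (use o(2) ps LInp id fit assms a in \<open>simp_all add: operands_def operands_fit_def\<close>)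
    have 2: "exec N inptail (?s(RG := [], RH := enc_items ?h @ ?s RH)) (s(RIn := i, RG := enc_items its'))"
      by (subst exec_inptail[where g = g and a = a and h = ?h])
        (use o(3) ps id fit a kinds assms(10) in \<open>auto intro!: store_eqI\<close>)
    let ?i = "enc_nat 0 @ enc_nat a @ enc_nat 0 @ i"
    have "exec N inpgate (s(RIn := ?i, RN := bits_of g)) (s(RIn := i, RG := enc_items its'))"
      by (subst exec_inpgate) (use id 1 2 a in \<open>auto simp: fits_def fun_upd_twist\<close>)
    then show ?thesis
      using id assms(3) fit(1) x LInp ps
      by (simp add: gatestep_def exec_read_num gate_syms_inp fits_def fun_upd_twist)
  next
    case (LOp f)
    then have f: "f \<in> {OUn, OInt, OPlus, OTimes, ODiv}" "length ps = 2" using o(1) by (cases f; simp)+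
    then obtain p' q' where ps: "ps = [p', q']" by (auto simp: numeral_2_eq_2 length_Suc_conv)
    obtain p q where pq: "sort ps = [p, q]" using ps by (cases "p' \<le> q'") auto
    have fpq: "fits N p" "fits N q" using fit(2) pq by (metis set_sort list.set_intros)+
    let ?s = "s(RIn := i, RN := bits_of g, RP := bits_of p, RQ := bits_of q)"
    have 1: "exec N (process_all (LOp f)) ?s (?s(RG := [], RH := enc_items ?h @ ?s RH))"
      by (rule process_all_run[where qs = "[p, q]" and g = g and its = its])
        (use o(2) pq LOp id fit fpq assms in \<open>simp_all add: operands_def operands_fit_def\<close>)
    have 2: "exec N optail (?s(RG := [], RH := enc_items ?h @ ?s RH)) (s(RIn := i, RG := enc_items its'))"
      by (subst exec_optail[where g = g and p = p and q = q and h = ?h])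
        (use o(3) pq id fit fpq kinds assms(10) in \<open>auto intro!: store_eqI\<close>)
    let ?i = "enc_nat (op_code f) @ enc_nat 2 @ enc_nat p' @ enc_nat q' @ i"
    have "exec N (opgate f) (s(RIn := ?i, RN := bits_of g)) (s(RIn := i, RG := enc_items its'))"
    proof (subst exec_opgate)
      show "\<exists>p0 q0 p'' q'' i'. (s(RIn := ?i, RN := bits_of g)) RIn = enc_nat (op_code f) @ enc_nat 2 @ enc_nat p'' @ enc_nat q'' @ i' \<and>
        sort [p'', q''] = [p0, q0] \<and> fits N p0 \<and> fits N q0 \<and>
        (\<exists>u. exec N (process_all (LOp f)) (s(RIn := ?i, RN := bits_of g, RIn := i', RP := bits_of p0, RQ := bits_of q0)) u \<and>
          exec N optail u (s(RIn := i, RG := enc_items its')))"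
        using 1 2 pq ps fpq
        by - (rule exI[of _ p], rule exI[of _ q], rule exI[of _ p'], rule exI[of _ q'], rule exI[of _ i],
            auto simp: fun_upd_twist simp del: sort_key_simps)
    qed (use id in simp_all)
    then have "exec N (choices inpgate (map opgate [OUn, OInt, OPlus, OTimes, ODiv])) (s(RIn := ?i, RN := bits_of g)) (s(RIn := i, RG := enc_items its'))"
      using f(1) unfolding exec_choices by auto
    then show ?thesis
      using id assms(3) fit(1) x LOp ps
      by (simp add: gatestep_def exec_read_num gate_syms_op fits_def fun_upd_twist del: choices.simps list.map)
  qed
qed

section \<open>Processing a circuit\<close>

text \<open>With \<open>RY\<close> empty, \<open>add True\<close> accepts exactly the guess whose
  successor is the counter. At counter 0 there is none, so no more gates are read than the encoding
  announces.\<close>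

definition decrement :: rprog where
  "decrement = guess RW ;; copy RW RX ;; shift RK RZ ;; add True ;; shift RW RK"

lemma exec_decrement:
  assumes "idle s" "s RK = bits_of n"
  shows "exec N decrement s s' \<longleftrightarrow> (\<exists>k. n = Suc k \<and> fits N n \<and> s' = s(RK := bits_of k))"
proof -
  have e: "s(RW := bits_of k, RX := bits_of k, RK := [], RZ := bits_of n, RX := [], RY := [], RZ := [], RW := [], RK := bits_of k) = s(RK := bits_of k)" for k
    by (rule store_eqI) (use assms in simp_all)
  have "exec N decrement s s' \<longleftrightarrow> (\<exists>k. fits (Suc N) k \<and> fits N k \<and> fits N n \<and> n = Suc k \<and>
      s' = s(RW := bits_of k, RX := bits_of k, RK := [], RZ := bits_of n, RX := [], RY := [], RZ := [], RW := [], RK := bits_of k))"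
    using assms by (auto simp: decrement_def exec_guess exec_copy exec_shift exec_add fits_def)
  also have "\<dots> \<longleftrightarrow> (\<exists>k. n = Suc k \<and> fits N n \<and> s' = s(RK := bits_of k))"
    unfolding e using fits_mono[of _ n N] fits_Suc by (metis Suc_n_not_le_n nat_le_linear)
  finally show ?thesis .
qed

fun gates_rel :: "gate list \<Rightarrow> item list \<Rightarrow> item list \<Rightarrow> bool" where
  "gates_rel [] its its' \<longleftrightarrow> its' = its"
| "gates_rel (x # gs) its its' \<longleftrightarrow> (\<exists>u. gate_rel x its u \<and> gates_rel gs u its')"

text \<open>The loops traverse every intermediate list and every number in it, so completeness needs
  the size conditions at each stage and not only at the ends.\<close>

fun gates_run :: "nat \<Rightarrow> gate list \<Rightarrow> item list \<Rightarrow> item list \<Rightarrow> bool" where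
  "gates_run N [] its its' \<longleftrightarrow> its' = its \<and> fits_its N its \<and> length its \<le> N"
| "gates_run N (x # gs) its its' \<longleftrightarrow> gate_fits N x \<and> fits_its N its \<and> length its \<le> N \<and>
     (\<exists>u. gate_rel x its u \<and> gates_run N gs u its')"

lemma gates_run_first: "gates_run N gs its its' \<Longrightarrow> fits_its N its \<and> length its \<le> N"
  by (cases gs) auto

lemma gates_run_last: "gates_run N gs its its' \<Longrightarrow> fits_its N its' \<and> length its' \<le> N"
  by (induction gs arbitrary: its) auto

lemma iterate_gates_sound:
  assumes "iterate (exec N (gatestep ;; decrement)) k s s'" "idle_gate s" "s RG = enc_items its" "s RK = bits_of n"
  shows "\<exists>gs its' i. length gs = k \<and> k \<le> n \<and> s RIn = concat (map gate_syms gs) @ i \<and> gates_rel gs its its' \<and>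
    s' = s(RIn := i, RG := enc_items its', RK := bits_of (n - k))"
  using assms
proof (induction k arbitrary: s its n)
  case 0
  then have "s(RIn := s RIn, RG := enc_items its, RK := bits_of n) = s" by (simp add: fun_upd_idem)
  then show ?case using 0 by - (rule exI[of _ "[]"], rule exI[of _ its], rule exI[of _ "s RIn"], simp)
next
  case (Suc k)
  from Suc.prems(1) obtain u t where u: "exec N gatestep s u" "exec N decrement u t" "iterate (exec N (gatestep ;; decrement)) k t s'"
    unfolding iterate.simps exec_simps(4) by blast
  from gatestep_sound[OF u(1) Suc.prems(2,3)] obtain x its' i where
    1: "s RIn = gate_syms x @ i" "gate_rel x its its'" "u = s(RIn := i, RG := enc_items its')" by blast
  have "idle u" "u RK = bits_of n" using 1 Suc.prems by simp_all
  from u(2)[unfolded exec_decrement[OF this]] obtain n' where 2: "n = Suc n'" "t = u(RK := bits_of n')" by blast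
  have "\<exists>gs its2 i'. length gs = k \<and> k \<le> n' \<and> t RIn = concat (map gate_syms gs) @ i' \<and> gates_rel gs its' its2 \<and>
    s' = t(RIn := i', RG := enc_items its2, RK := bits_of (n' - k))"
    by (rule Suc.IH[OF u(3)]) (use 1 2 Suc.prems in simp_all)
  then obtain gs its2 i' where 3: "length gs = k" "k \<le> n'" "t RIn = concat (map gate_syms gs) @ i'" "gates_rel gs its' its2"
    "s' = t(RIn := i', RG := enc_items its2, RK := bits_of (n' - k))" by blast
  have "s' = s(RIn := i', RG := enc_items its2, RK := bits_of (n - Suc k))"
    unfolding 3(5) 2 1(3) by (rule store_eqI) simp_all
  then show ?case using 1 2 3
    by - (rule exI[of _ "x # gs"], rule exI[of _ its2], rule exI[of _ i'], auto)
qed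

lemma iterate_gates_run:
  assumes "gates_run N gs its its'" "idle_gate s" "s RG = enc_items its" "s RK = bits_of (length gs)"
    and "s RIn = concat (map gate_syms gs) @ i" "fits N (length gs)" "1 \<le> N"
  shows "iterate (exec N (gatestep ;; decrement)) (length gs) s (s(RIn := i, RG := enc_items its', RK := bits_of 0))"
  using assms
proof (induction gs arbitrary: s its)
  case Nil
  then have "s(RIn := i, RG := enc_items its', RK := bits_of 0) = s" by (simp add: fun_upd_idem)
  then show ?case by simp
next
  case (Cons x gs)
  from Cons.prems(1) obtain u where u: "gate_rel x its u" "gates_run N gs u its'" "gate_fits N x" "fits_its N its" "length its \<le> N"
    by auto
  let ?i = "concat (map gate_syms gs) @ i"
  let ?t = "s(RIn := ?i, RG := enc_items u)"
  have "exec N gatestep s ?t"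
    by (rule gatestep_run[where its = its and x = x]) (use u gates_run_first[OF u(2)] Cons.prems in simp_all)
  moreover have "exec N decrement ?t (?t(RK := bits_of (length gs)))"
    using Cons.prems by (subst exec_decrement[where n = "Suc (length gs)"]) simp_all
  moreover have "iterate (exec N (gatestep ;; decrement)) (length gs) (?t(RK := bits_of (length gs)))
      (?t(RK := bits_of (length gs), RIn := i, RG := enc_items its', RK := bits_of 0))"
    by (rule Cons.IH[where its = u]) (use u Cons.prems fits_mono[of "length gs" "Suc (length gs)" N] in simp_all)
  moreover have "?t(RK := bits_of (length gs), RIn := i, RG := enc_items its', RK := bits_of 0) = s(RIn := i, RG := enc_items its', RK := bits_of 0)"
    by (rule store_eqI) simp_all
  ultimately show ?case unfolding list.size iterate.simps exec_simps(4) by auto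
qed

definition popforbid :: rprog where
  "popforbid = pop_item RG KF ;; clear RM ;; clear RV"

text \<open>After the last gate a prohibition can no longer be violated, whereas a leftover
  \<open>KV\<close> or \<open>KM\<close> is a demand that no gate has met.\<close>

definition drop_forbidden :: rprog where
  "drop_forbidden = Star popforbid ;; Emp RG"

lemma iterate_popforbid:
  assumes "idle s" "s RV = []" "s RG = enc_items its"
  shows "iterate (exec N popforbid) k s s' \<and> s' RG = [] \<longleftrightarrow>
    k = length its \<and> (\<forall>it\<in>set its. fst it = KF) \<and> fits_its N its \<and> s' = s(RG := [])"
  using assms
proof (induction its arbitrary: s k)
  case Nil
  then have "\<not> exec N popforbid s u" for u by (simp add: popforbid_def exec_pop_item[where its = "[]"])
  then show ?case using Nil by (cases k) (auto simp: fun_upd_idem)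
next
  case (Cons it its)
  obtain k0 m v where it: "it = (k0, m, v)" by (cases it) auto
  have "exec N popforbid s u \<longleftrightarrow> k0 = KF \<and> fits N m \<and> fits N v \<and> u = s(RG := enc_items its)" for u
    using Cons.prems exec_pop_item[of RG s "it # its" N KF]
    by (auto simp: popforbid_def exec_clear it fits_def intro!: store_eqI)
  note 1 = this
  show ?case
  proof (cases k)
    case 0
    then show ?thesis using Cons.prems by (auto simp: enc_item_def it)
  next
    case (Suc k')
    have "iterate (exec N popforbid) k s s' \<and> s' RG = [] \<longleftrightarrow> k0 = KF \<and> fits N m \<and> fits N v \<and>
      (iterate (exec N popforbid) k' (s(RG := enc_items its)) s' \<and> s' RG = [])"
      unfolding Suc iterate.simps 1 by blast
    also have "\<dots> \<longleftrightarrow> k0 = KF \<and> fits N m \<and> fits N v \<and>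
      (k' = length its \<and> (\<forall>it\<in>set its. fst it = KF) \<and> fits_its N its \<and> s' = s(RG := enc_items its, RG := []))"
      by (subst Cons.IH) (use Cons.prems in simp_all)
    finally show ?thesis by (auto simp: it Suc)
  qed
qed

lemma exec_drop_forbidden:
  assumes "idle s" "s RV = []" "s RG = enc_items its"
  shows "exec N drop_forbidden s s' \<longleftrightarrow> length its \<le> N \<and> (\<forall>it\<in>set its. fst it = KF) \<and> fits_its N its \<and> s' = s(RG := [])"
proof -
  have "exec N drop_forbidden s s' \<longleftrightarrow> (\<exists>k\<le>N. iterate (exec N popforbid) k s s' \<and> s' RG = [])"
    by (auto simp: drop_forbidden_def)
  then show ?thesis unfolding iterate_popforbid[OF assms] by auto
qed

text \<open>The guessed target is duplicated: one copy enters the first item, the other waits in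
  \<open>RB\<close> until the true target is reached in the input.\<close>

definition mc_start :: rprog where
  "mc_start = read_num RM ;; read_num RK ;; guess RB ;; copy RB RV ;; push_item RG KV RM RV"

text \<open>The counter must be zero. With \<open>RY\<close> empty, \<open>add False\<close>
  compares the number just read with the guessed target, and \<open>Emp RIn\<close> excludes
  trailing input.\<close>

definition mc_finish :: rprog where
  "mc_finish = Pop RK S0 ;; Emp RK ;; read_num RX ;; shift RB RZ ;; add False ;; Emp RIn ;; drop_forbidden"

definition mc_prog :: rprog where
  "mc_prog = mc_start ;; Star (gatestep ;; decrement) ;; mc_finish"

definition empty_store :: store where
  "empty_store = (\<lambda>_. [])"

lemma empty_store_simps [simp]: "empty_store r = []" "idle_gate empty_store" "idle empty_store" "clean empty_store"
  unfolding idle_gate_def idle_def clean_def by (simp_all add: empty_store_def)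

lemma exec_mc_start: "exec N mc_start (empty_store(RIn := x)) s' \<longleftrightarrow> (\<exists>out n b i. x = enc_nat out @ enc_nat n @ i \<and>
    fits N out \<and> fits (Suc N) n \<and> fits N b \<and>
    s' = empty_store(RIn := i, RK := bits_of n, RB := bits_of b, RG := enc_items [(KV, out, b)]))"
proof -
  have e: "empty_store(RIn := i, RM := [], RK := bits_of n, RB := bits_of b, RV := [], RG := enc_items [(KV, out, b)]) =
    empty_store(RIn := i, RK := bits_of n, RB := bits_of b, RG := enc_items [(KV, out, b)])" for i n b out
    by (rule store_eqI) simp_all
  show ?thesis (is "?l \<longleftrightarrow> ?r")
  proof
    assume ?l
    then show ?r
      by (auto simp: mc_start_def exec_read_num exec_guess exec_copy exec_push_item fits_def) (auto intro!: store_eqI)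
  next
    assume ?r
    then obtain out n b i where *: "x = enc_nat out @ enc_nat n @ i" "fits N out" "fits (Suc N) n" "fits N b"
      "s' = empty_store(RIn := i, RK := bits_of n, RB := bits_of b, RG := enc_items [(KV, out, b)])" by blast
    let ?s1 = "empty_store(RIn := enc_nat n @ i, RM := bits_of out)"
    let ?s2 = "?s1(RIn := i, RK := bits_of n)"
    let ?s3 = "?s2(RB := bits_of b)"
    let ?s4 = "?s3(RV := bits_of b)"
    have "exec N (read_num RM) (empty_store(RIn := x)) ?s1" using * fits_Suc by (simp add: exec_read_num fits_def)
    moreover have "exec N (read_num RK) ?s1 ?s2" using * by (simp add: exec_read_num fits_def)
    moreover have "exec N (guess RB) ?s2 ?s3" using * by (simp add: exec_guess fits_def) (rule exI[of _ b], simp)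
    moreover have "exec N (copy RB RV) ?s3 ?s4" using * by (simp add: exec_copy fits_def)
    moreover have "exec N (push_item RG KV RM RV) ?s4 s'"
      using * e by (subst exec_push_item[where m = out and v = b]) (simp_all add: fits_def fun_upd_twist)
    ultimately show ?l unfolding mc_start_def exec_simps(4) by blast
  qed
qed

lemma exec_mc_finish:
  assumes "idle s" "s RV = []" "s RG = enc_items its" "s RK = bits_of n" "s RB = bits_of b"
  shows "(\<exists>s'. exec N mc_finish s s') \<longleftrightarrow> n = 0 \<and> s RIn = enc_nat b \<and> fits N b \<and>
    length its \<le> N \<and> (\<forall>it\<in>set its. fst it = KF) \<and> fits_its N its"
proof -
  have n: "bits_of n = [S0] \<longleftrightarrow> n = 0" by (metis bits_of_0 bits_of_inject)
  have "idle (s(RB := [], RIn := [], RK := [], RX := [], RY := [], RZ := []))"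
    unfolding idle_def clean_def using assms(1) by simp
  then have fin: "exec N drop_forbidden (s(RB := [], RIn := [], RK := [], RX := [], RY := [], RZ := [])) s' \<longleftrightarrow> length its \<le> N \<and>
      (\<forall>it\<in>set its. fst it = KF) \<and> fits_its N its \<and> s' = s(RB := [], RIn := [], RK := [], RX := [], RY := [], RZ := [], RG := [])" for s'
    by (rule exec_drop_forbidden) (use assms in simp_all)
  show ?thesis
    using assms by (auto simp: mc_finish_def exec_read_num exec_shift exec_add fits_def n fin fun_upd_twist)
qed


lemma map_dig_instance: "map dig (enc_instance out gs b) = enc_nat out @ enc_nat (length gs) @ concat (map gate_syms gs) @ enc_nat b"
  by (simp add: enc_instance_def enc_nat_def gate_syms_def[abs_def] map_concat comp_def)

lemma load_empty_store: "load RIn S0 S1 w = empty_store(RIn := map dig w)"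
  by (simp add: load_def empty_store_def dig_def[abs_def])

theorem mc_prog_sound:
  assumes "exec N mc_prog (load RIn S0 S1 w) s'"
  shows "\<exists>out gs b its. w = enc_instance out gs b \<and> gates_rel gs [(KV, out, b)] its \<and> (\<forall>it\<in>set its. fst it = KF)"
proof -
  from assms obtain u t k where u: "exec N mc_start (empty_store(RIn := map dig w)) u"
    "iterate (exec N (gatestep ;; decrement)) k u t" "exec N mc_finish t s'"
    unfolding mc_prog_def load_empty_store exec_simps(4)[of N mc_start] exec_simps(4)[of N "Star p" for p] exec_simps(6) by blast
  from u(1)[unfolded exec_mc_start] obtain out n b i where
    1: "map dig w = enc_nat out @ enc_nat n @ i" "u = empty_store(RIn := i, RK := bits_of n, RB := bits_of b, RG := enc_items [(KV, out, b)])" by blast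
  from iterate_gates_sound[OF u(2), of "[(KV, out, b)]" n] 1(2) obtain gs its i' where
    2: "length gs = k" "k \<le> n" "u RIn = concat (map gate_syms gs) @ i'" "gates_rel gs [(KV, out, b)] its"
    "t = u(RIn := i', RG := enc_items its, RK := bits_of (n - k))" by auto
  have "n - k = 0 \<and> t RIn = enc_nat b \<and> fits N b \<and> length its \<le> N \<and> (\<forall>it\<in>set its. fst it = KF) \<and> fits_its N its"
    by (rule iffD1[OF exec_mc_finish]) (use u(3) 1(2) 2(5) in \<open>auto simp: fun_upd_twist\<close>)
  then have 3: "n = length gs" "i' = enc_nat b" "\<forall>it\<in>set its. fst it = KF" using 2 by auto
  have "map dig w = map dig (enc_instance out gs b)"
    unfolding map_dig_instance 1(1) using 2(3) 1(2) 3 by simp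
  then have "w = enc_instance out gs b" by (rule map_injective) (simp add: inj_def)
  then show ?thesis using 2(4) 3(3) by blast
qed

theorem mc_prog_run:
  assumes "gates_run N gs [(KV, out, b)] its" "\<forall>it\<in>set its. fst it = KF" "fits N (length gs)" "1 \<le> N" "length gs \<le> N"
  shows "\<exists>s'. exec N mc_prog (load RIn S0 S1 (enc_instance out gs b)) s'"
proof -
  have f: "fits N out" "fits N b" using gates_run_first[OF assms(1)] by simp_all
  let ?i = "concat (map gate_syms gs) @ enc_nat b"
  let ?u = "empty_store(RIn := ?i, RK := bits_of (length gs), RB := bits_of b, RG := enc_items [(KV, out, b)])"
  let ?t = "?u(RIn := enc_nat b, RG := enc_items its, RK := bits_of 0)"
  have "exec N mc_start (load RIn S0 S1 (enc_instance out gs b)) ?u"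
    unfolding load_empty_store map_dig_instance exec_mc_start using f assms(3) fits_Suc by blast
  moreover have "iterate (exec N (gatestep ;; decrement)) (length gs) ?u ?t"
    by (rule iterate_gates_run[where its = "[(KV, out, b)]"]) (use assms in simp_all)
  moreover have "\<exists>s'. exec N mc_finish ?t s'"
    by (subst exec_mc_finish[where its = its and n = 0 and b = b])
      (use f assms gates_run_last[OF assms(1)] in simp_all)
  ultimately show ?thesis
    unfolding mc_prog_def exec_simps(4)[of N mc_start] exec_simps(4)[of N "Star p" for p] exec_simps(6) using assms(5) by blast
qed

section \<open>Certificates and result sets\<close>

abbreviation names :: "gate list \<Rightarrow> nat set" where
  "names gs \<equiv> set (map fst gs)"

abbreviation (input) div_ops :: "op set" where
  "div_ops \<equiv> {OUn, OInt, OPlus, OTimes, ODiv}"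

fun wf_gates :: "gate list \<Rightarrow> bool" where
  "wf_gates [] \<longleftrightarrow> True"
| "wf_gates ((g, l, ps) # gs) \<longleftrightarrow> g \<notin> names gs \<and> set ps \<subseteq> names gs \<and> lab_ok div_ops l (length ps) \<and> wf_gates gs"

lemma wf_circuit_wf_gates: "wf_circuit div_ops out gs \<longleftrightarrow> wf_gates gs \<and> out \<in> names gs"
proof -
  have "distinct (map fst gs) \<and> (\<forall>i < length gs. case gs ! i of (g, l, ps) \<Rightarrow>
      (\<forall>p \<in> set ps. p \<in> set (map fst (drop (Suc i) gs))) \<and> lab_ok div_ops l (length ps)) \<longleftrightarrow> wf_gates gs"
  proof (induction gs)
    case (Cons x gs)
    then show ?case
      by (cases x) (auto simp: All_less_Suc2 simp del: lab_ok.simps)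
  qed simp
  then show ?thesis unfolding wf_circuit_def by auto
qed

definition valid_item :: "gate list \<Rightarrow> item \<Rightarrow> bool" where
  "valid_item gs = (\<lambda>(k, m, v). k = KV \<and> m \<in> names gs \<and> v \<in> sem gs m \<or> k = KM \<and> m \<in> names gs \<or> k = KF \<and> m \<notin> names gs)"

lemma sem_Cons: "sem ((g, l, ps) # gs) m = (if m = g then eval_lab l (map (sem gs) (sort ps)) else sem gs m)"
  by (simp add: Let_def)

text \<open>A set operation has an element exactly if suitable operand elements exist. Sizes are
  left out on purpose: a quotient gives no bound on the dividend and divisor that witness
  it.\<close>

lemma expands_sem:
  assumes "lab_ok div_ops l (length ps)"
  shows "v \<in> eval_lab l (map S (sort ps)) \<longleftrightarrow> (\<exists>os. expands l (sort ps) v os \<and> (\<forall>(k, m, x)\<in>set os. x \<in> S m))"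
proof (cases l)
  case (LOp f)
  then have f: "f \<in> div_ops" "length (sort ps) = 2" using assms by (cases f; simp)+
  from f(2) obtain p q where pq: "sort ps = [p, q]"
    unfolding numeral_2_eq_2 length_Suc_conv length_0_conv by blast
  show ?thesis
  proof (cases "f = OUn")
    case True
    then show ?thesis unfolding LOp pq by (auto simp: ex_disj_distrib)
  next
    case False
    have "v \<in> eval_lab l [S p, S q] \<longleftrightarrow> (\<exists>x y. comb f v x y \<and> x \<in> S p \<and> y \<in> S q)"
      using f(1) False LOp by (cases f) (auto simp: set_plus_def set_times_def set_div_def)
    also have "\<dots> \<longleftrightarrow> (\<exists>os. expands l [p, q] v os \<and> (\<forall>(k, m, x)\<in>set os. x \<in> S m))"
      unfolding LOp using False by auto
    finally show ?thesis unfolding pq by simp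
  qed
qed simp

lemma expands_items:
  "expands l qs v os \<Longrightarrow> length os \<le> 2 \<and> (\<forall>(k, m, x)\<in>set os. k = KV \<and> m \<in> set qs)"
  by (cases l) (auto split: if_splits)

lemma process_rel_sound:
  assumes "process_rel g l (sort ps) it os" "\<forall>j\<in>set os. valid_item gs j" "g \<notin> names gs" "lab_ok div_ops l (length ps)"
  shows "valid_item ((g, l, ps) # gs) it"
proof -
  obtain k m v where it: "it = (k, m, v)" by (cases it) auto
  from assms(1) consider "m \<noteq> g" "os = [(k, m, v)]" | "m = g" "k = KM" | "m = g" "k = KV" "expands l (sort ps) v os"
    unfolding process_rel_def it by auto
  then show ?thesis
  proof cases
    case 1
    then show ?thesis using assms(2) by (auto simp: valid_item_def it Let_def)
  next
    case 2
    then show ?thesis by (simp add: valid_item_def it)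
  next
    case 3
    have "\<forall>(k, m, x)\<in>set os. x \<in> sem gs m"
      using assms(2) expands_items[OF 3(3)] by (fastforce simp: valid_item_def)
    then have "v \<in> eval_lab l (map (sem gs) (sort ps))"
      using 3(3) unfolding expands_sem[OF assms(4)] by blast
    then show ?thesis using 3 by (simp add: valid_item_def it Let_def)
  qed
qed

text \<open>The last conjunct records where a replacement comes from: it is the old item, or it asks
  a predecessor for a value from its result set. The size bound on new items in
  \<open>gates_run_complete\<close> rests on this.\<close>

lemma process_rel_complete:
  assumes "valid_item ((g, l, ps) # gs) it" "set ps \<subseteq> names gs" "lab_ok div_ops l (length ps)"
  shows "\<exists>os. process_rel g l (sort ps) it os \<and> length os \<le> 2 \<and>
    (\<forall>j\<in>set os. valid_item gs j \<and> (j = it \<or> fst (snd j) \<in> set ps \<and> snd (snd j) \<in> sem gs (fst (snd j))))"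
proof -
  obtain k m v where it: "it = (k, m, v)" by (cases it) auto
  show ?thesis
  proof (cases "m = g")
    case False
    then show ?thesis using assms(1)
      by (intro exI[of _ "[it]"]) (auto simp: process_rel_def valid_item_def it Let_def)
  next
    case True
    with assms(1) consider "k = KM" | "k = KV" "v \<in> eval_lab l (map (sem gs) (sort ps))"
      by (auto simp: valid_item_def it Let_def)
    then show ?thesis
    proof cases
      case 1
      then show ?thesis using True by (intro exI[of _ "[]"]) (simp add: process_rel_def it)
    next
      case 2
      then obtain os where os: "expands l (sort ps) v os" "\<forall>(k, m, x)\<in>set os. x \<in> sem gs m"
        unfolding expands_sem[OF assms(3)] by blast
      have "\<forall>j\<in>set os. valid_item gs j \<and> (j = it \<or> fst (snd j) \<in> set ps \<and> snd (snd j) \<in> sem gs (fst (snd j)))"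
        using os(2) expands_items[OF os(1)] assms(2) by (fastforce simp: valid_item_def)
      then show ?thesis using os(1) expands_items[OF os(1)] 2 True
        by (intro exI[of _ os]) (simp add: process_rel_def it)
    qed
  qed
qed

text \<open>Validity travels backwards from the end, where prohibitions hold because no gate is
  left. Well-formedness need not be assumed: freshness of a name and presence of the predecessors
  are read off from the validity of the marks made at that gate.\<close>

theorem gates_rel_sound:
  assumes "gates_rel gs its its'" "\<forall>it\<in>set its'. fst it = KF"
  shows "wf_gates gs \<and> (\<forall>it\<in>set its. valid_item gs it)"
  using assms
proof (induction gs arbitrary: its)
  case Nil
  then show ?case by (auto simp: valid_item_def)
next
  case (Cons x gs)
  obtain g l ps where x: "x = (g, l, ps)" by (cases x) auto
  from Cons.prems obtain u where u: "gate_rel x its u" "gates_rel gs u its'" by auto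
  from Cons.IH[OF u(2) Cons.prems(2)] have IH: "wf_gates gs" "\<forall>it\<in>set u. valid_item gs it" by auto
  from u(1) obtain oss where o: "lab_ok div_ops l (length ps)" "list_all2 (process_rel g l (sort ps)) its oss"
    "u = rev (map (\<lambda>p. (KM, p, 0)) (sort ps)) @ (KF, g, 0) # rev (concat (rev oss))"
    unfolding gate_rel_def x by auto
  have su: "set u = (\<lambda>p. (KM, p, 0)) ` set ps \<union> {(KF, g, 0)} \<union> (\<Union>os\<in>set oss. set os)"
    unfolding o(3) by auto
  have "valid_item gs (KF, g, 0)" "\<forall>p\<in>set ps. valid_item gs (KM, p, 0)" using IH(2) unfolding su by auto
  then have g: "g \<notin> names gs" "set ps \<subseteq> names gs" by (auto simp: valid_item_def)
  have "valid_item (x # gs) it" if "it \<in> set its" for it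
  proof -
    from that obtain j where j: "j < length its" "its ! j = it" by (auto simp: in_set_conv_nth)
    with o(2) have "process_rel g l (sort ps) it (oss ! j)" "oss ! j \<in> set oss" by (auto simp: list_all2_conv_all_nth)
    then show ?thesis unfolding x using process_rel_sound[OF _ _ g(1) o(1)] IH(2) unfolding su by blast
  qed
  then show ?case using x g o(1) IH(1) by simp
qed

section \<open>Bounds\<close>

definition literals_less :: "nat \<Rightarrow> gate list \<Rightarrow> bool" where
  "literals_less c gs \<longleftrightarrow> (\<forall>(g, l, ps)\<in>set gs. \<forall>a. l = LInp a \<longrightarrow> a < c)"

text \<open>Division cannot leave the range of its dividends because \<open>a = c * b\<close> with \<open>b \<noteq> 0\<close> forces \<open>c \<le> a\<close>.\<close>

lemma eval_lab_less:
  assumes "lab_ok div_ops l (length As)" "\<forall>A\<in>set As. A \<subseteq> {..<2 ^ e}" "1 \<le> e" "\<And>a. l = LInp a \<Longrightarrow> a < 2 ^ (2 * e)"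
    and "v \<in> eval_lab l As"
  shows "v < 2 ^ (2 * e)"
proof (cases l)
  case (LInp a)
  then show ?thesis using assms by simp
next
  case (LOp f)
  then have f: "f \<in> div_ops" "length As = 2" using assms(1) by (cases f; simp)+
  then obtain A B where AB: "As = [A, B]" by (auto simp: numeral_2_eq_2 length_Suc_conv)
  have le: "(2::nat) ^ e \<le> 2 ^ (2 * e)" by (rule power_increasing) auto
  have less: "x < 2 ^ e" if "x \<in> A \<union> B" for x using that assms(2) AB by auto
  show ?thesis
  proof (cases f)
    case OPlus
    then obtain x y where xy: "v = x + y" "x \<in> A" "y \<in> B" using assms(5) LOp AB by (auto simp: set_plus_def)
    have "v < 2 ^ e + 2 ^ e" unfolding xy(1) using xy by (intro add_strict_mono less) auto
    also have "\<dots> = 2 ^ Suc e" by simp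
    also have "\<dots> \<le> 2 ^ (2 * e)" by (rule power_increasing) (use assms(3) in auto)
    finally show ?thesis .
  next
    case OTimes
    then obtain x y where xy: "v = x * y" "x \<in> A" "y \<in> B" using assms(5) LOp AB by (auto simp: set_times_def)
    have "x < 2 ^ e" "y < 2 ^ e" using xy less by auto
    then have "v < 2 ^ e * 2 ^ e" unfolding xy(1) by (intro mult_strict_mono) auto
    then show ?thesis by (simp add: power_add[symmetric] mult_2)
  next
    case ODiv
    then obtain x y where xy: "x = v * y" "x \<in> A" "y \<noteq> 0" using assms(5) LOp AB by (auto simp: set_div_def)
    have "v * 1 \<le> v * y" by (rule mult_le_mono2) (use xy(3) in simp)
    then have "v \<le> x" using xy(1) by simp
    also have "x < 2 ^ e" using xy less by auto
    finally show ?thesis using le by linarith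
  next
    case OUn
    then have "v < 2 ^ e" using assms(5) LOp AB less by auto
    then show ?thesis using le by linarith
  next
    case OInt
    then have "v < 2 ^ e" using assms(5) LOp AB less by auto
    then show ?thesis using le by linarith
  qed (use f in simp)
qed

text \<open>Values cannot be bounded downwards from the target, since undoing a division leads to
  larger numbers. The bound is built up from the literals instead, for all elements of all result
  sets: multiplication is the worst case and doubles the exponent at each gate.\<close>

lemma sem_less:
  assumes "wf_gates gs" "literals_less (2 ^ c) gs" "1 \<le> c" "v \<in> sem gs m"
  shows "v < 2 ^ (c * 2 ^ length gs)"
  using assms(1,2,4)
proof (induction gs arbitrary: v m)
  case (Cons x gs)
  obtain g l ps where x: "x = (g, l, ps)" by (cases x) auto
  let ?e = "c * 2 ^ length gs"
  have IH: "v < 2 ^ ?e" if "v \<in> sem gs m" for v m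
    using Cons.IH[OF _ _ that] Cons.prems(1,2) x by (auto simp: literals_less_def)
  have e: "c * 2 ^ length (x # gs) = 2 * ?e" by simp
  have c: "c \<le> ?e" by simp
  show ?case
  proof (cases "m = g")
    case True
    have "a < 2 ^ (2 * ?e)" if "l = LInp a" for a
    proof -
      have "a < 2 ^ c" using Cons.prems(2) that x by (auto simp: literals_less_def)
      also have "(2::nat) ^ c \<le> 2 ^ (2 * ?e)" by (rule power_increasing) (use c in linarith, simp)
      finally show ?thesis .
    qed
    moreover have "v \<in> eval_lab l (map (sem gs) (sort ps))" using Cons.prems(3) True unfolding x sem_Cons by simp
    moreover have "1 \<le> ?e" using c assms(3) by linarith
    moreover have "lab_ok div_ops l (length (map (sem gs) (sort ps)))" using Cons.prems(1) x by simp
    moreover have "\<forall>A\<in>set (map (sem gs) (sort ps)). A \<subseteq> {..<2 ^ ?e}" using IH by auto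
    ultimately show ?thesis unfolding e by (rule_tac eval_lab_less)
  next
    case False
    then have "v < 2 ^ ?e" using Cons.prems(3) IH unfolding x sem_Cons by simp
    also have "(2::nat) ^ ?e \<le> 2 ^ (2 * ?e)" by (rule power_increasing) auto
    finally show ?thesis unfolding e .
  qed
qed simp

lemma length_concat_map_le: "(\<And>x. x \<in> set xs \<Longrightarrow> length (f x) \<le> k) \<Longrightarrow> length (concat (map f xs)) \<le> k * length xs"
  by (induction xs) (auto intro: add_mono)

text \<open>The quantity \<open>length its + 3\<close> serves as a potential. An item has at most
  two replacements and a gate adds at most three marks, so \<open>L\<close> items become at most
  \<open>2 * L + 3\<close>, and the potential at most doubles per gate.\<close>

theorem gates_run_complete:
  assumes "wf_gates gs" "\<forall>it\<in>set its. valid_item gs it" "\<forall>x\<in>set gs. gate_fits N x" "fits_its N its"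
    and "literals_less (2 ^ c) gs" "1 \<le> c" "c * 2 ^ length gs \<le> N" "(length its + 3) * 2 ^ length gs \<le> N"
  shows "\<exists>its'. gates_run N gs its its' \<and> (\<forall>it\<in>set its'. fst it = KF)"
  using assms
proof (induction gs arbitrary: its)
  case Nil
  then show ?case by (auto simp: valid_item_def)
next
  case (Cons x gs)
  obtain g l ps where x: "x = (g, l, ps)" by (cases x) auto
  have wf: "g \<notin> names gs" "set ps \<subseteq> names gs" "lab_ok div_ops l (length ps)" "wf_gates gs"
    using Cons.prems(1) x by auto
  have lit: "literals_less (2 ^ c) gs" using Cons.prems(5) by (simp add: literals_less_def)
  have cN: "c * 2 ^ length gs \<le> N" using Cons.prems(7) by simp
  have "1 * 1 \<le> c * 2 ^ length gs" by (rule mult_le_mono) (use Cons.prems(6) in simp_all)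
  then have N: "1 \<le> N" using cN by linarith
  have val: "fits N v" if "v \<in> sem gs m" for v m
  proof -
    \<comment> \<open>Replacements ask for values of gates in the remaining list, so the bound for
      that list applies.\<close>
    have "v < 2 ^ (c * 2 ^ length gs)" by (rule sem_less[OF wf(4) lit Cons.prems(6) that])
    also have "(2::nat) ^ (c * 2 ^ length gs) \<le> 2 ^ N" by (rule power_increasing[OF cN]) simp
    finally show ?thesis unfolding fits_def by (rule length_bits_of_le) (rule N)
  qed
  have gf: "gate_fits N x" "fits N g" "\<forall>p\<in>set ps. fits N p" using Cons.prems(3) x by auto
  have "\<forall>it\<in>set its. \<exists>os. process_rel g l (sort ps) it os \<and> length os \<le> 2 \<and>
    (\<forall>j\<in>set os. valid_item gs j \<and> (j = it \<or> fst (snd j) \<in> set ps \<and> snd (snd j) \<in> sem gs (fst (snd j))))"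
    using process_rel_complete[OF _ wf(2,3)] Cons.prems(2) unfolding x by blast
  from bchoice[OF this] obtain F where F: "process_rel g l (sort ps) it (F it) \<and> length (F it) \<le> 2 \<and>
    (\<forall>j\<in>set (F it). valid_item gs j \<and> (j = it \<or> fst (snd j) \<in> set ps \<and> snd (snd j) \<in> sem gs (fst (snd j))))"
    if "it \<in> set its" for it
    by blast
  let ?oss = "map F its"
  let ?u = "rev (map (\<lambda>p. (KM, p, 0)) (sort ps)) @ (KF, g, 0) # rev (concat (rev ?oss))"
  have "list_all2 (process_rel g l (sort ps)) its ?oss"
    unfolding list_all2_map2 list_all2_same using F by blast
  then have rel: "gate_rel x its ?u"
    unfolding gate_rel_def x prod.case using wf(3) by blast
  have set_u: "set ?u = (\<lambda>p. (KM, p, 0)) ` set ps \<union> {(KF, g, 0)} \<union> (\<Union>it\<in>set its. set (F it))" by auto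
  have "valid_item gs (KM, p, 0)" if "p \<in> set ps" for p using that wf(2) by (auto simp: valid_item_def)
  moreover have "valid_item gs (KF, g, 0)" using wf(1) by (simp add: valid_item_def)
  moreover have "valid_item gs j" if "it \<in> set its" "j \<in> set (F it)" for it j using F that by blast
  ultimately have good_u: "\<forall>j\<in>set ?u. valid_item gs j" unfolding set_u by blast
  have zero: "fits N 0" using N by (simp add: fits_def)
  have fits_F: "fits_its N (F it)" if it: "it \<in> set its" for it
    unfolding fits_its_def
  proof clarify
    fix k m v assume j: "(k, m, v) \<in> set (F it)"
    have "(k, m, v) = it \<or> m \<in> set ps \<and> v \<in> sem gs m"
      using conjunct2[OF conjunct2[OF F[OF it]], THEN bspec, OF j] by simp
    then show "fits N m \<and> fits N v"
    proof
      assume "(k, m, v) = it"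
      then show ?thesis using Cons.prems(4) it unfolding fits_its_def by fast
    next
      assume "m \<in> set ps \<and> v \<in> sem gs m"
      then show ?thesis using gf(3) val by blast
    qed
  qed
  have "fits_its N (map (\<lambda>p. (KM, p, 0)) (sort ps))" using gf(3) zero by (auto simp: fits_its_def)
  moreover have "fits_its N (concat ?oss)" using fits_F unfolding fits_its_def by fastforce
  ultimately have fits_u: "fits_its N ?u" using gf(2) zero by simp
  have "length (concat ?oss) \<le> 2 * length its"
    by (rule length_concat_map_le) (use F in blast)
  moreover have "length (concat (rev ?oss)) = length (concat ?oss)"
    by (simp add: length_concat rev_map[symmetric] sum_list_rev)
  moreover have "length ps \<le> 2" using wf(3) by (cases l; simp; case_tac x2; simp)
  ultimately have "length ?u + 3 \<le> 2 * (length its + 3)" by simp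
  then have "(length ?u + 3) * 2 ^ length gs \<le> 2 * (length its + 3) * 2 ^ length gs" by (rule mult_le_mono1)
  then have len_u: "(length ?u + 3) * 2 ^ length gs \<le> N"
    by (rule le_trans) (use Cons.prems(8) in \<open>simp add: algebra_simps\<close>)
  have "(length its + 3) * 1 \<le> (length its + 3) * 2 ^ length (x # gs)" by (rule mult_le_mono2) simp
  from le_trans[OF this Cons.prems(8)] have len: "length its \<le> N" by simp
  from Cons.IH[OF wf(4) good_u _ fits_u lit Cons.prems(6) cN len_u] Cons.prems(3) obtain its' where
    "gates_run N gs ?u its'" "\<forall>it\<in>set its'. fst it = KF" by auto
  then show ?case unfolding gates_run.simps using rel gf(1) Cons.prems(4) len by blast
qed

lemma length_concat_mem: "x \<in> set xs \<Longrightarrow> length (f x) \<le> length (concat (map f xs))"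
  by (induction xs) auto

lemma length_concat_ge: "(\<And>x. x \<in> set xs \<Longrightarrow> f x \<noteq> []) \<Longrightarrow> length xs \<le> length (concat (map f xs))"
proof (induction xs)
  case (Cons x xs)
  then have "1 \<le> length (f x)" by (simp add: Suc_leI)
  then show ?case using Cons by simp
qed simp

lemma fits_enc_num: "length (enc_num n) \<le> N \<Longrightarrow> fits N n"
proof -
  have "length (concat (map (\<lambda>b. [b, b]) l)) = 2 * length l" for l :: "bool list" by (induction l) auto
  then show "length (enc_num n) \<le> N \<Longrightarrow> fits N n" by (simp add: enc_num_def fits_def bits_of_def)
qed

lemma enc_gate_fits: "length (enc_gate x) \<le> N \<Longrightarrow> gate_fits N x"
proof -
  assume *: "length (enc_gate x) \<le> N"
  obtain g l ps where x: "x = (g, l, ps)" by (cases x) auto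
  have "fits N p" if "p \<in> set ps" for p
    using * length_concat_mem[OF that, of enc_num] unfolding x by (intro fits_enc_num) simp
  then show ?thesis using * unfolding x by (cases l) (auto intro!: fits_enc_num)
qed


lemma enc_gate_ne: "enc_gate x \<noteq> []"
  by (cases x) (simp add: enc_num_def)

lemma exp_bounded_size: "exp_bounded (\<lambda>n. 2 ^ (2 * n + 4))"
proof (rule exp_bounded_pow2)
  fix n :: nat assume "1 \<le> n"
  then have "2 * 2 \<le> (n + 1) * (n + 1)" by (intro mult_le_mono) auto
  then have "4 * (n + 1) \<le> (n + 1) * (n + 1) * (n + 1)" by (intro mult_le_mono1) simp
  then show "2 * n + 4 \<le> (n + 1) ^ 3" by (simp add: power3_eq_cube)
qed

theorem theorem3:
  shows "MC {OUn, OInt, OPlus, OTimes, ODiv} \<in> NEXP"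
proof (rule NEXP_I[where p = mc_prog and r = RIn and z = S0 and e = S1 and N = "\<lambda>n. 2 ^ (2 * n + 4)"])
  show "S0 \<noteq> S1" by simp
  show "exp_bounded (\<lambda>n. 2 ^ (2 * n + 4))" by (rule exp_bounded_size)
  show "[] \<notin> MC div_ops" by (simp add: MC_def enc_instance_def enc_num_def)
  show "w \<in> MC div_ops" if "exec N mc_prog (load RIn S0 S1 w) s'" for w N s'
  proof -
    from mc_prog_sound[OF that] obtain out gs b its where w: "w = enc_instance out gs b"
      "gates_rel gs [(KV, out, b)] its" "\<forall>it\<in>set its. fst it = KF" by blast
    from gates_rel_sound[OF w(2,3)] have "wf_circuit div_ops out gs \<and> b \<in> sem gs out"
      unfolding wf_circuit_wf_gates by (simp add: valid_item_def)
    then show ?thesis using w(1) unfolding MC_def by blast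
  qed
  show "\<exists>s'. exec (2 ^ (2 * length w + 4)) mc_prog (load RIn S0 S1 w) s'" if "w \<in> MC div_ops" for w
  proof -
    from that obtain out gs b where w: "w = enc_instance out gs b" "wf_circuit div_ops out gs" "b \<in> sem gs out"
      unfolding MC_def by blast
    let ?n = "length w"
    \<comment> \<open>A common bound for the digits of all values, at most
      \<open>?n * 2 ^ ?n\<close>, for the number of pending items, at most
      \<open>4 * 2 ^ ?n\<close>, and for the input length itself.\<close>
    let ?N = "2 ^ (2 * ?n + 4) :: nat"
    have wf: "wf_gates gs" "out \<in> names gs" using w(2) unfolding wf_circuit_wf_gates by auto
    have len: "?n = length (enc_num out) + length (enc_num (length gs)) + length (concat (map enc_gate gs)) + length (enc_num b)"
      unfolding w(1) enc_instance_def by simp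
    have "?n < 2 ^ ?n" by (rule less_exp)
    moreover have "(2::nat) ^ ?n \<le> ?N" by (rule power_increasing) auto
    ultimately have nN: "?n \<le> ?N" by linarith
    have n1: "1 \<le> ?n" unfolding len by (simp add: enc_num_def)
    have gs: "length gs \<le> ?n" using length_concat_ge[of gs enc_gate] enc_gate_ne unfolding len by fastforce
    have gate: "gate_fits ?n x" if "x \<in> set gs" for x
      using length_concat_mem[OF that, of enc_gate] unfolding len by (intro enc_gate_fits) linarith
    have up: "gate_fits ?N x" if "gate_fits ?n x" for x
      using that nN by (cases x) (auto simp: fits_def split: lab.splits)
    \<comment> \<open>Literals are written out in the input, so none has more than \<open>?n\<close>
      digits; this supplies the parameter \<open>c\<close> of
      \<open>gates_run_complete\<close>.\<close>
    have lit: "literals_less (2 ^ ?n) gs"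
      unfolding literals_less_def
    proof clarify
      fix g a ps assume "(g, LInp a, ps) \<in> set gs"
      then have "length (bits_of a) \<le> ?n" using gate by (fastforce simp: fits_def)
      then have "(2::nat) ^ length (bits_of a) \<le> 2 ^ ?n" by (rule power_increasing) simp
      from less_le_trans[OF val_less this] show "a < 2 ^ ?n" by simp
    qed
    have p: "(2::nat) ^ length gs \<le> 2 ^ ?n" by (rule power_increasing[OF gs]) simp
    have "?n * 2 ^ length gs \<le> 2 ^ ?n * 2 ^ ?n" by (rule mult_le_mono[OF less_imp_le[OF less_exp] p])
    also have "\<dots> = 2 ^ (2 * ?n)" by (simp add: mult_2 power_add)
    also have "\<dots> \<le> ?N" by (rule power_increasing) auto
    finally have c: "?n * 2 ^ length gs \<le> ?N" .
    have "(1 + 3) * 2 ^ length gs \<le> 4 * (2::nat) ^ ?n"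
      by (rule order_trans[OF _ mult_le_mono2[OF p, of 4]]) simp
    also have "\<dots> = 2 ^ (?n + 2)" by (simp add: power_add)
    also have "\<dots> \<le> ?N" by (rule power_increasing) auto
    finally have i: "(length [(KV, out, b)] + 3) * 2 ^ length gs \<le> ?N" by simp
    have fit: "fits ?N out" "fits ?N (length gs)" "fits ?N b"
      using nN len by (intro fits_enc_num; linarith)+
    have "\<exists>its. gates_run ?N gs [(KV, out, b)] its \<and> (\<forall>it\<in>set its. fst it = KF)"
      by (rule gates_run_complete[OF wf(1) _ _ _ lit n1 c i])
        (use wf(2) w(3) gate up fit in \<open>auto simp: valid_item_def\<close>)
    then obtain its where "gates_run ?N gs [(KV, out, b)] its" "\<forall>it\<in>set its. fst it = KF" by blast
    from mc_prog_run[OF this fit(2)] show ?thesis unfolding w(1)[symmetric] using gs nN by simp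
  qed
qed

end
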